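(* Let $n\ge1$, let $\mathcal{E}$ be a Hilbert space, let $L\in\mathcal{B}(\mathcal{E},\mathcal{F}_n^2\otimes\mathcal{E})$ be a symbol with odometer map $W_L\in\mathcal{B}(\mathcal{F}_n^2\otimes\mathcal{E})$, and let $\Theta\in H^\infty_{\mathcal{B}(\mathcal{E})}(\mathbb{D})$ be the analytic symbol associated with $W_L$. Then: (1) $W_L$ is an isometry if and only if $L\mathcal{E}\subseteq\mathcal{M}^\perp$ and $\Theta$ is inner. (2) $W_L$ is unitary if and only if $L\mathcal{E}\subseteq\mathcal{M}^\perp$ and $\Theta$ is a constant unitary operator-valued function. (3) $W_L$ is invertible if and only if $\Theta$ is invertible in $H^\infty_{\mathcal{B}(\mathcal{E})}(\mathbb{D})$.
   Context: Hilbert spaces are separable and complex; $\mathcal{B}(\mathcal{H},\mathcal{K})$ denotes bounded linear operators. $F_n^+$ is the free monoid of words $\mu=\mu_1\cdots\mu_m$ in the letters $1,\dots,n$, with empty word $\emptyset$. The full Fock space $\mathcal{F}_n^2=\mathbb{C}\Omega\oplus\bigoplus_{k\ge1}(\mathbb{C}^n)^{\otimes k}$ has orthonormal basis $e_\mu=e_{\mu_1}\otimes\cdots\otimes e_{\mu_m}$, $\mu\in F_n^+$, with $e_\emptyset=\Omega$; $e_k^m:=e_k^{\otimes m}$, $e_k^0=\Omega$, and $\Omega$ acts as a unit for left tensoring. For $f\in\mathcal{F}_n^2\otimes\mathcal{E}$, $e_1^p\otimes f$ means left tensoring by $e_1^p$. $\mathcal{M}^\perp:=\overline{\mathrm{span}}\{e_1^m\otimes\xi:m\ge0,\xi\in\mathcal{E}\}$.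 Odometer map: for $L\in\mathcal{B}(\mathcal{E},\mathcal{F}_n^2\otimes\mathcal{E})$, $W_L$ is the operator on $\mathcal{F}_n^2\otimes\mathcal{E}$ given by $W_L(\Omega\otimes\eta)=L\eta$; $W_L(e_n^m\otimes\eta)=e_1^m\otimes L\eta$ for $m\ge1$; and, for a nonempty word $\mu=\mu_1\cdots\mu_m$ having some letter $\ne n$, with $k$ the smallest index such that $\mu_k\neq n$, $W_L(e_\mu\otimes\eta)=e_1^{k-1}\otimes e_{\mu_k+1}\otimes e_{\mu_{k+1}}\otimes\cdots\otimes e_{\mu_m}\otimes\eta$. It is a standing assumption that $W_L$ is a bounded operator on $\mathcal{F}_n^2\otimes\mathcal{E}$. The analytic symbol associated with $W_L$ is $\Theta(z)=\sum_{r\ge0}z^rL_r\in H^\infty_{\mathcal{B}(\mathcal{E})}(\mathbb{D})$ (bounded analytic $\mathcal{B}(\mathcal{E})$-valued functions on the unit disc), where $L_r=(\langle e_1^r,\cdot\rangle\otimes I_{\mathcal{E}})L$ and $\langle e_1^r,\cdot\rangle\otimes I_{\mathcal{E}}:\mathcal{F}_n^2\otimes\mathcal{E}\to\mathcal{E}$ sends $e_\mu\otimes\eta$ to $\eta$ if $e_\mu=e_1^r$ and to $0$ otherwise. $\Theta$ is inner if its boundary values satisfy $\Theta(\zeta)^*\Theta(\zeta)=I_{\mathcal{E}}$ for a.e. $\zeta\in\partial\mathbb{D}$. $\Theta$ is invertible in $H^\infty_{\mathcal{B}(\mathcal{E})}(\mathbb{D})$ if $\Theta(z)$ is invertible for every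 $z\in\mathbb{D}$ and $\Theta^{-1}\in H^\infty_{\mathcal{B}(\mathcal{E})}(\mathbb{D})$. *)

theory Defs
  imports "HOL-Analysis.Analysis"
begin

section \<open>Complex Hilbert spaces\<close>

text \<open>
  HOL-Analysis only has real inner product spaces. A complex inner product space is a complex
  normed space whose inner product is conjugate-linear in the first and linear in the second
  argument; the underlying real inner product is its real part, so that the norm, the metric and
  the topology are the ones already provided by the class real_inner.
\<close>

class scaleC =
  fixes scaleC :: "complex \<Rightarrow> 'a \<Rightarrow> 'a" (infixr "*\<^sub>C" 75)

class complex_normed_vector = real_normed_vector + scaleC +
  assumes scaleC_add_right: "c *\<^sub>C (x + y) = c *\<^sub>C x + c *\<^sub>C y"
    and scaleC_add_left: "(c + d) *\<^sub>C x = c *\<^sub>C x + d *\<^sub>C x"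
    and scaleC_scaleC: "c *\<^sub>C (d *\<^sub>C x) = (c * d) *\<^sub>C x"
    and scaleC_of_real: "complex_of_real r *\<^sub>C x = r *\<^sub>R x"
    and norm_scaleC: "norm (c *\<^sub>C x) = cmod c * norm x"

class complex_inner = complex_normed_vector + real_inner +
  fixes cinner :: "'a \<Rightarrow> 'a \<Rightarrow> complex"
  assumes cinner_commute: "cinner x y = cnj (cinner y x)"
    and cinner_add_right: "cinner x (y + z) = cinner x y + cinner x z"
    and cinner_scaleC_right: "cinner x (c *\<^sub>C y) = c * cinner x y"
    and Re_cinner: "Re (cinner x y) = inner x y"

class chilbert_space = complex_inner + complete_space

instance chilbert_space \<subseteq> banach ..

lemma scaleC_one [simp]: "1 *\<^sub>C (x::'a::complex_normed_vector) = x"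
  using scaleC_of_real[of 1 x] by simp

lemma vector_space_scaleC: "vector_space (scaleC :: complex \<Rightarrow> 'a::complex_normed_vector \<Rightarrow> 'a)"
  by standard (simp_all add: scaleC_add_right scaleC_add_left scaleC_scaleC)

interpretation complex_vector:
  vector_space "scaleC :: complex \<Rightarrow> 'a::complex_normed_vector \<Rightarrow> 'a"
  by (rule vector_space_scaleC)

abbreviation cspan :: "'a::complex_normed_vector set \<Rightarrow> 'a set"
  where "cspan \<equiv> module.span scaleC"

lemma bounded_linear_scaleC: "bounded_linear (\<lambda>x::'a::complex_normed_vector. c *\<^sub>C x)"
proof (rule bounded_linear_intro[where K="cmod c"])
  fix x y :: 'a and r :: real
  show "c *\<^sub>C (x + y) = c *\<^sub>C x + c *\<^sub>C y" by (rule scaleC_add_right)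
  show "c *\<^sub>C (r *\<^sub>R x) = r *\<^sub>R (c *\<^sub>C x)"
    by (simp add: scaleC_of_real[symmetric] scaleC_scaleC mult.commute)
  show "norm (c *\<^sub>C x) \<le> norm x * cmod c" by (simp add: norm_scaleC mult.commute)
qed

lemma cinner_add_left: "cinner (x + y) z = cinner x z + cinner y (z::'a::complex_inner)"
  by (metis cinner_add_right cinner_commute complex_cnj_add)

lemma cinner_scaleC_left: "cinner (c *\<^sub>C x) y = cnj c * cinner x (y::'a::complex_inner)"
  by (metis cinner_commute cinner_scaleC_right complex_cnj_mult)

lemma Im_cinner: "Im (cinner x y) = inner (\<i> *\<^sub>C x) (y::'a::complex_inner)"
  unfolding Re_cinner[symmetric] cinner_scaleC_left by simp

lemma cinner_eqI:
  assumes "\<And>x::'a::complex_inner. cinner x a = cinner x b"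
  shows "a = b"
proof -
  have "inner x (a - b) = 0" for x
    using assms[of x] by (metis Re_cinner inner_diff_right right_minus_eq)
  then show ?thesis by (metis inner_eq_zero_iff right_minus_eq)
qed

lemma cinner_Cauchy_Schwarz: "cmod (cinner x y) \<le> norm x * norm (y::'a::complex_inner)"
proof (cases "cinner x y = 0")
  case False
  define c where "c = cnj (cinner x y) / cmod (cinner x y)"
  have c: "cmod c = 1" using False by (simp add: c_def norm_divide)
  have "c * cinner x y = complex_of_real (cmod (cinner x y))"
    using False complex_norm_square[of "cinner x y"]
    by (simp add: c_def field_simps power2_eq_square)
  then have "cmod (cinner x y) = Re (cinner x (c *\<^sub>C y))"
    by (simp add: cinner_scaleC_right)
  also have "\<dots> = inner x (c *\<^sub>C y)" by (rule Re_cinner)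
  also have "\<dots> \<le> norm x * norm (c *\<^sub>C y)" by (rule norm_cauchy_schwarz)
  finally show ?thesis by (simp add: norm_scaleC c)
qed simp

lemma bounded_linear_cinner_right: "bounded_linear (\<lambda>y::'a::complex_inner. cinner x y)"
proof (rule bounded_linear_intro[where K="norm x"])
  fix y z :: 'a and r :: real
  show "cinner x (y + z) = cinner x y + cinner x z" by (rule cinner_add_right)
  show "cinner x (r *\<^sub>R y) = r *\<^sub>R cinner x y"
    by (metis cinner_scaleC_right scaleC_of_real scaleR_conv_of_real)
  show "norm (cinner x y) \<le> norm y * norm x"
    using cinner_Cauchy_Schwarz[of x y] by (simp add: mult.commute)
qed


section \<open>Bounded complex-linear operators\<close>

text \<open>The library type of bounded linear functions is real-linear; the bounded complex-linear
  operators are a closed real subspace of it, with the same operator norm.\<close>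

typedef (overloaded) ('a, 'b) cblinfun ("(_ \<Rightarrow>\<^sub>C\<^sub>L /_)" [22, 21] 21) =
  "{A :: 'a::complex_normed_vector \<Rightarrow>\<^sub>L 'b::complex_normed_vector.
      \<forall>c x. blinfun_apply A (c *\<^sub>C x) = c *\<^sub>C blinfun_apply A x}"
  morphisms blinfun_of_cblinfun CBlinfun
  by (rule exI[where x=0]) (simp add: complex_vector.scale_zero_right)

setup_lifting type_definition_cblinfun

definition cblinfun_apply :: "('a::complex_normed_vector \<Rightarrow>\<^sub>C\<^sub>L 'b::complex_normed_vector) \<Rightarrow> 'a \<Rightarrow> 'b"
    (infixr "*\<^sub>V" 70)
  where "A *\<^sub>V x = blinfun_apply (blinfun_of_cblinfun A) x"

lemma cblinfun_scaleC_right: "A *\<^sub>V (c *\<^sub>C x) = c *\<^sub>C (A *\<^sub>V x)"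
  using blinfun_of_cblinfun[of A] by (simp add: cblinfun_apply_def)

lemma cblinfun_eqI: "(\<And>x. A *\<^sub>V x = B *\<^sub>V x) \<Longrightarrow> A = B"
  unfolding cblinfun_apply_def blinfun_of_cblinfun_inject[symmetric] by (rule blinfun_eqI)

lemma bounded_linear_cblinfun_apply: "bounded_linear ((*\<^sub>V) A)"
  unfolding cblinfun_apply_def by (rule blinfun.bounded_linear_right)

lemma cblinfun_add_right: "A *\<^sub>V (x + y) = A *\<^sub>V x + A *\<^sub>V y"
  unfolding cblinfun_apply_def by (rule blinfun.add_right)

lemma CBlinfun_Blinfun_apply:
  assumes "bounded_linear f" "\<And>c x. f (c *\<^sub>C x) = c *\<^sub>C f x"
  shows "CBlinfun (Blinfun f) *\<^sub>V x = f x"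
  using assms by (simp add: cblinfun_apply_def CBlinfun_inverse bounded_linear_Blinfun_apply)

instantiation cblinfun :: (complex_normed_vector, complex_normed_vector) real_normed_vector
begin

lift_definition norm_cblinfun :: "'a \<Rightarrow>\<^sub>C\<^sub>L 'b \<Rightarrow> real" is norm .

lift_definition minus_cblinfun :: "'a \<Rightarrow>\<^sub>C\<^sub>L 'b \<Rightarrow> 'a \<Rightarrow>\<^sub>C\<^sub>L 'b \<Rightarrow> 'a \<Rightarrow>\<^sub>C\<^sub>L 'b" is "(-)"
  by (simp add: blinfun.diff_left complex_vector.scale_right_diff_distrib)

lift_definition uminus_cblinfun :: "'a \<Rightarrow>\<^sub>C\<^sub>L 'b \<Rightarrow> 'a \<Rightarrow>\<^sub>C\<^sub>L 'b" is uminus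
  by (simp add: blinfun.minus_left complex_vector.scale_minus_right)

lift_definition zero_cblinfun :: "'a \<Rightarrow>\<^sub>C\<^sub>L 'b" is 0
  by (simp add: complex_vector.scale_zero_right)

lift_definition plus_cblinfun :: "'a \<Rightarrow>\<^sub>C\<^sub>L 'b \<Rightarrow> 'a \<Rightarrow>\<^sub>C\<^sub>L 'b \<Rightarrow> 'a \<Rightarrow>\<^sub>C\<^sub>L 'b" is "(+)"
  by (simp add: blinfun.add_left scaleC_add_right)

lift_definition scaleR_cblinfun :: "real \<Rightarrow> 'a \<Rightarrow>\<^sub>C\<^sub>L 'b \<Rightarrow> 'a \<Rightarrow>\<^sub>C\<^sub>L 'b" is "scaleR"
  by (simp add: blinfun.scaleR_left scaleC_of_real[symmetric] scaleC_scaleC mult.commute)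

definition dist_cblinfun :: "'a \<Rightarrow>\<^sub>C\<^sub>L 'b \<Rightarrow> 'a \<Rightarrow>\<^sub>C\<^sub>L 'b \<Rightarrow> real"
  where "dist_cblinfun A B = norm (A - B)"

definition sgn_cblinfun :: "'a \<Rightarrow>\<^sub>C\<^sub>L 'b \<Rightarrow> 'a \<Rightarrow>\<^sub>C\<^sub>L 'b"
  where "sgn_cblinfun A = inverse (norm A) *\<^sub>R A"

definition uniformity_cblinfun :: "(('a \<Rightarrow>\<^sub>C\<^sub>L 'b) \<times> ('a \<Rightarrow>\<^sub>C\<^sub>L 'b)) filter"
  where "uniformity_cblinfun = (INF e\<in>{0 <..}. principal {(x, y). dist x y < e})"

definition open_cblinfun :: "('a \<Rightarrow>\<^sub>C\<^sub>L 'b) set \<Rightarrow> bool"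
  where "open_cblinfun S = (\<forall>x\<in>S. \<forall>\<^sub>F (x', y) in uniformity. x' = x \<longrightarrow> y \<in> S)"

lemmas cblinfun_rep_eqs = blinfun_of_cblinfun_inject[symmetric] norm_cblinfun.rep_eq
  minus_cblinfun.rep_eq uminus_cblinfun.rep_eq zero_cblinfun.rep_eq plus_cblinfun.rep_eq
  scaleR_cblinfun.rep_eq

instance
proof
  fix A B C :: "'a \<Rightarrow>\<^sub>C\<^sub>L 'b" and r s :: real and S :: "('a \<Rightarrow>\<^sub>C\<^sub>L 'b) set"
  show "dist A B = norm (A - B)" by (rule dist_cblinfun_def)
  show "sgn A = inverse (norm A) *\<^sub>R A" by (rule sgn_cblinfun_def)
  show "(uniformity :: (('a \<Rightarrow>\<^sub>C\<^sub>L 'b) \<times> ('a \<Rightarrow>\<^sub>C\<^sub>L 'b)) filter)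
      = (INF e\<in>{0 <..}. principal {(x, y). dist x y < e})"
    by (rule uniformity_cblinfun_def)
  show "open S = (\<forall>x\<in>S. \<forall>\<^sub>F (x', y) in uniformity. x' = x \<longrightarrow> y \<in> S)"
    by (rule open_cblinfun_def)
  show "norm (A + B) \<le> norm A + norm B" by (simp add: cblinfun_rep_eqs norm_triangle_ineq)
qed (simp_all add: cblinfun_rep_eqs scaleR_add_right scaleR_add_left)

end

lemma norm_cblinfun: "norm (A *\<^sub>V x) \<le> norm A * norm x"
  unfolding cblinfun_apply_def norm_cblinfun.rep_eq by (rule norm_blinfun)

lemma norm_cblinfun_bound: "0 \<le> b \<Longrightarrow> (\<And>x. norm (A *\<^sub>V x) \<le> b * norm x) \<Longrightarrow> norm A \<le> b"
  unfolding cblinfun_apply_def norm_cblinfun.rep_eq by (rule norm_blinfun_bound)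

lemma plus_cblinfun_apply: "(A + B) *\<^sub>V x = A *\<^sub>V x + B *\<^sub>V x"
  by (simp add: cblinfun_apply_def plus_cblinfun.rep_eq blinfun.add_left)

lemma scaleR_cblinfun_apply: "(r *\<^sub>R A) *\<^sub>V x = r *\<^sub>R (A *\<^sub>V x)"
  by (simp add: cblinfun_apply_def scaleR_cblinfun.rep_eq blinfun.scaleR_left)

instantiation cblinfun :: (complex_normed_vector, complex_normed_vector) complex_normed_vector
begin

definition scaleC_cblinfun :: "complex \<Rightarrow> 'a \<Rightarrow>\<^sub>C\<^sub>L 'b \<Rightarrow> 'a \<Rightarrow>\<^sub>C\<^sub>L 'b"
  where "scaleC_cblinfun c A = CBlinfun (Blinfun (\<lambda>x. c *\<^sub>C (A *\<^sub>V x)))"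

lemma scaleC_cblinfun_apply: "(c *\<^sub>C A) *\<^sub>V x = c *\<^sub>C (A *\<^sub>V x)"
  for A :: "'a \<Rightarrow>\<^sub>C\<^sub>L 'b"
  unfolding scaleC_cblinfun_def
  by (rule CBlinfun_Blinfun_apply)
    (simp_all add: cblinfun_scaleC_right scaleC_scaleC mult.commute
      bounded_linear_compose[OF bounded_linear_scaleC bounded_linear_cblinfun_apply])

instance
proof
  fix A B :: "'a \<Rightarrow>\<^sub>C\<^sub>L 'b" and r :: real and c d :: complex
  show "c *\<^sub>C (A + B) = c *\<^sub>C A + c *\<^sub>C B"
    by (rule cblinfun_eqI) (simp add: scaleC_cblinfun_apply plus_cblinfun_apply scaleC_add_right)
  show "(c + d) *\<^sub>C A = c *\<^sub>C A + d *\<^sub>C A"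
    by (rule cblinfun_eqI) (simp add: scaleC_cblinfun_apply plus_cblinfun_apply scaleC_add_left)
  show "c *\<^sub>C (d *\<^sub>C A) = (c * d) *\<^sub>C A"
    by (rule cblinfun_eqI) (simp add: scaleC_cblinfun_apply scaleC_scaleC)
  show "complex_of_real r *\<^sub>C A = r *\<^sub>R A"
    by (rule cblinfun_eqI) (simp add: scaleC_cblinfun_apply scaleR_cblinfun_apply scaleC_of_real)
  have le: "norm (c *\<^sub>C A) \<le> cmod c * norm A" for c and A :: "'a \<Rightarrow>\<^sub>C\<^sub>L 'b"
    by (rule norm_cblinfun_bound)
      (auto simp: scaleC_cblinfun_apply norm_scaleC mult.assoc intro!: mult_left_mono norm_cblinfun)
  have "cmod c * norm A \<le> norm (c *\<^sub>C A)"
  proof (cases "c = 0")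
    case False
    have "inverse c *\<^sub>C c *\<^sub>C A = A"
      by (rule cblinfun_eqI) (use False in \<open>simp add: scaleC_cblinfun_apply scaleC_scaleC\<close>)
    then have "norm A \<le> inverse (cmod c) * norm (c *\<^sub>C A)"
      using le[of "inverse c" "c *\<^sub>C A"] by (simp add: norm_inverse)
    then show ?thesis using False by (simp add: field_simps)
  qed simp
  then show "norm (c *\<^sub>C A) = cmod c * norm A" using le by (simp add: antisym)
qed

end

instance cblinfun :: (complex_normed_vector, "{complex_normed_vector, banach}") banach
proof
  fix X :: "nat \<Rightarrow> 'a \<Rightarrow>\<^sub>C\<^sub>L 'b"
  assume X: "Cauchy X"
  let ?Y = "\<lambda>n. blinfun_of_cblinfun (X n)"
  have dist: "dist (blinfun_of_cblinfun A) (blinfun_of_cblinfun B) = dist A B"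
    for A B :: "'a \<Rightarrow>\<^sub>C\<^sub>L 'b"
    by (simp add: dist_norm norm_cblinfun.rep_eq minus_cblinfun.rep_eq)
  have "Cauchy ?Y" using X by (simp add: Cauchy_def dist)
  then obtain B where B: "?Y \<longlonglongrightarrow> B" by (auto simp: Cauchy_convergent_iff convergent_def)
  have lim: "(\<lambda>n. blinfun_apply (?Y n) x) \<longlonglongrightarrow> blinfun_apply B x" for x
    using B by (rule blinfun.tendsto) simp
  have "blinfun_apply B (c *\<^sub>C x) = c *\<^sub>C blinfun_apply B x" for c x
  proof (rule LIMSEQ_unique[OF lim])
    have "blinfun_apply (?Y n) (c *\<^sub>C x) = c *\<^sub>C blinfun_apply (?Y n) x" for n
      using blinfun_of_cblinfun[of "X n"] by simp
    then show "(\<lambda>n. blinfun_apply (?Y n) (c *\<^sub>C x)) \<longlonglongrightarrow> c *\<^sub>C blinfun_apply B x"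
      using bounded_linear.tendsto[OF bounded_linear_scaleC lim] by simp
  qed
  then have B_eq: "blinfun_of_cblinfun (CBlinfun B) = B" by (simp add: CBlinfun_inverse)
  have "dist (X n) (CBlinfun B) = dist (?Y n) B" for n
    using dist[of "X n" "CBlinfun B"] B_eq by simp
  with B have "X \<longlonglongrightarrow> CBlinfun B"
    by (simp add: tendsto_dist_iff[of X] tendsto_dist_iff[of ?Y])
  then show "convergent X" by (auto simp: convergent_def)
qed

lift_definition id_cblinfun :: "'a::complex_normed_vector \<Rightarrow>\<^sub>C\<^sub>L 'a" is id_blinfun
  by simp

lift_definition cblinfun_compose :: "'b::complex_normed_vector \<Rightarrow>\<^sub>C\<^sub>L 'c::complex_normed_vector \<Rightarrow>
    'a::complex_normed_vector \<Rightarrow>\<^sub>C\<^sub>L 'b \<Rightarrow> 'a \<Rightarrow>\<^sub>C\<^sub>L 'c" (infixl "o\<^sub>C\<^sub>L" 67) is blinfun_compose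
  by simp

lemma id_cblinfun_apply [simp]: "id_cblinfun *\<^sub>V x = x"
  by (simp add: cblinfun_apply_def id_cblinfun.rep_eq)

lemma cblinfun_compose_apply [simp]: "(A o\<^sub>C\<^sub>L B) *\<^sub>V x = A *\<^sub>V B *\<^sub>V x"
  by (simp add: cblinfun_apply_def cblinfun_compose.rep_eq)

text \<open>Existence of the adjoint (via the Riesz representation theorem) is proved below.\<close>

definition cadjoint :: "'a::chilbert_space \<Rightarrow>\<^sub>C\<^sub>L 'b::chilbert_space \<Rightarrow> 'b \<Rightarrow>\<^sub>C\<^sub>L 'a"
  where "cadjoint A = (THE B. \<forall>x y. cinner (A *\<^sub>V x) y = cinner x (B *\<^sub>V y))"

definition cisometry :: "'a::complex_normed_vector \<Rightarrow>\<^sub>C\<^sub>L 'b::complex_normed_vector \<Rightarrow> bool"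
  where "cisometry A \<longleftrightarrow> (\<forall>x. norm (A *\<^sub>V x) = norm x)"

definition cunitary :: "'a::chilbert_space \<Rightarrow>\<^sub>C\<^sub>L 'b::chilbert_space \<Rightarrow> bool"
  where "cunitary A \<longleftrightarrow>
    cadjoint A o\<^sub>C\<^sub>L A = id_cblinfun \<and> A o\<^sub>C\<^sub>L cadjoint A = id_cblinfun"

definition is_cinverse :: "'a::complex_normed_vector \<Rightarrow>\<^sub>C\<^sub>L 'b::complex_normed_vector \<Rightarrow>
    'b \<Rightarrow>\<^sub>C\<^sub>L 'a \<Rightarrow> bool"
  where "is_cinverse A B \<longleftrightarrow> B o\<^sub>C\<^sub>L A = id_cblinfun \<and> A o\<^sub>C\<^sub>L B = id_cblinfun"

definition cinvertible :: "'a::complex_normed_vector \<Rightarrow>\<^sub>C\<^sub>L 'b::complex_normed_vector \<Rightarrow> bool"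
  where "cinvertible A \<longleftrightarrow> (\<exists>B. is_cinverse A B)"

definition cinverse :: "'a::complex_normed_vector \<Rightarrow>\<^sub>C\<^sub>L 'b::complex_normed_vector \<Rightarrow> 'b \<Rightarrow>\<^sub>C\<^sub>L 'a"
  where "cinverse A = (THE B. is_cinverse A B)"

lemma is_cinverse_unique: "is_cinverse A B \<Longrightarrow> is_cinverse A C \<Longrightarrow> B = C"
  unfolding is_cinverse_def
  by (rule cblinfun_eqI) (metis cblinfun_compose_apply id_cblinfun_apply)

lemma cinverse_eqI: "is_cinverse A B \<Longrightarrow> cinverse A = B"
  unfolding cinverse_def by (rule the_equality) (assumption, rule is_cinverse_unique)

lemma riesz_representation_real:
  fixes f :: "'a::{real_inner, complete_space} \<Rightarrow> real"
  assumes f: "bounded_linear f"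
  shows "\<exists>y. \<forall>x. f x = inner y x"
proof (cases "\<forall>x. f x = 0")
  case True
  then show ?thesis by (intro exI[of _ 0]) simp
next
  case False
  interpret f: bounded_linear f by (rule f)
  obtain a where a: "f a \<noteq> 0" using False by blast
  define S where "S = {x. f x = 1}"
  have S_ne: "(1 / f a) *\<^sub>R a \<in> S" using a by (simp add: S_def f.scaleR)
  define d where "d = (INF x\<in>S. (norm x)\<^sup>2)"
  have bdd: "bdd_below ((\<lambda>x. (norm x)\<^sup>2) ` S)" by (intro bdd_belowI2[of _ 0]) simp
  have d_le: "d \<le> (norm x)\<^sup>2" if "x \<in> S" for x
    unfolding d_def using bdd that by (rule cINF_lower)
  have "\<exists>x\<in>S. (norm x)\<^sup>2 < d + 1 / real (Suc n)" for n
  proof -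
    have "(INF x\<in>S. (norm x)\<^sup>2) < d + 1 / real (Suc n)" by (simp add: d_def)
    then show ?thesis using S_ne bdd by (subst (asm) cINF_less_iff) auto
  qed
  then obtain X where XS: "\<And>n. X n \<in> S" and X: "\<And>n. (norm (X n))\<^sup>2 < d + 1 / real (Suc n)"
    by metis
  have close: "(norm (X m - X n))\<^sup>2 \<le> 2 / real (Suc m) + 2 / real (Suc n)" for m n
  proof -
    have "(1/2) *\<^sub>R (X m + X n) \<in> S" using XS[of m] XS[of n] by (simp add: S_def f.scaleR f.add)
    from d_le[OF this] have "4 * d \<le> (norm (X m + X n))\<^sup>2"
      by (simp add: power_mult_distrib power_divide)
    moreover have "(norm (X m + X n))\<^sup>2 + (norm (X m - X n))\<^sup>2
        = 2 * (norm (X m))\<^sup>2 + 2 * (norm (X n))\<^sup>2"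
      by (simp add: power2_norm_eq_inner inner_add_left inner_add_right inner_diff_left
          inner_diff_right inner_commute)
    ultimately show ?thesis using X[of m] X[of n] by linarith
  qed
  have "Cauchy X"
  proof (rule CauchyI)
    fix e :: real assume e: "0 < e"
    then have "0 < e\<^sup>2 / 4" by simp
    then obtain N where N: "inverse (real (Suc N)) < e\<^sup>2 / 4" using reals_Archimedean by blast
    have "norm (X m - X n) < e" if "m \<ge> N" "n \<ge> N" for m n
    proof (rule power_less_imp_less_base)
      have "1 / real (Suc m) \<le> inverse (real (Suc N))" "1 / real (Suc n) \<le> inverse (real (Suc N))"
        using that by (auto simp: field_simps)
      moreover have "2 / real (Suc k) = 2 * (1 / real (Suc k))" for k by simp
      ultimately have "2 / real (Suc m) + 2 / real (Suc n) < e\<^sup>2" using N by linarith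
      then show "(norm (X m - X n))\<^sup>2 < e\<^sup>2" using close[of m n] by linarith
    qed (use e in simp)
    then show "\<exists>M. \<forall>m\<ge>M. \<forall>n\<ge>M. norm (X m - X n) < e" by blast
  qed
  then obtain p where p: "X \<longlonglongrightarrow> p" by (auto simp: Cauchy_convergent_iff convergent_def)
  have "(\<lambda>n. f (X n)) \<longlonglongrightarrow> f p" by (rule f.tendsto[OF p])
  then have pS: "f p = 1" using XS by (simp add: S_def LIMSEQ_const_iff)
  have np: "(norm p)\<^sup>2 \<le> d"
  proof (rule LIMSEQ_le)
    show "(\<lambda>n. (norm (X n))\<^sup>2) \<longlonglongrightarrow> (norm p)\<^sup>2" by (intro tendsto_intros p)
    show "(\<lambda>n. d + 1 / real (Suc n)) \<longlonglongrightarrow> d"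
      using tendsto_add[OF tendsto_const LIMSEQ_inverse_real_of_nat, of d]
      by (simp add: inverse_eq_divide)
    show "\<exists>N. \<forall>n\<ge>N. (norm (X n))\<^sup>2 \<le> d + 1 / real (Suc n)" using X less_imp_le by blast
  qed
  have p0: "p \<noteq> 0" using pS f.zero by auto
  have orth: "inner p z = 0" if z: "f z = 0" for z
  proof (cases "z = 0")
    case False
    define t where "t = inner p z / (norm z)\<^sup>2"
    have nz: "(norm z)\<^sup>2 > 0" using False by simp
    have "p - t *\<^sub>R z \<in> S" using z pS by (simp add: S_def f.diff f.scaleR)
    then have "(norm p)\<^sup>2 \<le> (norm (p - t *\<^sub>R z))\<^sup>2" using np d_le order_trans by blast
    also have "\<dots> = (norm p)\<^sup>2 - 2 * t * inner p z + t\<^sup>2 * (norm z)\<^sup>2"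
      unfolding power2_norm_eq_inner
      by (simp add: inner_diff_left inner_diff_right inner_commute power2_eq_square algebra_simps)
    also have "\<dots> = (norm p)\<^sup>2 - (inner p z)\<^sup>2 / (norm z)\<^sup>2"
      using nz by (simp add: t_def power2_eq_square field_simps)
    finally have "(inner p z)\<^sup>2 / (norm z)\<^sup>2 \<le> 0" by simp
    then show ?thesis using nz by (simp add: divide_le_0_iff)
  qed simp
  show ?thesis
  proof (intro exI allI)
    fix x
    have "f (x - f x *\<^sub>R p) = 0" using pS by (simp add: f.diff f.scaleR)
    from orth[OF this] have "inner p x = f x * (norm p)\<^sup>2"
      by (simp add: inner_diff_right power2_norm_eq_inner)
    then show "f x = inner ((1 / (norm p)\<^sup>2) *\<^sub>R p) x" using p0 by simp
  qed
qed

lemma cadjoint_exists: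
  fixes A :: "'a::chilbert_space \<Rightarrow>\<^sub>C\<^sub>L 'b::chilbert_space"
  shows "\<exists>B. \<forall>x y. cinner (A *\<^sub>V x) y = cinner x (B *\<^sub>V y)"
proof -
  have "\<exists>b. \<forall>x. inner y (A *\<^sub>V x) = inner b x" for y
    by (rule riesz_representation_real)
      (rule bounded_linear_compose[OF bounded_linear_inner_right bounded_linear_cblinfun_apply])
  then obtain b where b: "\<And>x y. inner y (A *\<^sub>V x) = inner (b y) x" by metis
  have adj: "cinner (A *\<^sub>V x) y = cinner x (b y)" for x y
    using b[of y x] b[of y "\<i> *\<^sub>C x"]
    by (auto simp: complex_eq_iff Re_cinner Im_cinner inner_commute
        cblinfun_scaleC_right[symmetric])
  have add: "b (y + z) = b y + b z" for y z
    by (rule cinner_eqI) (simp add: adj[symmetric] cinner_add_right)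
  have scaleC: "b (c *\<^sub>C y) = c *\<^sub>C b y" for c y
    by (rule cinner_eqI) (simp add: adj[symmetric] cinner_scaleC_right)
  have "norm (b y) \<le> norm y * norm A" for y
  proof -
    have "norm (b y) * norm (b y) = inner y (A *\<^sub>V b y)"
      by (simp add: b power2_eq_square[symmetric] power2_norm_eq_inner)
    also have "\<dots> \<le> norm y * norm (A *\<^sub>V b y)" by (rule norm_cauchy_schwarz)
    also have "\<dots> \<le> norm y * (norm A * norm (b y))" by (intro mult_left_mono norm_cblinfun) simp
    finally have "norm (b y) * norm (b y) \<le> (norm y * norm A) * norm (b y)"
      by (simp add: mult.assoc)
    then show ?thesis
      by (cases "b y = 0") (simp_all del: mult.assoc)
  qed
  then have "bounded_linear b"
    by (intro bounded_linear_intro[where K="norm A"] add)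
      (simp_all add: scaleC_of_real[symmetric] scaleC)
  then have "CBlinfun (Blinfun b) *\<^sub>V y = b y" for y
    using scaleC by (rule CBlinfun_Blinfun_apply)
  then show ?thesis using adj by (intro exI[of _ "CBlinfun (Blinfun b)"]) simp
qed

lemma cinner_cadjoint:
  fixes A :: "'a::chilbert_space \<Rightarrow>\<^sub>C\<^sub>L 'b::chilbert_space"
  shows "cinner (A *\<^sub>V x) y = cinner x (cadjoint A *\<^sub>V y)"
proof -
  have "\<exists>!B. \<forall>x y. cinner (A *\<^sub>V x) y = cinner x (B *\<^sub>V y)"
  proof (rule ex_ex1I)
    fix B C :: "'b \<Rightarrow>\<^sub>C\<^sub>L 'a"
    assume B: "\<forall>x y. cinner (A *\<^sub>V x) y = cinner x (B *\<^sub>V y)"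
      and C: "\<forall>x y. cinner (A *\<^sub>V x) y = cinner x (C *\<^sub>V y)"
    show "B = C"
    proof (intro cblinfun_eqI cinner_eqI)
      fix x y
      show "cinner y (B *\<^sub>V x) = cinner y (C *\<^sub>V x)"
        using B[rule_format, of y x] C[rule_format, of y x] by simp
    qed
  qed (rule cadjoint_exists)
  from theI'[OF this] show ?thesis unfolding cadjoint_def by blast
qed


section \<open>Square-summable families\<close>

typedef (overloaded) ('i, 'e) ell2 =
  "{f :: 'i \<Rightarrow> 'e::real_normed_vector. (\<lambda>i. (norm (f i))\<^sup>2) summable_on UNIV}"
  morphisms ell2_nth Abs_ell2
  by (rule exI[where x="\<lambda>_. 0"]) simp

setup_lifting type_definition_ell2

lemma ell2_summable: "(\<lambda>i. (norm (ell2_nth f i))\<^sup>2) summable_on UNIV"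
  using ell2_nth[of f] by simp

lemma summable_comparison_real:
  fixes f g :: "'i \<Rightarrow> real"
  assumes "f summable_on UNIV" "\<And>i. 0 \<le> g i" "\<And>i. g i \<le> f i"
  shows "g summable_on UNIV"
  using assms summable_on_comparison_test[of f UNIV g] by simp

lemma norm_add_square_le:
  fixes x y :: "'a::real_normed_vector"
  shows "(norm (x + y))\<^sup>2 \<le> 2 * (norm x)\<^sup>2 + 2 * (norm y)\<^sup>2"
proof -
  have "(norm (x + y))\<^sup>2 \<le> (norm x + norm y)\<^sup>2" by (simp add: norm_triangle_ineq power_mono)
  also have "\<dots> \<le> 2 * (norm x)\<^sup>2 + 2 * (norm y)\<^sup>2"
    using sum_squares_ge_zero[of "norm x - norm y" 0] by (simp add: power2_eq_square algebra_simps)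
  finally show ?thesis .
qed

lemma square_summable_add:
  fixes f g :: "'i \<Rightarrow> 'a::real_normed_vector"
  assumes "(\<lambda>i. (norm (f i))\<^sup>2) summable_on UNIV" "(\<lambda>i. (norm (g i))\<^sup>2) summable_on UNIV"
  shows "(\<lambda>i. (norm (f i + g i))\<^sup>2) summable_on UNIV"
proof (rule summable_comparison_real)
  show "(\<lambda>i. 2 * (norm (f i))\<^sup>2 + 2 * (norm (g i))\<^sup>2) summable_on UNIV"
    using assms by (intro summable_on_add summable_on_cmult_right)
qed (simp_all add: norm_add_square_le)

lemma summable_norm_mult_norm:
  fixes f g :: "'i \<Rightarrow> 'a::real_normed_vector"
  assumes "(\<lambda>i. (norm (f i))\<^sup>2) summable_on UNIV" "(\<lambda>i. (norm (g i))\<^sup>2) summable_on UNIV"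
  shows "(\<lambda>i. norm (f i) * norm (g i)) summable_on UNIV"
proof (rule summable_comparison_real)
  show "(\<lambda>i. (norm (f i))\<^sup>2 + (norm (g i))\<^sup>2) summable_on UNIV"
    using assms by (intro summable_on_add)
  show "norm (f i) * norm (g i) \<le> (norm (f i))\<^sup>2 + (norm (g i))\<^sup>2" for i
  proof -
    have "2 * (norm (f i) * norm (g i)) \<le> (norm (f i))\<^sup>2 + (norm (g i))\<^sup>2"
      using sum_squares_bound[of "norm (f i)" "norm (g i)"] by (simp add: mult.assoc)
    moreover have "0 \<le> norm (f i) * norm (g i)" by simp
    ultimately show ?thesis by linarith
  qed
qed simp

lemma ell2_inner_summable:
  fixes f g :: "'i \<Rightarrow> 'a::real_inner"
  assumes "(\<lambda>i. (norm (f i))\<^sup>2) summable_on UNIV" "(\<lambda>i. (norm (g i))\<^sup>2) summable_on UNIV"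
  shows "(\<lambda>i. inner (f i) (g i)) summable_on UNIV"
  by (rule abs_summable_summable, rule summable_comparison_real)
    (auto intro: summable_norm_mult_norm[OF assms] simp: Cauchy_Schwarz_ineq2)

lemma ell2_cinner_summable:
  fixes f g :: "'i \<Rightarrow> 'a::complex_inner"
  assumes "(\<lambda>i. (norm (f i))\<^sup>2) summable_on UNIV" "(\<lambda>i. (norm (g i))\<^sup>2) summable_on UNIV"
  shows "(\<lambda>i. cinner (f i) (g i)) summable_on UNIV"
  by (rule abs_summable_summable, rule summable_comparison_real)
    (auto intro: summable_norm_mult_norm[OF assms] simp: cinner_Cauchy_Schwarz)

instantiation ell2 :: (type, real_inner) real_inner
begin

lift_definition inner_ell2 :: "('a, 'b) ell2 \<Rightarrow> ('a, 'b) ell2 \<Rightarrow> real"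
  is "\<lambda>f g. \<Sum>\<^sub>\<infinity>i. inner (f i) (g i)" .

lift_definition minus_ell2 :: "('a, 'b) ell2 \<Rightarrow> ('a, 'b) ell2 \<Rightarrow> ('a, 'b) ell2"
  is "\<lambda>f g i. f i - g i"
  using square_summable_add[where g="\<lambda>i. - (_ i)"] by fastforce

lift_definition uminus_ell2 :: "('a, 'b) ell2 \<Rightarrow> ('a, 'b) ell2" is "\<lambda>f i. - f i"
  by simp

lift_definition zero_ell2 :: "('a, 'b) ell2" is "\<lambda>i. 0"
  by simp

lift_definition plus_ell2 :: "('a, 'b) ell2 \<Rightarrow> ('a, 'b) ell2 \<Rightarrow> ('a, 'b) ell2"
  is "\<lambda>f g i. f i + g i"
  by (rule square_summable_add)

lift_definition scaleR_ell2 :: "real \<Rightarrow> ('a, 'b) ell2 \<Rightarrow> ('a, 'b) ell2" is "\<lambda>r f i. r *\<^sub>R f i"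
  by (simp add: power_mult_distrib summable_on_cmult_right)

definition norm_ell2 :: "('a, 'b) ell2 \<Rightarrow> real"
  where "norm_ell2 f = sqrt (inner f f)"

definition dist_ell2 :: "('a, 'b) ell2 \<Rightarrow> ('a, 'b) ell2 \<Rightarrow> real"
  where "dist_ell2 f g = norm (f - g)"

definition sgn_ell2 :: "('a, 'b) ell2 \<Rightarrow> ('a, 'b) ell2"
  where "sgn_ell2 f = inverse (norm f) *\<^sub>R f"

definition uniformity_ell2 :: "(('a, 'b) ell2 \<times> ('a, 'b) ell2) filter"
  where "uniformity_ell2 = (INF e\<in>{0 <..}. principal {(x, y). dist x y < e})"

definition open_ell2 :: "('a, 'b) ell2 set \<Rightarrow> bool"
  where "open_ell2 S = (\<forall>x\<in>S. \<forall>\<^sub>F (x', y) in uniformity. x' = x \<longrightarrow> y \<in> S)"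

instance
proof
  fix f g h :: "('a, 'b) ell2" and r s :: real and S :: "('a, 'b) ell2 set"
  show "dist f g = norm (f - g)" by (rule dist_ell2_def)
  show "sgn f = inverse (norm f) *\<^sub>R f" by (rule sgn_ell2_def)
  show "(uniformity :: (('a, 'b) ell2 \<times> ('a, 'b) ell2) filter)
      = (INF e\<in>{0 <..}. principal {(x, y). dist x y < e})"
    by (rule uniformity_ell2_def)
  show "open S = (\<forall>x\<in>S. \<forall>\<^sub>F (x', y) in uniformity. x' = x \<longrightarrow> y \<in> S)"
    by (rule open_ell2_def)
  show "f + g + h = f + (g + h)" by transfer (simp add: add.assoc)
  show "f + g = g + f" by transfer (simp add: add.commute)
  show "0 + f = f" by transfer simp
  show "- f + f = 0" by transfer simp
  show "f - g = f + - g" by transfer simp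
  show "r *\<^sub>R (f + g) = r *\<^sub>R f + r *\<^sub>R g" by transfer (simp add: scaleR_add_right)
  show "(r + s) *\<^sub>R f = r *\<^sub>R f + s *\<^sub>R f" by transfer (simp add: scaleR_add_left)
  show "r *\<^sub>R s *\<^sub>R f = (r * s) *\<^sub>R f" by transfer simp
  show "1 *\<^sub>R f = f" by transfer simp
  show "inner f g = inner g f" by transfer (simp add: inner_commute)
  show "inner (f + g) h = inner f h + inner g h"
    by transfer (simp add: inner_add_left infsum_add ell2_inner_summable)
  show "inner (r *\<^sub>R f) g = r * inner f g"
    by transfer (simp add: infsum_cmult_right')
  show "0 \<le> inner f f" by transfer (simp add: infsum_nonneg)
  show "(inner f f = 0) = (f = 0)"
  proof transfer
    fix f :: "'a \<Rightarrow> 'b" assume f: "(\<lambda>i. (norm (f i))\<^sup>2) summable_on UNIV"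
    show "((\<Sum>\<^sub>\<infinity>i. inner (f i) (f i)) = 0) = (f = (\<lambda>i. 0))"
    proof
      assume "(\<Sum>\<^sub>\<infinity>i. inner (f i) (f i)) = 0"
      then have "inner (f i) (f i) = 0" for i
        by (intro nonneg_infsum_le_0D[where A=UNIV]) (auto intro: ell2_inner_summable[OF f f])
      then show "f = (\<lambda>i. 0)" by auto
    qed simp
  qed
  show "norm f = sqrt (inner f f)" by (rule norm_ell2_def)
qed

end

lemma power2_norm_ell2: "(norm f)\<^sup>2 = (\<Sum>\<^sub>\<infinity>i. (norm (ell2_nth f i))\<^sup>2)"
  for f :: "('i, 'e::real_inner) ell2"
  by (simp add: power2_norm_eq_inner inner_ell2.rep_eq)

lemma sum_le_power2_norm_ell2:
  fixes f :: "('i, 'e::real_inner) ell2"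
  assumes "finite F"
  shows "(\<Sum>i\<in>F. (norm (ell2_nth f i))\<^sup>2) \<le> (norm f)\<^sup>2"
  unfolding power2_norm_ell2 using assms by (intro finite_sum_le_infsum ell2_summable) auto

lemma norm_ell2_nth_le: "norm (ell2_nth f i) \<le> norm f"
  for f :: "('i, 'e::real_inner) ell2"
  by (rule power2_le_imp_le) (use sum_le_power2_norm_ell2[of "{i}" f] in auto)

instantiation ell2 :: (type, complex_inner) complex_inner
begin

lift_definition scaleC_ell2 :: "complex \<Rightarrow> ('a, 'b) ell2 \<Rightarrow> ('a, 'b) ell2" is "\<lambda>c f i. c *\<^sub>C f i"
  by (simp add: norm_scaleC power_mult_distrib summable_on_cmult_right)

lift_definition cinner_ell2 :: "('a, 'b) ell2 \<Rightarrow> ('a, 'b) ell2 \<Rightarrow> complex"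
  is "\<lambda>f g. \<Sum>\<^sub>\<infinity>i. cinner (f i) (g i)" .

instance
proof
  fix f g h :: "('a, 'b) ell2" and r :: real and c d :: complex
  show "c *\<^sub>C (f + g) = c *\<^sub>C f + c *\<^sub>C g" by transfer (simp add: scaleC_add_right)
  show "(c + d) *\<^sub>C f = c *\<^sub>C f + d *\<^sub>C f" by transfer (simp add: scaleC_add_left)
  show "c *\<^sub>C (d *\<^sub>C f) = (c * d) *\<^sub>C f" by transfer (simp add: scaleC_scaleC)
  show "complex_of_real r *\<^sub>C f = r *\<^sub>R f" by transfer (simp add: scaleC_of_real)
  show "norm (c *\<^sub>C f) = cmod c * norm f"
  proof (rule power2_eq_imp_eq)
    show "(norm (c *\<^sub>C f))\<^sup>2 = (cmod c * norm f)\<^sup>2"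
      by (simp add: power2_norm_ell2 power_mult_distrib scaleC_ell2.rep_eq norm_scaleC
          infsum_cmult_right')
  qed simp_all
  show "cinner f g = cnj (cinner g f)"
    by transfer (metis (no_types, lifting) cinner_commute infsum_cnj infsum_cong)
  show "cinner f (g + h) = cinner f g + cinner f h"
    by transfer (simp add: cinner_add_right infsum_add ell2_cinner_summable)
  show "cinner f (c *\<^sub>C g) = c * cinner f g"
    by transfer (simp add: cinner_scaleC_right infsum_cmult_right')
  show "Re (cinner f g) = inner f g"
    by transfer (simp add: Re_cinner[symmetric] infsum_Re ell2_cinner_summable)
qed

end

instance ell2 :: (type, chilbert_space) chilbert_space
proof
  fix X :: "nat \<Rightarrow> ('a, 'b) ell2"
  assume X: "Cauchy X"
  have "Cauchy (\<lambda>n. ell2_nth (X n) i)" for i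
  proof (rule CauchyI)
    fix e :: real assume "0 < e"
    from CauchyD[OF X this] obtain M where M: "\<And>m n. m \<ge> M \<Longrightarrow> n \<ge> M \<Longrightarrow> norm (X m - X n) < e"
      by blast
    have "norm (ell2_nth (X m) i - ell2_nth (X n) i) \<le> norm (X m - X n)" for m n
      using norm_ell2_nth_le[of "X m - X n" i] by (simp add: minus_ell2.rep_eq)
    then show "\<exists>M. \<forall>m\<ge>M. \<forall>n\<ge>M. norm (ell2_nth (X m) i - ell2_nth (X n) i) < e"
      using M by (meson le_less_trans)
  qed
  then obtain g where g: "\<And>i. (\<lambda>n. ell2_nth (X n) i) \<longlonglongrightarrow> g i"
    unfolding Cauchy_convergent_iff convergent_def by metis
  have part: "(\<Sum>i\<in>F. (norm (ell2_nth (X m) i - g i))\<^sup>2) \<le> e\<^sup>2"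
    if M: "\<And>m n. m \<ge> M \<Longrightarrow> n \<ge> M \<Longrightarrow> norm (X m - X n) < e" and "m \<ge> M" "finite F" for M m e F
  proof (rule LIMSEQ_le_const2)
    show "(\<lambda>n. \<Sum>i\<in>F. (norm (ell2_nth (X m) i - ell2_nth (X n) i))\<^sup>2)
        \<longlonglongrightarrow> (\<Sum>i\<in>F. (norm (ell2_nth (X m) i - g i))\<^sup>2)"
      by (intro tendsto_intros g)
    have "(\<Sum>i\<in>F. (norm (ell2_nth (X m) i - ell2_nth (X n) i))\<^sup>2) \<le> e\<^sup>2" if "n \<ge> M" for n
    proof -
      have "(\<Sum>i\<in>F. (norm (ell2_nth (X m) i - ell2_nth (X n) i))\<^sup>2) \<le> (norm (X m - X n))\<^sup>2"
        using sum_le_power2_norm_ell2[OF \<open>finite F\<close>, of "X m - X n"]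
        by (simp add: minus_ell2.rep_eq)
      also have "\<dots> \<le> e\<^sup>2"
        using M[OF \<open>m \<ge> M\<close> \<open>n \<ge> M\<close>] by (intro power_mono) auto
      finally show ?thesis .
    qed
    then show "\<exists>N. \<forall>n\<ge>N. (\<Sum>i\<in>F. (norm (ell2_nth (X m) i - ell2_nth (X n) i))\<^sup>2) \<le> e\<^sup>2"
      by blast
  qed
  have summ: "(\<lambda>i. (norm (ell2_nth (X m) i - g i))\<^sup>2) summable_on UNIV
      \<and> (\<Sum>\<^sub>\<infinity>i. (norm (ell2_nth (X m) i - g i))\<^sup>2) \<le> e\<^sup>2"
    if M: "\<And>m n. m \<ge> M \<Longrightarrow> n \<ge> M \<Longrightarrow> norm (X m - X n) < e" and "m \<ge> M" for M m e
  proof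
    show s: "(\<lambda>i. (norm (ell2_nth (X m) i - g i))\<^sup>2) summable_on UNIV"
      by (rule nonneg_bounded_partial_sums_imp_summable_on[where C="e\<^sup>2"])
        (auto intro!: eventually_finite_subsets_at_top_weakI part[OF M \<open>m \<ge> M\<close>])
    show "(\<Sum>\<^sub>\<infinity>i. (norm (ell2_nth (X m) i - g i))\<^sup>2) \<le> e\<^sup>2"
      by (rule infsum_le_finite_sums[OF s]) (rule part[OF M \<open>m \<ge> M\<close>])
  qed
  obtain M where M: "\<And>m n. m \<ge> M \<Longrightarrow> n \<ge> M \<Longrightarrow> norm (X m - X n) < 1"
    using CauchyD[OF X zero_less_one] by blast
  have "(\<lambda>i. (norm (g i - ell2_nth (X M) i))\<^sup>2) summable_on UNIV"
    using summ[OF M order_refl] by (simp add: norm_minus_commute)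
  from square_summable_add[OF this ell2_summable[of "X M"]]
  have gs: "(\<lambda>i. (norm (g i))\<^sup>2) summable_on UNIV" by simp
  define G where "G = Abs_ell2 g"
  have G: "ell2_nth G = g" using gs by (simp add: G_def Abs_ell2_inverse)
  have "X \<longlonglongrightarrow> G"
  proof (rule LIMSEQ_I)
    fix e :: real assume e: "0 < e"
    then have "0 < e / 2" by simp
    from CauchyD[OF X this] obtain M
      where M: "\<And>m n. m \<ge> M \<Longrightarrow> n \<ge> M \<Longrightarrow> norm (X m - X n) < e / 2" by blast
    have "norm (X n - G) < e" if "n \<ge> M" for n
    proof -
      have "(norm (X n - G))\<^sup>2 \<le> (e / 2)\<^sup>2"
        using summ[OF M \<open>n \<ge> M\<close>] by (simp add: power2_norm_ell2 minus_ell2.rep_eq G)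
      then have "norm (X n - G) \<le> e / 2" by (rule power2_le_imp_le) (use e in simp)
      then show ?thesis using e by simp
    qed
    then show "\<exists>no. \<forall>n\<ge>no. norm (X n - G) < e" by blast
  qed
  then show "convergent X" by (auto simp: convergent_def)
qed

lift_definition ell2_single :: "'i \<Rightarrow> 'e \<Rightarrow> ('i, 'e::real_normed_vector) ell2"
  is "\<lambda>i x j. if j = i then x else 0"
proof -
  fix i :: 'i and x :: 'e
  have "(\<lambda>j. (norm (if j = i then x else 0))\<^sup>2) summable_on {i}" by simp
  then show "(\<lambda>j. (norm (if j = i then x else 0))\<^sup>2) summable_on UNIV"
    by (rule summable_on_cong_neutral[THEN iffD1, rotated -1]) auto
qed

definition ell2_coord :: "'i \<Rightarrow> ('i, 'e::complex_inner) ell2 \<Rightarrow>\<^sub>C\<^sub>L 'e"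
  where "ell2_coord i = CBlinfun (Blinfun (\<lambda>f. ell2_nth f i))"

lemma ell2_coord_apply:
  fixes f :: "('i, 'e::complex_inner) ell2"
  shows "ell2_coord i *\<^sub>V f = ell2_nth f i"
  unfolding ell2_coord_def
proof (rule CBlinfun_Blinfun_apply)
  show "bounded_linear (\<lambda>f::('i, 'e) ell2. ell2_nth f i)"
    by (rule bounded_linear_intro[where K=1])
      (simp_all add: plus_ell2.rep_eq scaleR_ell2.rep_eq norm_ell2_nth_le)
qed (simp add: scaleC_ell2.rep_eq)


section \<open>The full Fock space and odometer maps\<close>

text \<open>
  The alphabet $1 < \dots < n$ is a finite linearly ordered type 'n with n = CARD('n) elements
  (types are nonempty, so that n is at least 1): the letter 1 is its least element, the letter n
  its greatest, and the letter a + 1 the successor of a. Words are lists of letters.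
  The Hilbert space tensor product of the Fock space with E is the space of square-summable
  E-valued families indexed by words, the elementary tensor of the basis vector of the word w
  with x being the family with the single nonzero entry x at w.
\<close>

definition letter_one :: "'n::{finite, linorder}"
  where "letter_one = Min UNIV"

definition letter_max :: "'n::{finite, linorder}"
  where "letter_max = Max UNIV"

definition letter_succ :: "'n::{finite, linorder} \<Rightarrow> 'n"
  where "letter_succ a = Min {b. a < b}"

type_synonym ('n, 'e) fock = "('n list, 'e) ell2"

abbreviation basis_tensor :: "'n list \<Rightarrow> 'e \<Rightarrow> ('n, 'e::real_normed_vector) fock"
  where "basis_tensor \<equiv> ell2_single"

lift_definition left_tensor :: "'n list \<Rightarrow> ('n, 'e::real_normed_vector) fock \<Rightarrow> ('n, 'e) fock"
  is "\<lambda>u f w. if take (length u) w = u then f (drop (length u) w) else 0"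
proof -
  fix u :: "'n list" and f :: "'n list \<Rightarrow> 'e"
  assume f: "(\<lambda>w. (norm (f w))\<^sup>2) summable_on UNIV"
  let ?g = "\<lambda>w. (norm (if take (length u) w = u then f (drop (length u) w) else 0))\<^sup>2"
  have "(?g \<circ> (@) u) summable_on UNIV" using f by (simp add: o_def)
  moreover have "inj ((@) u)" by (simp add: inj_on_def)
  ultimately have "?g summable_on range ((@) u)" using summable_on_reindex by blast
  then show "?g summable_on UNIV"
  proof (rule summable_on_cong_neutral[THEN iffD1, rotated -1])
    fix w assume w: "w \<in> UNIV - range ((@) u)"
    have "take (length u) w \<noteq> u"
    proof
      assume "take (length u) w = u"
      then have "w = u @ drop (length u) w" using append_take_drop_id[of "length u" w] by simp
      with w show False by blast
    qed
    then show "?g w = 0" by simp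
  qed auto
qed

lemma left_tensor_basis_tensor: "left_tensor u (basis_tensor v x) = basis_tensor (u @ v) x"
proof -
  have "w = u @ v \<longleftrightarrow> take (length u) w = u \<and> drop (length u) w = v" for w
    using append_eq_conv_conj[of u v w] by auto
  then show ?thesis
    by (simp add: ell2_nth_inject[symmetric] left_tensor.rep_eq ell2_single.rep_eq fun_eq_iff)
qed

text \<open>The equations fix W on all elementary tensors, so there is at most one bounded operator W
  satisfying them; being an operator of type cblinfun, W is bounded. List indices start at 0:
  the last clause concerns a word with k initial letters n followed by a letter different from n.\<close>

definition is_odometer_map ::
    "'e::chilbert_space \<Rightarrow>\<^sub>C\<^sub>L ('n::{finite, linorder}, 'e) fock \<Rightarrow>
      ('n, 'e) fock \<Rightarrow>\<^sub>C\<^sub>L ('n, 'e) fock \<Rightarrow> bool"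
  where "is_odometer_map L W \<longleftrightarrow>
    (\<forall>\<eta>. W *\<^sub>V basis_tensor [] \<eta> = L *\<^sub>V \<eta>) \<and>
    (\<forall>m\<ge>1. \<forall>\<eta>. W *\<^sub>V basis_tensor (replicate m letter_max) \<eta> =
      left_tensor (replicate m letter_one) (L *\<^sub>V \<eta>)) \<and>
    (\<forall>w k \<eta>. k < length w \<longrightarrow> w ! k \<noteq> letter_max \<longrightarrow> (\<forall>i<k. w ! i = letter_max) \<longrightarrow>
      W *\<^sub>V basis_tensor w \<eta> =
        basis_tensor (replicate k letter_one @ [letter_succ (w ! k)] @ drop (Suc k) w) \<eta>)"

definition M_perp :: "('n::{finite, linorder}, 'e::chilbert_space) fock set"
  where "M_perp = closure (cspan {basis_tensor (replicate m letter_one) \<xi> | m \<xi>. True})"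

definition symbol_coeff ::
    "'e::chilbert_space \<Rightarrow>\<^sub>C\<^sub>L ('n::{finite, linorder}, 'e) fock \<Rightarrow> nat \<Rightarrow> 'e \<Rightarrow>\<^sub>C\<^sub>L 'e"
  where "symbol_coeff L r = ell2_coord (replicate r letter_one) o\<^sub>C\<^sub>L L"

definition analytic_symbol ::
    "'e::chilbert_space \<Rightarrow>\<^sub>C\<^sub>L ('n::{finite, linorder}, 'e) fock \<Rightarrow> complex \<Rightarrow> 'e \<Rightarrow>\<^sub>C\<^sub>L 'e"
  where "analytic_symbol L z = (\<Sum>r. z ^ r *\<^sub>C symbol_coeff L r)"

lemma summable_analytic_symbol:
  fixes L :: "'e::chilbert_space \<Rightarrow>\<^sub>C\<^sub>L ('n::{finite, linorder}, 'e) fock"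
  assumes "cmod z < 1"
  shows "summable (\<lambda>r. z ^ r *\<^sub>C symbol_coeff L r)"
proof (rule summable_comparison_test')
  show "summable (\<lambda>r. cmod z ^ r * norm L)"
    using assms by (intro summable_mult2 summable_geometric) simp
  have "norm (symbol_coeff L r) \<le> norm L" for r
    by (rule norm_cblinfun_bound)
      (auto simp: symbol_coeff_def ell2_coord_apply
        intro: order_trans[OF norm_ell2_nth_le norm_cblinfun])
  then show "norm (z ^ r *\<^sub>C symbol_coeff L r) \<le> cmod z ^ r * norm L" if "r \<ge> 0" for r
    by (simp add: norm_scaleC norm_power mult_left_mono)
qed


section \<open>Bounded analytic operator-valued functions on the unit disc\<close>

text \<open>Functions on the disc are represented by functions on the whole plane whose values outside
  the open unit disc are irrelevant.\<close>

definition H_infinity :: "(complex \<Rightarrow> 'e::complex_normed_vector \<Rightarrow>\<^sub>C\<^sub>L 'e) set"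
  where "H_infinity = {F. (\<forall>z\<in>ball 0 1. \<exists>D. (F has_derivative (\<lambda>h. h *\<^sub>C D)) (at z)) \<and>
    bounded (F ` ball 0 1)}"

text \<open>Boundary values are radial limits in the strong operator topology.\<close>

definition has_boundary_value ::
    "(complex \<Rightarrow> 'e::complex_normed_vector \<Rightarrow>\<^sub>C\<^sub>L 'e) \<Rightarrow> complex \<Rightarrow> 'e \<Rightarrow>\<^sub>C\<^sub>L 'e \<Rightarrow> bool"
  where "has_boundary_value F \<zeta> B \<longleftrightarrow>
    (\<forall>x. ((\<lambda>r. F (complex_of_real r * \<zeta>) *\<^sub>V x) \<longlongrightarrow> B *\<^sub>V x) (at_left 1))"

definition inner_function :: "(complex \<Rightarrow> 'e::chilbert_space \<Rightarrow>\<^sub>C\<^sub>L 'e) \<Rightarrow> bool"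
  where "inner_function F \<longleftrightarrow> F \<in> H_infinity \<and>
    (AE t in lebesgue_on {0..2 * pi}.
      \<exists>B. has_boundary_value F (cis t) B \<and> cadjoint B o\<^sub>C\<^sub>L B = id_cblinfun)"

definition constant_unitary :: "(complex \<Rightarrow> 'e::chilbert_space \<Rightarrow>\<^sub>C\<^sub>L 'e) \<Rightarrow> bool"
  where "constant_unitary F \<longleftrightarrow> (\<exists>U. cunitary U \<and> (\<forall>z\<in>ball 0 1. F z = U))"

definition invertible_in_H_infinity :: "(complex \<Rightarrow> 'e::complex_normed_vector \<Rightarrow>\<^sub>C\<^sub>L 'e) \<Rightarrow> bool"
  where "invertible_in_H_infinity F \<longleftrightarrow> F \<in> H_infinity \<and>
    (\<forall>z\<in>ball 0 1. cinvertible (F z)) \<and> (\<lambda>z. cinverse (F z)) \<in> H_infinity"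

end

theory Submission
  imports Defs "HOL-Complex_Analysis.Cauchy_Integral_Formula"
begin

text \<open>
  The odometer on words, extended by carrying so that $n^m$ goes to $1^m$, is a bijection of all
  words. Composing \<open>W\<close> with the inverse of the induced unitary gives an operator \<open>A\<close> that fixes
  every vector orthogonal to the span of the $e_n^m \otimes \xi$; its compression \<open>T\<close> to that span,
  identified with the Hardy space, is multiplication by $\Theta$. Hence \<open>W\<close> is invertible iff \<open>T\<close>
  is, and isometric iff \<open>T\<close> is and \<open>A\<close> leaves the span invariant, the latter meaning
  $L\mathcal{E} \subseteq \mathcal{M}^\perp$.

  A multiplier is isometric iff its symbol is inner: Parseval's identity on circles of radius
  $r \to 1$ with dominated convergence gives one direction, and the other needs Fatou's theorem for
  vector-valued power series, obtained from a weak-type bound of the radial maximal function by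
  averages over intervals. The inverse of an invertible multiplier commutes with the shift, hence is
  a multiplier; a unitary one also commutes with the adjoint of the shift, which forces constants to
  go to constants.
\<close>

interpretation cblinfun: bounded_bilinear cblinfun_apply
proof (rule bounded_bilinear.intro)
  show "\<exists>K. \<forall>(A::'a \<Rightarrow>\<^sub>C\<^sub>L 'b) x. norm (A *\<^sub>V x) \<le> norm A * norm x * K"
    by (rule exI[of _ 1]) (simp add: norm_cblinfun)
qed (simp_all add: cblinfun_add_right plus_cblinfun_apply scaleR_cblinfun_apply
    linear_cmul[OF bounded_linear.linear[OF bounded_linear_cblinfun_apply]])

interpretation scaleC: bounded_bilinear "scaleC :: complex \<Rightarrow> 'a::complex_normed_vector \<Rightarrow> 'a"
proof (rule bounded_bilinear.intro)
  show "\<exists>K. \<forall>c (x::'a). norm (c *\<^sub>C x) \<le> norm c * norm x * K"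
    by (rule exI[of _ 1]) (simp add: norm_scaleC)
qed (simp_all add: scaleC_add_left scaleC_add_right scaleR_conv_of_real scaleC_of_real[symmetric]
    scaleC_scaleC mult.commute)

interpretation cinner: bounded_bilinear "cinner :: 'a::complex_inner \<Rightarrow> 'a \<Rightarrow> complex"
proof (rule bounded_bilinear.intro)
  fix a b :: 'a and r :: real
  show "\<exists>K. \<forall>x (y::'a). norm (cinner x y) \<le> norm x * norm y * K"
    by (rule exI[of _ 1]) (simp add: cinner_Cauchy_Schwarz)
  show "cinner (r *\<^sub>R a) b = r *\<^sub>R cinner a b"
    by (simp add: scaleC_of_real[symmetric] cinner_scaleC_left scaleR_conv_of_real)
  show "cinner a (r *\<^sub>R b) = r *\<^sub>R cinner a b"
    by (simp add: scaleC_of_real[symmetric] cinner_scaleC_right scaleR_conv_of_real)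
qed (simp_all add: cinner_add_left cinner_add_right)

section \<open>Polarization, adjoints and Riesz representation in complex Hilbert spaces\<close>

lemma CBlinfun_apply:
  assumes "\<And>x y. f (x + y) = f x + f y" "\<And>c x. f (c *\<^sub>C x) = c *\<^sub>C f x"
    "\<And>x. norm (f x) \<le> K * norm x"
  shows "CBlinfun (Blinfun f) *\<^sub>V x = f x"
proof (rule CBlinfun_Blinfun_apply)
  show "bounded_linear f"
    by (rule bounded_linear_intro[where K=K])
      (simp_all add: assms scaleC_of_real[symmetric] mult.commute[of _ K])
qed (rule assms(2))

lemma cinner_self: "cinner x x = complex_of_real ((norm (x::'a::complex_inner))\<^sup>2)"
proof (rule complex_eqI)
  have "Im (cinner x x) = Im (cnj (cinner x x))" using cinner_commute[of x x] by (rule arg_cong)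
  then have "Im (cinner x x) = - Im (cinner x x)" by simp
  then show "Im (cinner x x) = Im (complex_of_real ((norm x)\<^sup>2))" by simp
qed (simp add: Re_cinner power2_norm_eq_inner)

lemma norm_add_orthogonal:
  "cinner x y = 0 \<Longrightarrow> (norm (x + y))\<^sup>2 = (norm x)\<^sup>2 + (norm (y::'a::complex_inner))\<^sup>2"
  using Re_cinner[of x y]
  by (simp add: power2_norm_eq_inner inner_add_left inner_add_right inner_commute)

text \<open>Polarization: expanding the norm of \<open>x + y\<close> gives the real inner product,
  and the imaginary part of \<open>cinner x y\<close> is the real inner product of $i x$ with
  \<open>y\<close>.\<close>

lemma cisometry_iff_cinner:
  "cisometry A \<longleftrightarrow> (\<forall>x y. cinner (A *\<^sub>V x) (A *\<^sub>V y) = cinner x y)"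
  for A :: "'a::complex_inner \<Rightarrow>\<^sub>C\<^sub>L 'b::complex_inner"
proof
  assume A: "cisometry A"
  have *: "inner (A *\<^sub>V x) (A *\<^sub>V y) = inner x y" for x y
  proof -
    have "(norm (A *\<^sub>V (x + y)))\<^sup>2 = (norm (x + y))\<^sup>2" using A by (simp add: cisometry_def)
    moreover have "(norm (A *\<^sub>V x))\<^sup>2 = (norm x)\<^sup>2" "(norm (A *\<^sub>V y))\<^sup>2 = (norm y)\<^sup>2"
      using A by (simp_all add: cisometry_def)
    ultimately show ?thesis
      by (simp add: power2_norm_eq_inner cblinfun.add_right inner_add_left inner_add_right
          inner_commute)
  qed
  show "\<forall>x y. cinner (A *\<^sub>V x) (A *\<^sub>V y) = cinner x y"
    by (auto simp: complex_eq_iff Re_cinner Im_cinner * cblinfun_scaleC_right[symmetric])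
next
  assume "\<forall>x y. cinner (A *\<^sub>V x) (A *\<^sub>V y) = cinner x y"
  then have "complex_of_real ((norm (A *\<^sub>V x))\<^sup>2) = complex_of_real ((norm x)\<^sup>2)" for x
    by (simp only: cinner_self[symmetric])
  then have "(norm (A *\<^sub>V x))\<^sup>2 = (norm x)\<^sup>2" for x
    by (simp only: of_real_eq_iff)
  then show "cisometry A" by (simp add: cisometry_def)
qed

lemma cisometry_iff_cadjoint:
  "cisometry A \<longleftrightarrow> cadjoint A o\<^sub>C\<^sub>L A = id_cblinfun"
  for A :: "'a::chilbert_space \<Rightarrow>\<^sub>C\<^sub>L 'b::chilbert_space"
proof
  assume "cisometry A"
  then have "cinner x (cadjoint A *\<^sub>V A *\<^sub>V y) = cinner x y" for x y
    by (simp add: cisometry_iff_cinner cinner_cadjoint[symmetric])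
  then show "cadjoint A o\<^sub>C\<^sub>L A = id_cblinfun"
    by (intro cblinfun_eqI cinner_eqI) simp
next
  assume "cadjoint A o\<^sub>C\<^sub>L A = id_cblinfun"
  then have "cadjoint A *\<^sub>V A *\<^sub>V y = y" for y
    by (metis cblinfun_compose_apply id_cblinfun_apply)
  then show "cisometry A"
    by (simp add: cisometry_iff_cinner cinner_cadjoint)
qed

lemma cblinfun_compose_eq_id_iff: "A o\<^sub>C\<^sub>L B = id_cblinfun \<longleftrightarrow> (\<forall>x. A *\<^sub>V B *\<^sub>V x = x)"
  by (metis cblinfun_compose_apply id_cblinfun_apply cblinfun_eqI)

lemma cinvertible_iff: "cinvertible A \<longleftrightarrow> (\<exists>B. (\<forall>x. B *\<^sub>V A *\<^sub>V x = x) \<and> (\<forall>x. A *\<^sub>V B *\<^sub>V x = x))"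
  by (simp add: cinvertible_def is_cinverse_def cblinfun_compose_eq_id_iff)

text \<open>Splits unitarity into the two properties that are characterized separately. The missing
  identity comes from applying the isometry identity to a preimage \<open>B y\<close> of
  \<open>y\<close>.\<close>

lemma cunitary_iff: "cunitary A \<longleftrightarrow> cisometry A \<and> cinvertible A"
proof
  assume "cunitary A"
  then show "cisometry A \<and> cinvertible A"
    by (auto simp: cunitary_def cisometry_iff_cadjoint cinvertible_def is_cinverse_def)
next
  assume A: "cisometry A \<and> cinvertible A"
  then obtain B where B: "\<And>x. A *\<^sub>V B *\<^sub>V x = x" by (auto simp: cinvertible_iff)
  have *: "cadjoint A *\<^sub>V A *\<^sub>V y = y" for y
    using A unfolding cisometry_iff_cadjoint by (metis cblinfun_compose_apply id_cblinfun_apply)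
  have "A *\<^sub>V cadjoint A *\<^sub>V y = y" for y
    using *[of "B *\<^sub>V y"] B by simp
  with A show "cunitary A"
    by (auto simp: cunitary_def cisometry_iff_cadjoint intro: cblinfun_eqI)
qed

text \<open>The functional is conjugate-linear because the representing vector is wanted in the
  linear slot of \<open>cinner\<close>. The real Riesz theorem handles the real part, and the
  imaginary part at \<open>x\<close> is the real part at $i x$.\<close>

lemma riesz_representation:
  fixes f :: "'a::chilbert_space \<Rightarrow> complex"
  assumes add: "\<And>x y. f (x + y) = f x + f y" and scale: "\<And>c x. f (c *\<^sub>C x) = cnj c * f x"
    and bound: "\<And>x. cmod (f x) \<le> K * norm x"
  shows "\<exists>y. \<forall>x. f x = cinner x y"
proof -
  have "bounded_linear (\<lambda>x. Re (f x))"
    by (rule bounded_linear_intro[where K=K])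
      (auto simp: add scale scaleC_of_real[symmetric] mult.commute[of _ K]
        intro: order_trans[OF abs_Re_le_cmod bound])
  then obtain y where y: "\<And>x. Re (f x) = inner y x"
    using riesz_representation_real by blast
  have "Im (f x) = Re (f (\<i> *\<^sub>C x))" for x by (simp add: scale)
  then have "f x = cinner x y" for x
    by (simp add: complex_eq_iff y Re_cinner Im_cinner inner_commute)
  then show ?thesis by blast
qed


subsection \<open>Square-summable families\<close>

lemmas ell2_nth_simps [simp] = zero_ell2.rep_eq plus_ell2.rep_eq minus_ell2.rep_eq
  scaleR_ell2.rep_eq scaleC_ell2.rep_eq uminus_ell2.rep_eq

lemma ell2_eqI: "(\<And>i. ell2_nth f i = ell2_nth g i) \<Longrightarrow> f = g"
  by (simp add: ell2_nth_inject[symmetric] fun_eq_iff)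

lemma ell2_nth_single: "ell2_nth (ell2_single i x) j = (if j = i then x else 0)"
  by (simp add: ell2_single.rep_eq)

lemma ell2_nth_sum: "ell2_nth (sum f F) i = (\<Sum>j\<in>F. ell2_nth (f j) i)"
  for f :: "'j \<Rightarrow> ('i, 'e::real_inner) ell2"
  by (induction F rule: infinite_finite_induct) simp_all

lemma cinner_single: "cinner (ell2_single i x) f = cinner x (ell2_nth f i)"
  for x :: "'e::complex_inner"
proof -
  have "cinner (ell2_single i x) f = (\<Sum>\<^sub>\<infinity>j\<in>{i}. cinner x (ell2_nth f i))"
    unfolding cinner_ell2.rep_eq
    by (rule infsum_cong_neutral) (auto simp: ell2_nth_single cinner.zero_left)
  then show ?thesis by simp
qed

lemma norm_single [simp]: "norm (ell2_single i x) = norm (x::'e::complex_inner)"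
proof (rule power2_eq_imp_eq)
  show "(norm (ell2_single i x))\<^sup>2 = (norm x)\<^sup>2"
    using cinner_single[of i x "ell2_single i x"]
    by (simp add: cinner_self ell2_nth_single flip: of_real_power)
qed simp_all

lemma ell2_single_scaleC: "ell2_single i (c *\<^sub>C x) = c *\<^sub>C ell2_single i (x::'e::complex_inner)"
  by (rule ell2_eqI) (simp add: ell2_nth_single scaleC.zero_right)

text \<open>The squared distance from \<open>f\<close> to a finite partial sum equals
  \<open>(norm f)^2\<close> minus the sum of the squared norms of the chosen coordinates, and this
  difference tends to 0.\<close>

lemma ell2_has_sum:
  fixes f :: "('i, 'e::complex_inner) ell2"
  shows "((\<lambda>i. ell2_single i (ell2_nth f i)) has_sum f) UNIV"
proof -
  let ?s = "\<lambda>F. \<Sum>i\<in>F. ell2_single i (ell2_nth f i)"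
  have s: "ell2_nth (?s F) j = (if j \<in> F then ell2_nth f j else 0)" if "finite F" for F j
    using that by (simp add: ell2_nth_sum ell2_nth_single if_distrib sum.delta cong: if_cong)
  have n: "(norm (?s F - f))\<^sup>2 = (norm f)\<^sup>2 - (\<Sum>i\<in>F. (norm (ell2_nth f i))\<^sup>2)" if F: "finite F" for F
  proof -
    have "(norm (?s F - f))\<^sup>2 = (\<Sum>\<^sub>\<infinity>i\<in>UNIV - F. (norm (ell2_nth f i))\<^sup>2)"
      unfolding power2_norm_ell2
      by (rule infsum_cong_neutral) (auto simp: s[OF F])
    also have "\<dots> = (norm f)\<^sup>2 - (\<Sum>i\<in>F. (norm (ell2_nth f i))\<^sup>2)"
      unfolding power2_norm_ell2 using F
      by (subst infsum_Diff) (auto intro: ell2_summable)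
    finally show ?thesis .
  qed
  have "((\<lambda>F. (norm f)\<^sup>2 - (\<Sum>i\<in>F. (norm (ell2_nth f i))\<^sup>2)) \<longlongrightarrow> (norm f)\<^sup>2 - (norm f)\<^sup>2)
      (finite_subsets_at_top UNIV)"
    using has_sum_infsum[OF ell2_summable[of f]]
    by (intro tendsto_intros) (simp add: has_sum_def power2_norm_ell2)
  moreover have "\<forall>\<^sub>F F in finite_subsets_at_top UNIV.
      (norm f)\<^sup>2 - (\<Sum>i\<in>F. (norm (ell2_nth f i))\<^sup>2) = (norm (?s F - f))\<^sup>2"
    by (rule eventually_finite_subsets_at_top_weakI) (simp add: n)
  ultimately have "((\<lambda>F. (norm (?s F - f))\<^sup>2) \<longlongrightarrow> (norm f)\<^sup>2 - (norm f)\<^sup>2) (finite_subsets_at_top UNIV)"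
    by (rule Lim_transform_eventually)
  then have "((\<lambda>F. (norm (?s F - f))\<^sup>2) \<longlongrightarrow> 0) (finite_subsets_at_top UNIV)"
    by simp
  then have "((\<lambda>F. sqrt ((norm (?s F - f))\<^sup>2)) \<longlongrightarrow> sqrt 0) (finite_subsets_at_top UNIV)"
    by (rule tendsto_real_sqrt)
  then have "((\<lambda>F. norm (?s F - f)) \<longlongrightarrow> 0) (finite_subsets_at_top UNIV)"
    by simp
  then show ?thesis
    unfolding has_sum_def by (subst tendsto_dist_iff) (simp only: dist_norm)
qed

text \<open>The density argument used throughout. It takes real-linear maps into any normed space,
  so evaluations of power series are covered as well as operators on families.\<close>

lemma eq_on_singlesI:
  fixes A B :: "('i, 'e::complex_inner) ell2 \<Rightarrow> 'b::real_normed_vector"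
  assumes "bounded_linear A" "bounded_linear B"
    and eq: "\<And>i x. A (ell2_single i x) = B (ell2_single i x)"
  shows "A f = B f"
proof -
  have "((\<lambda>i. A (ell2_single i (ell2_nth f i))) has_sum A f) UNIV"
    "((\<lambda>i. B (ell2_single i (ell2_nth f i))) has_sum B f) UNIV"
    using has_sum_bounded_linear[OF assms(1) ell2_has_sum[of f]]
      has_sum_bounded_linear[OF assms(2) ell2_has_sum[of f]] by (simp_all add: o_def)
  then show ?thesis unfolding eq by (rule has_sum_unique)
qed

definition ell2_pull :: "('i \<Rightarrow> 'j) \<Rightarrow> ('j, 'e::complex_inner) ell2 \<Rightarrow>\<^sub>C\<^sub>L ('i, 'e) ell2"
  where "ell2_pull \<sigma> = CBlinfun (Blinfun (\<lambda>f. Abs_ell2 (\<lambda>i. ell2_nth f (\<sigma> i))))"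

lemma ell2_pull_nth:
  fixes \<sigma> :: "'i \<Rightarrow> 'j" and f :: "('j, 'e::complex_inner) ell2"
  assumes "inj \<sigma>"
  shows "ell2_nth (ell2_pull \<sigma> *\<^sub>V f) i = ell2_nth f (\<sigma> i)"
proof -
  define P :: "('j, 'e) ell2 \<Rightarrow> ('i, 'e) ell2" where "P f = Abs_ell2 (\<lambda>i. ell2_nth f (\<sigma> i))" for f
  have summ: "(\<lambda>j. (norm (ell2_nth f j))\<^sup>2) summable_on range \<sigma>" for f :: "('j, 'e) ell2"
    by (rule summable_on_subset_banach[OF ell2_summable]) simp
  have nth: "ell2_nth (P f) = (\<lambda>i. ell2_nth f (\<sigma> i))" for f
    unfolding P_def
    using summable_on_reindex[OF assms, of "\<lambda>j. (norm (ell2_nth f j))\<^sup>2"] summ[of f]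
    by (intro Abs_ell2_inverse) (simp add: o_def)
  have "norm (P f) \<le> 1 * norm f" for f :: "('j, 'e) ell2"
  proof (rule power2_le_imp_le)
    have "(norm (P f))\<^sup>2 = (\<Sum>\<^sub>\<infinity>j\<in>range \<sigma>. (norm (ell2_nth f j))\<^sup>2)"
      by (simp add: power2_norm_ell2 nth infsum_reindex[OF assms] o_def)
    also have "\<dots> \<le> (1 * norm f)\<^sup>2"
      unfolding power2_norm_ell2 mult_1 by (rule infsum_mono_neutral[OF summ ell2_summable]) auto
    finally show "(norm (P f))\<^sup>2 \<le> (1 * norm f)\<^sup>2" .
  qed simp
  then have "ell2_pull \<sigma> *\<^sub>V f = P f"
    unfolding ell2_pull_def P_def[symmetric]
    by (intro CBlinfun_apply[where K=1] ell2_eqI) (simp_all add: nth)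
  then show ?thesis by (simp add: nth)
qed

text \<open>Extension by zero along an injection. Taking the adjoint of the pull gives boundedness
  and duality at once; the coordinates are then read off by pairing with single-entry
  families.\<close>

definition ell2_push :: "('i \<Rightarrow> 'j) \<Rightarrow> ('i, 'e::chilbert_space) ell2 \<Rightarrow>\<^sub>C\<^sub>L ('j, 'e) ell2"
  where "ell2_push \<sigma> = cadjoint (ell2_pull \<sigma>)"

lemma cinner_push: "cinner f (ell2_push \<sigma> *\<^sub>V g) = cinner (ell2_pull \<sigma> *\<^sub>V f) g"
  by (simp add: ell2_push_def cinner_cadjoint)

lemma ell2_pull_single:
  assumes "inj \<sigma>"
  shows "ell2_pull \<sigma> *\<^sub>V ell2_single (\<sigma> i) x = ell2_single i (x::'e::complex_inner)"
  using assms by (intro ell2_eqI) (auto simp: ell2_pull_nth ell2_nth_single dest: injD)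

lemma ell2_push_nth [simp]:
  assumes "inj \<sigma>"
  shows "ell2_nth (ell2_push \<sigma> *\<^sub>V f) (\<sigma> i) = ell2_nth (f::('i, 'e::chilbert_space) ell2) i"
proof (rule cinner_eqI)
  fix x
  show "cinner x (ell2_nth (ell2_push \<sigma> *\<^sub>V f) (\<sigma> i)) = cinner x (ell2_nth f i)"
    using assms by (simp add: cinner_single[symmetric] cinner_push ell2_pull_single)
qed

lemma ell2_push_nth_outside:
  fixes f :: "('i, 'e::chilbert_space) ell2"
  assumes "inj \<sigma>" "j \<notin> range \<sigma>"
  shows "ell2_nth (ell2_push \<sigma> *\<^sub>V f) j = 0"
proof (rule cinner_eqI)
  fix x :: 'e
  have "ell2_pull \<sigma> *\<^sub>V ell2_single j x = 0"
    using assms by (intro ell2_eqI) (auto simp: ell2_pull_nth ell2_nth_single)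
  then show "cinner x (ell2_nth (ell2_push \<sigma> *\<^sub>V f) j) = cinner x 0"
    by (simp add: cinner_single[symmetric] cinner_push cinner.zero_left cinner.zero_right)
qed

lemma ell2_push_single:
  assumes "inj \<sigma>"
  shows "ell2_push \<sigma> *\<^sub>V ell2_single i x = ell2_single (\<sigma> i) (x::'e::chilbert_space)"
proof (rule ell2_eqI)
  fix j
  show "ell2_nth (ell2_push \<sigma> *\<^sub>V ell2_single i x) j = ell2_nth (ell2_single (\<sigma> i) x) j"
  proof (cases "j \<in> range \<sigma>")
    case True
    then show ?thesis using assms by (auto simp: ell2_nth_single dest: injD)
  next
    case False
    then show ?thesis using assms by (auto simp: ell2_push_nth_outside ell2_nth_single)
  qed
qed

lemma ell2_pull_push [simp]:
  assumes "inj \<sigma>"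
  shows "ell2_pull \<sigma> *\<^sub>V ell2_push \<sigma> *\<^sub>V f = (f::('i, 'e::chilbert_space) ell2)"
  using assms by (intro ell2_eqI) (simp add: ell2_pull_nth)

lemma cisometry_push: "inj \<sigma> \<Longrightarrow> cisometry (ell2_push \<sigma> :: ('i, 'e::chilbert_space) ell2 \<Rightarrow>\<^sub>C\<^sub>L _)"
  by (simp add: cisometry_iff_cinner cinner_push)

lemma ell2_push_pull_bij [simp]:
  assumes "bij \<sigma>"
  shows "ell2_push \<sigma> *\<^sub>V ell2_pull \<sigma> *\<^sub>V f = (f::('i, 'e::chilbert_space) ell2)"
proof (rule ell2_eqI)
  fix j
  obtain i where "j = \<sigma> i" using surjD[OF bij_is_surj[OF assms], of j] by blast
  then show "ell2_nth (ell2_push \<sigma> *\<^sub>V ell2_pull \<sigma> *\<^sub>V f) j = ell2_nth f j"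
    using assms by (simp add: ell2_pull_nth bij_is_inj)
qed

subsection \<open>Power series with vector coefficients\<close>

text \<open>Lets scalar coefficients share the vector-valued lemmas: the geometric series in the
  Poisson formula, the values of \<open>cinner\<close> in Parseval, and the series of squared
  coefficient norms.\<close>

instantiation complex :: complex_normed_vector
begin

definition scaleC_complex :: "complex \<Rightarrow> complex \<Rightarrow> complex"
  where [simp]: "scaleC_complex c x = c * x"

instance
  by standard (simp_all add: algebra_simps norm_mult scaleR_conv_of_real)

end

definition power_sum :: "(nat \<Rightarrow> 'a::{complex_normed_vector, banach}) \<Rightarrow> complex \<Rightarrow> 'a"
  where "power_sum a z = (\<Sum>k. z ^ k *\<^sub>C a k)"

lemma power_sum_sums:
  assumes "summable (\<lambda>k. norm (a k))" "cmod z \<le> 1"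
  shows "(\<lambda>k. z ^ k *\<^sub>C a k) sums power_sum a z"
proof -
  have "summable (\<lambda>k. z ^ k *\<^sub>C a k)"
    by (rule summable_comparison_test'[OF assms(1), of 0])
      (simp add: norm_scaleC norm_power power_le_one assms(2) mult_left_le_one_le)
  then show ?thesis unfolding power_sum_def by (rule summable_sums)
qed

lemma uniform_limit_power_sum:
  assumes "summable (\<lambda>k. norm (a k))"
  shows "uniform_limit (cball 0 1) (\<lambda>n z. \<Sum>k<n. z ^ k *\<^sub>C a k) (power_sum a) sequentially"
  unfolding power_sum_def[abs_def]
  by (rule Weierstrass_m_test[OF _ assms])
    (simp add: norm_scaleC norm_power power_le_one mult_left_le_one_le)

lemma continuous_on_power_sum:
  assumes "summable (\<lambda>k. norm (a k))"
  shows "continuous_on (cball 0 1) (power_sum a)"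
  by (rule uniform_limit_theorem[OF _ uniform_limit_power_sum[OF assms]])
    (auto intro!: always_eventually continuous_intros scaleC.continuous_on)

lemma norm_power_sum_le:
  assumes "summable (\<lambda>k. norm (a k))" "cmod z \<le> 1"
  shows "norm (power_sum a z) \<le> (\<Sum>k. norm (a k))"
  unfolding power_sum_def
  by (rule norm_suminf_le[OF _ assms(1)])
    (simp add: norm_scaleC norm_power power_le_one assms(2) mult_left_le_one_le)

text \<open>The start \<open>s\<close> of the period is free because integrals over
  \<open>{0..2 * pi}\<close>, over \<open>{-pi..pi}\<close> and over the two periods of
  \<open>{-pi..3 * pi}\<close> all occur.\<close>

lemma has_integral_cis:
  "((\<lambda>t. cis (of_int m * t)) has_integral (if m = 0 then 2 * pi else 0)) {s..s + 2 * pi}"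
proof (cases "m = 0")
  case True
  then show ?thesis using has_integral_const_real[of "1::complex" s "s + 2 * pi"]
    by (simp add: scaleR_conv_of_real)
next
  case False
  define c where "c = \<i> * complex_of_int m"
  let ?F = "\<lambda>t. exp (c * complex_of_real t) / c"
  have cis: "cis (of_int m * t) = exp (c * complex_of_real t)" for t
    by (simp add: cis_conv_exp c_def mult.assoc)
  have "((\<lambda>t. cis (of_int m * t)) has_integral ?F (s + 2 * pi) - ?F s) {s..s + 2 * pi}"
    unfolding cis
  proof (rule fundamental_theorem_of_calculus)
    fix t :: real
    show "(?F has_vector_derivative exp (c * complex_of_real t)) (at t within {s..s + 2 * pi})"
      by (rule has_vector_derivative_real_field)
        (use False in \<open>auto intro!: derivative_eq_intros simp: c_def\<close>)
  qed simp
  moreover have "cis (of_int m * (s + 2 * pi)) = cis (of_int m * s)"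
    using cis_multiple_2pi[of "of_int m"]
    by (simp add: distrib_left cis_mult[symmetric] mult.commute mult.left_commute)
  ultimately show ?thesis using False by (simp add: cis)
qed

text \<open>Orthogonality of the exponentials leaves the diagonal of the double sum. A general
  sesquilinear \<open>B\<close> covers both Parseval, where it is \<open>cinner\<close>, and the
  Poisson formula, where it multiplies a vector by a conjugated scalar.\<close>

lemma has_integral_circle_prod_sum:
  fixes B :: "'a::complex_normed_vector \<Rightarrow> 'b::complex_normed_vector \<Rightarrow> 'c::{complex_normed_vector, banach}"
  assumes B: "bounded_bilinear B"
    and B1: "\<And>c x y. B (c *\<^sub>C x) y = cnj c *\<^sub>C B x y"
    and B2: "\<And>c x y. B x (c *\<^sub>C y) = c *\<^sub>C B x y"
  shows "((\<lambda>t. B (\<Sum>k<n. cis t ^ k *\<^sub>C a k) (\<Sum>k<n. cis t ^ k *\<^sub>C b k)) has_integral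
    (2 * pi) *\<^sub>R (\<Sum>k<n. B (a k) (b k))) {s..s + 2 * pi}"
proof -
  interpret B: bounded_bilinear B by (rule B)
  have eq: "B (\<Sum>k<n. cis t ^ k *\<^sub>C a k) (\<Sum>k<n. cis t ^ k *\<^sub>C b k)
      = (\<Sum>j<n. \<Sum>k<n. cis (of_int (int k - int j) * t) *\<^sub>C B (a j) (b k))" for t
    by (subst sum.swap) (simp add: B.sum_left B.sum_right B1 B2 scaleC.sum_right scaleC_scaleC
        cis_cnj Complex.DeMoivre cis_mult algebra_simps)
  have "((\<lambda>t. \<Sum>j<n. \<Sum>k<n. cis (of_int (int k - int j) * t) *\<^sub>C B (a j) (b k)) has_integral
      (\<Sum>j<n. \<Sum>k<n. (if int k - int j = 0 then complex_of_real (2 * pi) else 0) *\<^sub>C B (a j) (b k)))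
      {s..s + 2 * pi}"
  proof (intro has_integral_sum finite_lessThan)
    fix j k
    have "bounded_linear (\<lambda>c. c *\<^sub>C B (a j) (b k))" by (rule scaleC.bounded_linear_left)
    from has_integral_linear[OF has_integral_cis[of "int k - int j" s] this]
    show "((\<lambda>t. cis (of_int (int k - int j) * t) *\<^sub>C B (a j) (b k)) has_integral
      (if int k - int j = 0 then complex_of_real (2 * pi) else 0) *\<^sub>C B (a j) (b k)) {s..s + 2 * pi}"
      by (cases "k = j") (simp_all add: o_def scaleC.zero_left)
  qed
  also have "(\<Sum>j<n. \<Sum>k<n. (if int k - int j = 0 then complex_of_real (2 * pi) else 0) *\<^sub>C B (a j) (b k))
      = (\<Sum>j<n. \<Sum>k<n. if k = j then (2 * pi) *\<^sub>R B (a j) (b k) else 0)"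
    by (intro sum.cong refl) (simp del: of_real_mult add: scaleC_of_real)
  also have "\<dots> = (2 * pi) *\<^sub>R (\<Sum>k<n. B (a k) (b k))"
    by (simp add: scaleR_sum_right)
  finally show ?thesis by (simp only: eq)
qed

lemma (in bounded_bilinear) summable_abs:
  fixes a :: "nat \<Rightarrow> 'a" and b :: "nat \<Rightarrow> 'b"
  assumes a: "summable (\<lambda>k. norm (a k))" and b: "summable (\<lambda>k. norm (b k))"
  shows "summable (\<lambda>k. norm (prod (a k) (b k)))"
proof -
  obtain K where K: "\<And>x y. norm (prod x y) \<le> norm x * norm y * K" "0 \<le> K"
    using nonneg_bounded by blast
  have "Bseq (\<lambda>k. norm (a k))"
    using summable_LIMSEQ_zero[OF a] by (intro convergent_imp_Bseq convergentI)
  then obtain M where M: "\<And>k. norm (a k) \<le> M" by (auto simp: Bseq_def)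
  show ?thesis
  proof (rule summable_comparison_test')
    show "summable (\<lambda>k. M * norm (b k) * K)" using b by (intro summable_mult summable_mult2)
    show "norm (norm (prod (a k) (b k))) \<le> M * norm (b k) * K" if "k \<ge> 0" for k
      unfolding real_norm_def abs_norm_cancel by (rule order_trans[OF K(1)]) (intro mult_right_mono M K(2) norm_ge_zero)
  qed
qed

text \<open>Absolutely summable coefficients make the partial sums converge uniformly on the circle,
  and a bounded bilinear map preserves uniform convergence to bounded limits, so the integrals
  converge.\<close>

lemma has_integral_circle_prod:
  fixes B :: "'a::{complex_normed_vector, banach} \<Rightarrow> 'b::{complex_normed_vector, banach}
    \<Rightarrow> 'c::{complex_normed_vector, banach}"
  assumes B: "bounded_bilinear B"
    and B1: "\<And>c x y. B (c *\<^sub>C x) y = cnj c *\<^sub>C B x y"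
    and B2: "\<And>c x y. B x (c *\<^sub>C y) = c *\<^sub>C B x y"
    and a: "summable (\<lambda>k. norm (a k))" and b: "summable (\<lambda>k. norm (b k))"
  shows "((\<lambda>t. B (power_sum a (cis t)) (power_sum b (cis t))) has_integral
    (2 * pi) *\<^sub>R (\<Sum>k. B (a k) (b k))) {s..s + 2 * pi}"
proof -
  interpret B: bounded_bilinear B by (rule B)
  have lim: "uniform_limit {s..s + 2 * pi} (\<lambda>n t. \<Sum>k<n. cis t ^ k *\<^sub>C c k)
      (\<lambda>t. power_sum c (cis t)) sequentially"
    if "summable (\<lambda>k. norm (c k))" for c :: "nat \<Rightarrow> 'd::{complex_normed_vector, banach}"
    by (rule uniform_limit_compose'[OF uniform_limit_power_sum[OF that]]) auto
  have bdd: "bounded ((\<lambda>t. power_sum c (cis t)) ` S)"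
    if "summable (\<lambda>k. norm (c k))" for c :: "nat \<Rightarrow> 'd::{complex_normed_vector, banach}" and S
    by (rule boundedI[of _ "\<Sum>k. norm (c k)"]) (auto intro: norm_power_sum_le that)
  have "uniform_limit {s..s + 2 * pi}
      (\<lambda>n t. B (\<Sum>k<n. cis t ^ k *\<^sub>C a k) (\<Sum>k<n. cis t ^ k *\<^sub>C b k))
      (\<lambda>t. B (power_sum a (cis t)) (power_sum b (cis t))) sequentially"
    by (intro B.bounded_uniform_limit lim bdd a b)
  then obtain I J where I: "\<And>n. ((\<lambda>t. B (\<Sum>k<n. cis t ^ k *\<^sub>C a k) (\<Sum>k<n. cis t ^ k *\<^sub>C b k))
        has_integral I n) {s..s + 2 * pi}"
    and J: "((\<lambda>t. B (power_sum a (cis t)) (power_sum b (cis t))) has_integral J) {s..s + 2 * pi}"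
    and IJ: "I \<longlonglongrightarrow> J"
    by (rule uniform_limit_integral)
      (auto intro!: B.continuous_on scaleC.continuous_on continuous_intros)
  have "I = (\<lambda>n. (2 * pi) *\<^sub>R (\<Sum>k<n. B (a k) (b k)))"
    using has_integral_unique[OF I has_integral_circle_prod_sum[OF B B1 B2]] by auto
  moreover have "summable (\<lambda>k. B (a k) (b k))" by (rule summable_norm_cancel[OF B.summable_abs[OF a b]])
  then have "(\<lambda>n. (2 * pi) *\<^sub>R (\<Sum>k<n. B (a k) (b k))) \<longlonglongrightarrow> (2 * pi) *\<^sub>R (\<Sum>k. B (a k) (b k))"
    by (intro tendsto_intros summable_LIMSEQ)
  ultimately have "J = (2 * pi) *\<^sub>R (\<Sum>k. B (a k) (b k))"
    using IJ LIMSEQ_unique by auto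
  with J show ?thesis by simp
qed

lemma parseval:
  fixes c :: "nat \<Rightarrow> 'e::chilbert_space"
  assumes "summable (\<lambda>k. norm (c k))"
  shows "((\<lambda>t. (norm (power_sum c (cis t)))\<^sup>2) has_integral 2 * pi * (\<Sum>k. (norm (c k))\<^sup>2)) {s..s + 2 * pi}"
proof -
  have "((\<lambda>t. cinner (power_sum c (cis t)) (power_sum c (cis t))) has_integral
    (2 * pi) *\<^sub>R (\<Sum>k. cinner (c k) (c k))) {s..s + 2 * pi}"
    by (rule has_integral_circle_prod[OF cinner.bounded_bilinear_axioms _ _ assms assms])
      (simp_all add: cinner_scaleC_left cinner_scaleC_right)
  from has_integral_linear[OF this bounded_linear_Re]
  have "((\<lambda>t. (norm (power_sum c (cis t)))\<^sup>2) has_integral Re ((2 * pi) *\<^sub>R (\<Sum>k. cinner (c k) (c k))))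
      {s..s + 2 * pi}"
    by (simp add: o_def cinner_self)
  moreover have "summable (\<lambda>k. cinner (c k) (c k))"
    by (rule summable_norm_cancel[OF cinner.summable_abs[OF assms assms]])
  ultimately show ?thesis by (simp add: Re_suminf cinner_self)
qed

text \<open>Moves a radius or a rotation into the coefficients. A radius below 1 makes bounded
  coefficients absolutely summable, which brings smaller circles within reach of the formulas on the
  unit circle.\<close>

lemma power_sum_scale: "power_sum (\<lambda>k. w ^ k *\<^sub>C a k) z = power_sum a (w * z)"
  by (simp add: power_sum_def scaleC_scaleC power_mult_distrib mult.commute)

lemma summable_norm_geometric:
  fixes a :: "nat \<Rightarrow> 'a::complex_normed_vector"
  assumes "\<And>k. norm (a k) \<le> C" "cmod z < 1"
  shows "summable (\<lambda>k. norm (z ^ k *\<^sub>C a k))"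
proof (rule summable_comparison_test')
  show "summable (\<lambda>k. cmod z ^ k * C)" using assms(2) by (intro summable_mult2 summable_geometric) simp
  show "norm (norm (z ^ k *\<^sub>C a k)) \<le> cmod z ^ k * C" if "k \<ge> 0" for k
    by (simp add: norm_scaleC norm_power mult_left_mono assms(1))
qed

lemma power_sum_sums_disc:
  assumes "\<And>k. norm (a k) \<le> C" "cmod z < 1"
  shows "(\<lambda>k. z ^ k *\<^sub>C a k) sums power_sum a z"
  unfolding power_sum_def
  by (rule summable_sums[OF summable_norm_cancel[OF summable_norm_geometric[OF assms]]])

lemma parseval_radius:
  fixes c :: "nat \<Rightarrow> 'e::chilbert_space"
  assumes c: "\<And>k. norm (c k) \<le> C" and r: "0 \<le> r" "r < 1"
  shows "((\<lambda>t. (norm (power_sum c (complex_of_real r * cis t)))\<^sup>2) has_integral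
    2 * pi * (\<Sum>k. r ^ (2 * k) * (norm (c k))\<^sup>2)) {s..s + 2 * pi}"
proof -
  let ?r = "complex_of_real r"
  have "summable (\<lambda>k. norm (?r ^ k *\<^sub>C c k))"
    by (rule summable_norm_geometric[OF c]) (use r in simp)
  from parseval[OF this, of s] show ?thesis
    using r by (simp add: power_sum_scale norm_scaleC norm_power power_mult_distrib power_even_eq)
qed

section \<open>The Poisson formula for vector-valued power series\<close>

definition poisson_kernel :: "real \<Rightarrow> real \<Rightarrow> real"
  where "poisson_kernel r s = (1 - r\<^sup>2) / (1 - 2 * r * cos s + r\<^sup>2)"

lemma poisson_denominator: "1 - 2 * r * cos s + r\<^sup>2 = (cmod (1 - complex_of_real r * cis s))\<^sup>2"
proof -
  have "(cmod (1 - complex_of_real r * cis s))\<^sup>2 = (1 - r * cos s)\<^sup>2 + (r * sin s)\<^sup>2"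
    by (simp add: cmod_power2)
  also have "\<dots> = 1 - 2 * r * cos s + r\<^sup>2"
    by (simp add: power2_diff power_mult_distrib sin_squared_eq right_diff_distrib)
  finally show ?thesis by simp
qed

lemma poisson_denominator_pos:
  fixes r :: real
  assumes "0 \<le> r" "r < 1"
  shows "0 < 1 - 2 * r * cos s + r\<^sup>2"
proof -
  have "complex_of_real r * cis s \<noteq> 1"
  proof
    assume "complex_of_real r * cis s = 1"
    then have "cmod (complex_of_real r * cis s) = 1" by simp
    then show False using assms by (simp add: norm_mult)
  qed
  then show ?thesis unfolding poisson_denominator by simp
qed

lemma has_integral_poisson:
  fixes c :: "nat \<Rightarrow> 'a::{complex_normed_vector, banach}"
  assumes c: "summable (\<lambda>k. norm (c k))" and r: "0 \<le> r" "r < 1"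
  shows "((\<lambda>t. poisson_kernel r t *\<^sub>R power_sum c (cis t)) has_integral
    (2 * pi) *\<^sub>R power_sum c (complex_of_real r)) {s..s + 2 * pi}"
proof -
  define q where "q = complex_of_real r"
  have q: "cmod q < 1" using r by (simp add: q_def)
  define g where "g k = (\<Sum>j\<le>k. q ^ j *\<^sub>C c (k - j))" for k
  have g_Suc: "g (Suc k) = c (Suc k) + q *\<^sub>C g k" for k
    by (simp only: g_def sum.atMost_Suc_shift)
      (simp add: scaleC.sum_right scaleC_scaleC)
  have g0: "g 0 = c 0" by (simp add: g_def)
  have g: "summable (\<lambda>k. norm (g k))"
  proof (rule summable_comparison_test')
    show "summable (\<lambda>k. \<Sum>j\<le>k. r ^ j * norm (c (k - j)))"
      using r c by (intro summable_Cauchy_product) (simp_all add: summable_geometric abs_of_nonneg)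
    show "norm (norm (g k)) \<le> (\<Sum>j\<le>k. r ^ j * norm (c (k - j)))" if "k \<ge> 0" for k
      unfolding g_def real_norm_def abs_norm_cancel
      by (rule order_trans[OF norm_sum]) (use r in \<open>simp add: norm_scaleC norm_power q_def\<close>)
  qed
  have geq: "(1 - q * z) *\<^sub>C power_sum g z = power_sum c z" if z: "cmod z \<le> 1" for z
  proof -
    have "(\<lambda>k. z ^ Suc k *\<^sub>C c (Suc k)) sums (power_sum c z - c 0)"
      using power_sum_sums[OF c z] sums_Suc_iff[of "\<lambda>k. z ^ k *\<^sub>C c k" "power_sum c z - c 0"] by simp
    moreover have "(\<lambda>k. (q * z) *\<^sub>C z ^ k *\<^sub>C g k) sums ((q * z) *\<^sub>C power_sum g z)"
      by (rule bounded_linear.sums[OF bounded_linear_scaleC power_sum_sums[OF g z]])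
    ultimately have "(\<lambda>k. z ^ Suc k *\<^sub>C c (Suc k) + (q * z) *\<^sub>C z ^ k *\<^sub>C g k) sums
        (power_sum c z - c 0 + (q * z) *\<^sub>C power_sum g z)"
      by (rule sums_add)
    also have "(\<lambda>k. z ^ Suc k *\<^sub>C c (Suc k) + (q * z) *\<^sub>C z ^ k *\<^sub>C g k)
        = (\<lambda>k. z ^ Suc k *\<^sub>C g (Suc k))"
      by (simp add: g_Suc scaleC_add_right scaleC_scaleC mult_ac)
    finally have "(\<lambda>k. z ^ Suc k *\<^sub>C g (Suc k)) sums
        (power_sum c z - c 0 + (q * z) *\<^sub>C power_sum g z)" .
    moreover have "(\<lambda>k. z ^ Suc k *\<^sub>C g (Suc k)) sums (power_sum g z - c 0)"
      using power_sum_sums[OF g z] sums_Suc_iff[of "\<lambda>k. z ^ k *\<^sub>C g k" "power_sum g z - c 0"] g0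
      by simp
    ultimately have "power_sum c z - c 0 + (q * z) *\<^sub>C power_sum g z = power_sum g z - c 0"
      by (rule sums_unique2)
    then have "power_sum c z + (q * z) *\<^sub>C power_sum g z = power_sum g z"
      by (simp add: algebra_simps)
    then show ?thesis by (simp add: scaleC.diff_left algebra_simps)
  qed
  have s0: "summable (\<lambda>k. norm (q ^ k))" using q by (simp add: norm_power summable_geometric)
  have ps: "power_sum ((^) q) z = 1 / (1 - q * z)" if "cmod z \<le> 1" for z
  proof -
    have "cmod (q * z) < 1"
      using q that by (metis mult_left_le norm_ge_zero norm_mult order_le_less_trans)
    then show ?thesis
      by (simp add: power_sum_def power_mult_distrib[symmetric] suminf_geometric mult.commute)
  qed
  have "bounded_bilinear (\<lambda>z (x::'a). cnj z *\<^sub>C x)"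
    by (rule bounded_bilinear.comp1[OF scaleC.bounded_bilinear_axioms bounded_linear_cnj])
  from has_integral_circle_prod[OF this _ _ s0 g, of s]
  have "((\<lambda>t. cnj (power_sum ((^) q) (cis t)) *\<^sub>C power_sum g (cis t)) has_integral
      (2 * pi) *\<^sub>R power_sum g q) {s..s + 2 * pi}"
    by (simp add: scaleC_scaleC mult.commute power_sum_def q_def)
  from has_integral_linear[OF this bounded_linear_scaleR_right, of "1 - r\<^sup>2"]
  have "((\<lambda>t. (1 - r\<^sup>2) *\<^sub>R cnj (power_sum ((^) q) (cis t)) *\<^sub>C power_sum g (cis t)) has_integral
      (1 - r\<^sup>2) *\<^sub>R (2 * pi) *\<^sub>R power_sum g q) {s..s + 2 * pi}"
    by (simp add: o_def)
  moreover have "(1 - r\<^sup>2) *\<^sub>R cnj (power_sum ((^) q) (cis t)) *\<^sub>C power_sum g (cis t)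
      = poisson_kernel r t *\<^sub>R power_sum c (cis t)" for t
  proof -
    let ?d = "1 - q * cis t"
    have d: "?d \<noteq> 0"
      using poisson_denominator_pos[OF r, of t] by (auto simp: poisson_denominator q_def)
    have "poisson_kernel r t *\<^sub>R power_sum c (cis t)
        = complex_of_real ((1 - r\<^sup>2) / (cmod ?d)\<^sup>2) *\<^sub>C ?d *\<^sub>C power_sum g (cis t)"
      by (simp only: geq norm_cis order_refl scaleC_of_real poisson_kernel_def poisson_denominator
          q_def[symmetric])
    also have "\<dots> = (complex_of_real (1 - r\<^sup>2) * (1 / cnj ?d)) *\<^sub>C power_sum g (cis t)"
    proof -
      have "complex_of_real ((1 - r\<^sup>2) / (cmod ?d)\<^sup>2) * ?d = complex_of_real (1 - r\<^sup>2) * (1 / cnj ?d)"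
        unfolding of_real_divide complex_norm_square using d by (simp add: divide_simps del: complex_cnj_diff)
      then show ?thesis by (simp only: scaleC_scaleC)
    qed
    also have "\<dots> = (1 - r\<^sup>2) *\<^sub>R cnj (power_sum ((^) q) (cis t)) *\<^sub>C power_sum g (cis t)"
      by (simp only: scaleC_scaleC[symmetric] scaleC_of_real ps norm_cis order_refl complex_cnj_divide
          complex_cnj_one)
    finally show ?thesis ..
  qed
  moreover have "(1 - r\<^sup>2) *\<^sub>R (2 * pi) *\<^sub>R power_sum g q = (2 * pi) *\<^sub>R power_sum c q"
  proof -
    have "(1 - r\<^sup>2) *\<^sub>R power_sum g q = (1 - q * q) *\<^sub>C power_sum g q"
      by (simp add: q_def power2_eq_square flip: scaleC_of_real)
    then have "(1 - r\<^sup>2) *\<^sub>R power_sum g q = power_sum c q" using geq[of q] q by simp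
    then show ?thesis by (metis scaleR_left_commute)
  qed
  ultimately show ?thesis by (simp add: q_def)
qed

subsection \<open>Radial limits\<close>

text \<open>Folds Poisson integrals onto \<open>{0..pi}\<close>, where the kernel is
  monotone.\<close>

lemma integral_reflect_halves:
  fixes f :: "real \<Rightarrow> real"
  assumes f: "continuous_on {-a..a} f" and a: "0 \<le> a"
  shows "integral {-a..a} f = integral {0..a} (\<lambda>t. f t + f (- t))"
proof -
  have m: "continuous_on {0..a} (\<lambda>t. f (- t))"
    by (rule continuous_on_compose2[OF f]) (use a in \<open>auto intro!: continuous_intros\<close>)
  have "integral {-a..a} f = integral {-a..0} f + integral {0..a} f"
    using a f by (intro Henstock_Kurzweil_Integration.integral_combine[symmetric]
        integrable_continuous_interval) auto
  also have "integral {-a..0} f = integral {0..a} (\<lambda>t. f (- t))"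
    using Henstock_Kurzweil_Integration.integral_reflect_real[of 0 "-a" f] by simp
  also have "integral {0..a} (\<lambda>t. f (- t)) + integral {0..a} f = integral {0..a} (\<lambda>t. f t + f (- t))"
    using m continuous_on_subset[OF f, of "{0..a}"] a
    by (subst Henstock_Kurzweil_Integration.integral_add)
      (auto intro: integrable_continuous_interval)
  finally show ?thesis .
qed

lemma integral_symmetric_halves:
  fixes g :: "real \<Rightarrow> real"
  assumes g: "continuous_on UNIV g" and "0 \<le> s"
  shows "integral {\<theta> - s..\<theta> + s} g = integral {0..s} (\<lambda>t. g (\<theta> + t) + g (\<theta> - t))"
proof -
  have "integral {\<theta> - s..\<theta> + s} g = integral {-s..s} (\<lambda>t. g (\<theta> + t))"
    using integral_shift_Icc_real[of "-s" s g \<theta>] by (simp add: o_def add.commute)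
  also have "\<dots> = integral {0..s} (\<lambda>t. g (\<theta> + t) + g (\<theta> - t))"
    by (subst integral_reflect_halves[OF _ assms(2)])
      (auto intro!: continuous_on_compose2[OF g] continuous_intros)
  finally show ?thesis .
qed

lemma continuous_on_poisson_kernel:
  assumes "0 \<le> r" "r < 1"
  shows "continuous_on S (poisson_kernel r)"
  unfolding poisson_kernel_def[abs_def]
  using less_imp_neq[OF poisson_denominator_pos[OF assms]] by (intro continuous_intros) auto

lemma poisson_kernel_nonneg:
  assumes "0 \<le> r" "r < 1"
  shows "0 \<le> poisson_kernel r s"
  unfolding poisson_kernel_def
  using less_imp_le[OF poisson_denominator_pos[OF assms]] assms
  by (intro divide_nonneg_nonneg) (simp_all add: power_le_one)

lemma poisson_kernel_minus [simp]: "poisson_kernel r (- s) = poisson_kernel r s"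
  by (simp add: poisson_kernel_def)

lemma poisson_kernel_deriv:
  assumes r: "0 \<le> r" "r < 1" and s: "s \<in> {0..pi}"
  shows "\<exists>p'\<le>0. (poisson_kernel r has_real_derivative p') (at s within S)"
proof (intro exI conjI)
  let ?d = "1 - 2 * r * cos s + r\<^sup>2"
  show "(poisson_kernel r has_real_derivative - ((1 - r\<^sup>2) * (2 * r * sin s)) / (?d * ?d)) (at s within S)"
    unfolding poisson_kernel_def[abs_def]
    using poisson_denominator_pos[OF r, of s]
    by (auto intro!: derivative_eq_intros)
  have "0 \<le> (1 - r\<^sup>2) * (2 * r * sin s)"
    using r s by (intro mult_nonneg_nonneg) (auto simp: power_le_one sin_ge_zero)
  then show "- ((1 - r\<^sup>2) * (2 * r * sin s)) / (?d * ?d) \<le> 0"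
    using poisson_denominator_pos[OF r, of s] by (simp add: divide_nonpos_nonneg)
qed

text \<open>Since the kernel $P$ decreases on $[0,\pi]$, the derivative of
  $P(s)\,(\int_0^s \varphi - M s)$ dominates $P(s)\,(\varphi(s) - M)$.\<close>

lemma integral_poisson_le:
  fixes \<phi> :: "real \<Rightarrow> real"
  assumes r: "0 \<le> r" "r < 1" and \<phi>: "continuous_on {0..pi} \<phi>"
    and avg: "\<And>s. s \<in> {0..pi} \<Longrightarrow> integral {0..s} \<phi> \<le> M * s"
  shows "integral {0..pi} (\<lambda>s. poisson_kernel r s * \<phi> s) \<le> M * integral {0..pi} (poisson_kernel r)"
proof -
  let ?P = "poisson_kernel r"
  let ?D = "\<lambda>s. ?P s * (integral {0..s} \<phi> - M * s)"
  note P = continuous_on_poisson_kernel[OF r]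
  obtain p' where p': "\<And>s. s \<in> {0..pi} \<Longrightarrow> p' s \<le> 0"
    "\<And>s. s \<in> {0..pi} \<Longrightarrow> (?P has_real_derivative p' s) (at s within {0..pi})"
    using poisson_kernel_deriv[OF r, of _ "{0..pi}"] by metis
  let ?D' = "\<lambda>s. p' s * (integral {0..s} \<phi> - M * s) + (\<phi> s - M) * ?P s"
  have 1: "(?D' has_integral ?D pi - ?D 0) {0..pi}"
  proof (rule fundamental_theorem_of_calculus)
    fix s assume s: "s \<in> {0..pi}"
    have "(?D has_real_derivative ?D' s) (at s within {0..pi})"
      by (rule DERIV_mult[OF p'(2)[OF s]])
        (auto intro!: derivative_eq_intros integral_has_real_derivative[OF \<phi> s])
    then show "(?D has_vector_derivative ?D' s) (at s within {0..pi})"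
      by (simp add: has_real_derivative_iff_has_vector_derivative)
  qed simp
  have 2: "((\<lambda>s. ?P s * (\<phi> s - M)) has_integral integral {0..pi} (\<lambda>s. ?P s * (\<phi> s - M))) {0..pi}"
    by (intro integrable_integral integrable_continuous_interval continuous_intros P \<phi>)
  have "?P s * (\<phi> s - M) \<le> ?D' s" if s: "s \<in> {0..pi}" for s
    using mult_nonpos_nonpos[OF p'(1)[OF s], of "integral {0..s} \<phi> - M * s"] avg[OF s]
    by (simp add: mult.commute)
  then have "integral {0..pi} (\<lambda>s. ?P s * (\<phi> s - M)) \<le> ?D pi - ?D 0"
    by (rule has_integral_le[OF 2 1])
  also have "\<dots> \<le> 0"
    using mult_nonneg_nonpos[OF poisson_kernel_nonneg[OF r, of pi], of "integral {0..pi} \<phi> - M * pi"]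
      avg[of pi] by simp
  also have "integral {0..pi} (\<lambda>s. ?P s * (\<phi> s - M))
      = integral {0..pi} (\<lambda>s. ?P s * \<phi> s) - M * integral {0..pi} ?P"
    unfolding right_diff_distrib
    by (subst Henstock_Kurzweil_Integration.integral_diff)
      (auto intro!: integrable_continuous_interval continuous_intros P \<phi> simp: mult.commute)
  finally show ?thesis by simp
qed

text \<open>The Poisson formula for the constant series 1 gives \<open>2 * pi\<close> over a full
  period, and evenness of the kernel halves it.\<close>

lemma integral_poisson_kernel:
  assumes "0 \<le> r" "r < 1"
  shows "integral {0..pi} (poisson_kernel r) = pi"
proof -
  let ?c = "\<lambda>k::nat. if k = 0 then 1 else (0::complex)"
  have "power_sum ?c z = 1" for z
    using sums_unique[OF sums_If_finite_set[of "{0}" "\<lambda>k. z ^ k"]]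
    by (simp add: power_sum_def if_distrib cong: if_cong)
  moreover have "summable (\<lambda>k. norm (?c k))" by (rule summable_finite[of "{0}"]) auto
  ultimately have "((\<lambda>t. complex_of_real (poisson_kernel r t)) has_integral complex_of_real (2 * pi)) {-pi..pi}"
    using has_integral_poisson[OF _ assms, of ?c "- pi"] by (simp add: scaleR_conv_of_real)
  from has_integral_linear[OF this bounded_linear_Re]
  have "integral {-pi..pi} (poisson_kernel r) = 2 * pi"
    by (simp add: o_def integral_unique)
  then show ?thesis
    by (subst (asm) integral_reflect_halves) (auto intro: continuous_on_poisson_kernel[OF assms])
qed

lemma continuous_on_power_sum_circle:
  assumes "summable (\<lambda>k. norm (c k))" "0 \<le> r" "r \<le> 1"
  shows "continuous_on S (\<lambda>t. power_sum c (complex_of_real r * cis t))"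
  by (rule continuous_on_compose2[OF continuous_on_power_sum[OF assms(1)]])
    (use assms(2,3) in \<open>auto intro!: continuous_intros simp: norm_mult\<close>)

lemma norm_power_sum_le_average:
  fixes c :: "nat \<Rightarrow> 'e::{complex_normed_vector, banach}"
  assumes c: "summable (\<lambda>k. norm (c k))" and r: "0 \<le> r" "r < 1"
    and avg: "\<And>s. 0 < s \<Longrightarrow> s \<le> pi \<Longrightarrow> integral {\<theta> - s..\<theta> + s} (\<lambda>t. norm (power_sum c (cis t))) \<le> 2 * s * M"
  shows "norm (power_sum c (complex_of_real r * cis \<theta>)) \<le> M"
proof -
  let ?P = "poisson_kernel r"
  define g where "g = (\<lambda>t. norm (power_sum c (cis t)))"
  have "continuous_on UNIV (\<lambda>t. power_sum c (cis t))"
    using continuous_on_power_sum_circle[OF c, of 1 UNIV] by simp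
  then have g: "continuous_on S (\<lambda>t. g (f t))" if "continuous_on S f" for S and f :: "real \<Rightarrow> real"
    unfolding g_def
    by (intro continuous_on_norm continuous_on_compose2[OF _ that, of UNIV "\<lambda>t. power_sum c (cis t)"]) auto
  note P = continuous_on_poisson_kernel[OF r]
  let ?c = "\<lambda>k. cis \<theta> ^ k *\<^sub>C c k"
  have c': "summable (\<lambda>k. norm (?c k))" using c by (simp add: norm_scaleC norm_power)
  have shift: "power_sum ?c (cis t) = power_sum c (cis (\<theta> + t))" for t
    by (simp add: power_sum_scale cis_mult)
  have I: "((\<lambda>t. ?P t *\<^sub>R power_sum c (cis (\<theta> + t))) has_integral
      (2 * pi) *\<^sub>R power_sum c (complex_of_real r * cis \<theta>)) {-pi..pi}"
    using has_integral_poisson[OF c' r, of "- pi"]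
    by (simp add: shift) (simp add: power_sum_scale mult.commute)
  have "2 * pi * norm (power_sum c (complex_of_real r * cis \<theta>))
      = norm (integral {-pi..pi} (\<lambda>t. ?P t *\<^sub>R power_sum c (cis (\<theta> + t))))"
    by (simp add: integral_unique[OF I])
  also have "\<dots> \<le> integral {-pi..pi} (\<lambda>t. ?P t * g (\<theta> + t))"
    by (intro integral_norm_bound_integral has_integral_integrable[OF I] integrable_continuous_interval
        continuous_intros P g) (simp add: g_def poisson_kernel_nonneg[OF r])
  also have "\<dots> = integral {0..pi} (\<lambda>t. ?P t * (g (\<theta> + t) + g (\<theta> - t)))"
    by (subst integral_reflect_halves) (auto intro!: continuous_intros P g simp: distrib_left)
  also have "\<dots> \<le> 2 * M * integral {0..pi} ?P"
  proof (rule integral_poisson_le[OF r])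
    fix s assume s: "s \<in> {0..pi}"
    have "integral {0..s} (\<lambda>t. g (\<theta> + t) + g (\<theta> - t)) = integral {\<theta> - s..\<theta> + s} g"
      using s g[OF continuous_on_id] by (subst integral_symmetric_halves) auto
    also have "\<dots> \<le> 2 * M * s"
      using avg[of s] s by (cases "s = 0") (auto simp: g_def mult_ac)
    finally show "integral {0..s} (\<lambda>t. g (\<theta> + t) + g (\<theta> - t)) \<le> 2 * M * s" .
  qed (intro continuous_intros g)
  also have "\<dots> = 2 * pi * M" by (simp add: integral_poisson_kernel[OF r])
  finally show ?thesis by simp
qed

text \<open>The covering lemma bounds the set where a Hardy-Littlewood maximal function exceeds a level.\<close>

lemma maximal_weak_type:
  fixes g :: "real \<Rightarrow> real"
  assumes g: "continuous_on UNIV g" "\<And>t. 0 \<le> g t" and v: "0 < v" and S: "S \<subseteq> {a..b}"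
    and avg: "\<And>t. t \<in> S \<Longrightarrow> \<exists>h>0. h \<le> H \<and> 2 * h * v < integral {t - h..t + h} g"
  obtains T where "T \<in> lmeasurable" "S \<subseteq> T"
    "measure lebesgue T \<le> 5 / v * integral {a - H..b + H} g"
proof -
  from avg have "\<forall>t\<in>S. \<exists>h. 0 < h \<and> h \<le> H \<and> 2 * h * v < integral {t - h..t + h} g" by blast
  then obtain h where h: "\<And>t. t \<in> S \<Longrightarrow> 0 < h t \<and> h t \<le> H \<and> 2 * h t * v < integral {t - h t..t + h t} g"
    by (auto dest!: bchoice)
  have int: "g integrable_on {c..d}" for c d
    by (intro integrable_continuous_interval continuous_on_subset[OF g(1)]) simp
  have "S \<subseteq> (\<Union>t\<in>S. cball t (h t))"
  proof
    fix t assume "t \<in> S"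
    moreover from h[OF this] have "t \<in> cball t (h t)" by simp
    ultimately show "t \<in> (\<Union>t\<in>S. cball t (h t))" by blast
  qed
  moreover have "\<And>t. t \<in> S \<Longrightarrow> 0 < h t \<and> h t \<le> H" using h by blast
  ultimately obtain C where C: "countable C" "C \<subseteq> S"
      "pairwise (\<lambda>i j. disjnt (cball i (h i)) (cball j (h j))) C"
      "S \<subseteq> (\<Union>t\<in>C. cball t (5 * h t))"
    by (rule Vitali_covering_lemma_cballs)
  \<comment> \<open>The 5 is the enlargement factor of the Vitali covering: an enlarged interval has
    five times the length \<open>2 * h t\<close>, which is less than its integral of
    \<open>g\<close> divided by \<open>v\<close>. The selected intervals are disjoint and stay
    within \<open>H\<close> of \<open>{a..b}\<close>.\<close>
  let ?B = "5 / v * integral {a - H..b + H} g"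
  have bound: "measure lebesgue (\<Union>t\<in>F. cball t (5 * h t)) \<le> ?B" if F: "F \<subseteq> C" "finite F" for F
  proof -
    have FS: "t \<in> S" if "t \<in> F" for t using that F C by blast
    have "measure lebesgue (\<Union>t\<in>F. cball t (5 * h t)) \<le> (\<Sum>t\<in>F. measure lebesgue (cball t (5 * h t)))"
      by (rule measure_UNION_le[OF F(2)]) simp
    also have "\<dots> = (\<Sum>t\<in>F. 5 / v * (2 * h t * v))"
    proof (rule sum.cong[OF refl])
      fix t assume "t \<in> F"
      then have "0 < h t" using FS h by blast
      then show "measure lebesgue (cball t (5 * h t)) = 5 / v * (2 * h t * v)"
        using v by (simp add: cball_eq_atLeastAtMost)
    qed
    also have "\<dots> \<le> (\<Sum>t\<in>F. 5 / v * integral {t - h t..t + h t} g)"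
    proof (intro sum_mono mult_left_mono)
      fix t assume "t \<in> F"
      from h[OF FS[OF this]] show "2 * h t * v \<le> integral {t - h t..t + h t} g" by simp
    qed (use v in simp)
    also have "\<dots> = 5 / v * (\<Sum>t\<in>F. integral {t - h t..t + h t} g)"
      by (simp add: sum_distrib_left)
    also have "\<dots> \<le> ?B"
    proof (rule mult_left_mono)
      have U: "(g has_integral (\<Sum>t\<in>F. integral {t - h t..t + h t} g)) (\<Union>t\<in>F. {t - h t..t + h t})"
      proof (rule has_integral_UN[OF F(2)])
        show "pairwise (\<lambda>i j. negligible ({i - h i..i + h i} \<inter> {j - h j..j + h j})) F"
        proof (rule pairwiseI)
          fix i j assume "i \<in> F" "j \<in> F" "i \<noteq> j"
          then have "disjnt (cball i (h i)) (cball j (h j))"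
            using C(3) F(1) by (auto simp: pairwise_def)
          then show "negligible ({i - h i..i + h i} \<inter> {j - h j..j + h j})"
            by (simp only: disjnt_def cball_eq_atLeastAtMost negligible_empty)
        qed
      qed (rule integrable_integral[OF int])
      have "{t - h t..t + h t} \<subseteq> {a - H..b + H}" if "t \<in> F" for t
      proof -
        have "a \<le> t" "t \<le> b" "h t \<le> H" using FS[OF that] S h[OF FS[OF that]] by auto
        then show ?thesis by auto
      qed
      then have "(\<Union>t\<in>F. {t - h t..t + h t}) \<subseteq> {a - H..b + H}" by (rule UN_least)
      from has_integral_subset_le[OF this U integrable_integral[OF int]]
      show "(\<Sum>t\<in>F. integral {t - h t..t + h t} g) \<le> integral {a - H..b + H} g" using g(2) by simp
    qed (use v in simp)
    finally show ?thesis .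
  qed
  show ?thesis
  proof
    show "(\<Union>t\<in>C. cball t (5 * h t)) \<in> lmeasurable"
      by (rule fmeasurable_UN_bound[OF C(1) _ bound]) auto
    show "measure lebesgue (\<Union>t\<in>C. cball t (5 * h t)) \<le> ?B"
      by (rule measure_UN_bound[OF C(1) _ bound]) auto
  qed (rule C(4))
qed

lemma average_square:
  fixes g :: "real \<Rightarrow> real"
  assumes g: "continuous_on UNIV g" and v: "0 < v" "0 \<le> h"
    and avg: "2 * h * v < integral {t - h..t + h} g"
  shows "2 * h * v\<^sup>2 < integral {t - h..t + h} (\<lambda>s. (g s)\<^sup>2)"
proof -
  have int: "f integrable_on {t - h..t + h}" if "continuous_on UNIV f" for f :: "real \<Rightarrow> real"
    by (intro integrable_continuous_interval continuous_on_subset[OF that]) simp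
  have "2 * v * g s \<le> v\<^sup>2 + (g s)\<^sup>2" for s
    using zero_le_power2[of "v - g s"] by (simp add: power2_diff)
  then have "integral {t - h..t + h} (\<lambda>s. 2 * v * g s) \<le> integral {t - h..t + h} (\<lambda>s. v\<^sup>2 + (g s)\<^sup>2)"
    by (intro integral_le int continuous_intros g)
  also have "\<dots> = 2 * h * v\<^sup>2 + integral {t - h..t + h} (\<lambda>s. (g s)\<^sup>2)"
    using v by (subst Henstock_Kurzweil_Integration.integral_add)
      (auto intro!: int continuous_intros g)
  finally have "2 * v * integral {t - h..t + h} g \<le> 2 * h * v\<^sup>2 + integral {t - h..t + h} (\<lambda>s. (g s)\<^sup>2)"
    by simp
  moreover have "2 * v * (2 * h * v) < 2 * v * integral {t - h..t + h} g"
    using avg v by (intro mult_strict_left_mono) auto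
  ultimately show ?thesis by (simp add: power2_eq_square algebra_simps)
qed

text \<open>Half-widths up to \<open>pi\<close> around points of \<open>{0..2 * pi}\<close> stay in
  \<open>{-pi..3 * pi}\<close>. These are two periods, contributing \<open>4 * pi\<close> times the
  coefficient sum; the covering factor 5 makes the constant \<open>20 * pi\<close>.\<close>

lemma radial_weak_type_summable:
  fixes c :: "nat \<Rightarrow> 'e::chilbert_space"
  assumes c: "summable (\<lambda>k. norm (c k))" and v: "0 < v"
    and E: "E = {t \<in> {0<..<2 * pi}. \<exists>r\<in>{0..<1}. v < norm (power_sum c (complex_of_real r * cis t))}"
  shows "E \<in> lmeasurable" "measure lebesgue E \<le> 20 * pi / v\<^sup>2 * (\<Sum>k. (norm (c k))\<^sup>2)"
proof -
  note cont = continuous_on_power_sum_circle[OF c]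
  define g where "g = (\<lambda>t. norm (power_sum c (cis t)))"
  have g: "continuous_on S g" for S
    unfolding g_def using cont[of 1 S] by (intro continuous_on_norm) auto
  \<comment> \<open>For each fixed radius the condition is open in \<open>t\<close>, so
    \<open>E\<close> is a union of open sets and hence measurable.\<close>
  have "open {t \<in> {0<..<2 * pi}. v < norm (power_sum c (complex_of_real r * cis t))}" if "r \<in> {0..<1}" for r
  proof -
    have "open ({0<..<2 * pi} \<inter> {t. v < norm (power_sum c (complex_of_real r * cis t))})"
      using that by (intro open_Int open_Collect_less continuous_intros cont open_greaterThanLessThan) auto
    then show ?thesis by (simp only: Int_def mem_Collect_eq)
  qed
  moreover have "E = (\<Union>r\<in>{0..<1}. {t \<in> {0<..<2 * pi}. v < norm (power_sum c (complex_of_real r * cis t))})"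
    unfolding E by blast
  ultimately have "open E" by (simp only:) (rule open_UN, blast)
  moreover have E': "E \<subseteq> {0..2 * pi}" unfolding E by auto
  then have "bounded E" by (rule bounded_subset[OF bounded_closed_interval])
  ultimately show Em: "E \<in> lmeasurable" by (intro lmeasurable_open)
  have avg: "\<exists>h>0. h \<le> pi \<and> 2 * h * v\<^sup>2 < integral {t - h..t + h} (\<lambda>s. (g s)\<^sup>2)" if "t \<in> E" for t
  proof -
    have "\<exists>r\<in>{0..<1}. v < norm (power_sum c (complex_of_real r * cis t))"
      using that unfolding E by simp
    then obtain r where r: "0 \<le> r" "r < 1" "v < norm (power_sum c (complex_of_real r * cis t))"
      by (meson atLeastLessThan_iff)
    have "\<exists>h>0. h \<le> pi \<and> 2 * h * v < integral {t - h..t + h} g"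
    proof (rule ccontr)
      assume "\<not> ?thesis"
      then have "norm (power_sum c (complex_of_real r * cis t)) \<le> v"
        unfolding g_def by (intro norm_power_sum_le_average[OF c r(1,2)]) force
      with r(3) show False by simp
    qed
    then show ?thesis using average_square[OF g v] by (meson less_imp_le)
  qed
  obtain T where T: "T \<in> lmeasurable" "E \<subseteq> T"
    "measure lebesgue T \<le> 5 / v\<^sup>2 * integral {0 - pi..2 * pi + pi} (\<lambda>s. (g s)\<^sup>2)"
    by (rule maximal_weak_type[OF _ _ _ E' avg]) (use v in \<open>auto intro!: continuous_intros g\<close>)
  have "measure lebesgue E \<le> measure lebesgue T"
    by (rule measure_mono_fmeasurable) (use T Em in auto)
  moreover have "integral {- pi..3 * pi} (\<lambda>s. (g s)\<^sup>2) = 4 * pi * (\<Sum>k. (norm (c k))\<^sup>2)"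
  proof -
    have "integral {- pi..3 * pi} (\<lambda>s. (g s)\<^sup>2)
        = integral {- pi..pi} (\<lambda>s. (g s)\<^sup>2) + integral {pi..3 * pi} (\<lambda>s. (g s)\<^sup>2)"
      by (intro Henstock_Kurzweil_Integration.integral_combine[symmetric]
          integrable_continuous_interval continuous_intros g) auto
    then show ?thesis
      using integral_unique[OF parseval[OF c, of "- pi"]] integral_unique[OF parseval[OF c, of pi]]
      by (simp add: g_def algebra_simps)
  qed
  ultimately show "measure lebesgue E \<le> 20 * pi / v\<^sup>2 * (\<Sum>k. (norm (c k))\<^sup>2)"
    using T(3) by (simp add: algebra_simps)
qed

text \<open>Square-summable coefficients become absolutely summable after dilation by
  \<open>R n < 1\<close>. The exceptional sets of the dilates increase to \<open>E\<close>, and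
  their bounds are uniform because dilation shrinks coefficients.\<close>

lemma radial_weak_type:
  fixes c :: "nat \<Rightarrow> 'e::chilbert_space"
  assumes c: "summable (\<lambda>k. (norm (c k))\<^sup>2)" and v: "0 < v"
    and E: "E = {t \<in> {0<..<2 * pi}. \<exists>r\<in>{0..<1}. v < norm (power_sum c (complex_of_real r * cis t))}"
  shows "E \<in> lmeasurable" "measure lebesgue E \<le> 20 * pi / v\<^sup>2 * (\<Sum>k. (norm (c k))\<^sup>2)"
proof -
  let ?B = "20 * pi / v\<^sup>2 * (\<Sum>k. (norm (c k))\<^sup>2)"
  have "Bseq (\<lambda>k. (norm (c k))\<^sup>2)"
    using summable_LIMSEQ_zero[OF c] by (intro convergent_imp_Bseq convergentI)
  then obtain K where K: "\<And>k. (norm (c k))\<^sup>2 \<le> K" by (auto simp: Bseq_def)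
  have C: "norm (c k) \<le> sqrt K" for k using K[of k] by (intro real_le_rsqrt)
  define R where "R n = 1 - inverse (real (Suc n))" for n
  have R: "0 \<le> R n" "R n < 1" for n by (auto simp: R_def field_simps)
  have R_mono: "R m \<le> R n" if "m \<le> n" for m n
    unfolding R_def using that by (intro diff_left_mono le_imp_inverse_le) auto
  define d where "d n = (\<lambda>k. complex_of_real (R n) ^ k *\<^sub>C c k)" for n
  define D where "D n = {t \<in> {0<..<2 * pi}. \<exists>r\<in>{0..<1}. v < norm (power_sum (d n) (complex_of_real r * cis t))}" for n
  have d: "summable (\<lambda>k. norm (d n k))" for n
    unfolding d_def by (rule summable_norm_geometric[OF C]) (use R in simp)
  have ps: "power_sum (d n) (complex_of_real r * cis t) = power_sum c (complex_of_real (R n * r) * cis t)" for n r t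
    by (simp add: d_def power_sum_scale mult.assoc)
  have D_mono: "D m \<subseteq> D n" if mn: "m \<le> n" for m n
  proof
    fix t assume t: "t \<in> D m"
    then obtain r where r: "r \<in> {0..<1}" "v < norm (power_sum c (complex_of_real (R m * r) * cis t))"
      unfolding D_def ps by blast
    show "t \<in> D n"
    \<comment> \<open>The first radius \<open>R 0\<close> is 0, so the rescaled radius
      \<open>R m * r / R n\<close> has to be avoided there; in that case the two dilations
      coincide.\<close>
    proof (cases "R n = 0")
      case True
      then have "R m = R n" using R_mono[OF mn] R(1)[of m] by simp
      then show ?thesis using t unfolding D_def ps by simp
    next
      case False
      then have pos: "0 < R n" using R(1)[of n] by simp
      let ?r = "R m * r / R n"
      have "?r \<le> r" using R_mono[OF mn] r pos R(1)[of m] by (simp add: divide_le_eq mult.commute mult_left_mono)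
      moreover have "0 \<le> ?r" using r R pos by simp
      moreover have "R n * ?r = R m * r" using pos by simp
      ultimately have "?r \<in> {0..<1}" "v < norm (power_sum c (complex_of_real (R n * ?r) * cis t))"
        using r by auto
      then show ?thesis using t unfolding D_def ps by blast
    qed
  qed
  have Dm: "D n \<in> lmeasurable" for n by (rule radial_weak_type_summable(1)[OF d v D_def])
  have "measure lebesgue (\<Union>i\<le>n. D i) \<le> ?B" for n
  proof -
    have "(\<Union>i\<le>n. D i) = D n" using D_mono by blast
    then have "measure lebesgue (\<Union>i\<le>n. D i) \<le> 20 * pi / v\<^sup>2 * (\<Sum>k. (norm (d n k))\<^sup>2)"
      using radial_weak_type_summable(2)[OF d v D_def] by simp
    also have "\<dots> \<le> ?B"
    proof (rule mult_left_mono)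
      have le: "(norm (d n k))\<^sup>2 \<le> (norm (c k))\<^sup>2" for k
        using R[of n]
        by (simp add: d_def norm_scaleC norm_power power_mult_distrib mult_left_le_one_le power_le_one)
      show "(\<Sum>k. (norm (d n k))\<^sup>2) \<le> (\<Sum>k. (norm (c k))\<^sup>2)"
        by (rule suminf_le[OF le _ c], rule summable_comparison_test'[OF c, of 0]) (use le in simp)
    qed simp
    finally show ?thesis .
  qed
  note U = fmeasurable_countable_Union[OF Dm this] measure_countable_Union_le[OF Dm this]
  have "E = (\<Union>n. D n)"
  proof (intro equalityI subsetI)
    fix t assume "t \<in> E"
    then obtain r where r: "r \<in> {0..<1}" "t \<in> {0<..<2 * pi}" "v < norm (power_sum c (complex_of_real r * cis t))"
      unfolding E by blast
    obtain n where n: "inverse (real (Suc n)) < 1 - r"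
      using reals_Archimedean[of "1 - r"] r by auto
    then have rR: "r < R n" by (simp add: R_def)
    with r have "r / R n \<in> {0..<1}" "R n * (r / R n) = r" by (auto simp: divide_simps)
    then have "t \<in> D n" unfolding D_def ps using r by force
    then show "t \<in> (\<Union>n. D n)" by blast
  next
    fix t assume "t \<in> (\<Union>n. D n)"
    then obtain n r where r: "r \<in> {0..<1}" "t \<in> {0<..<2 * pi}"
        "v < norm (power_sum c (complex_of_real (R n * r) * cis t))"
      unfolding D_def ps by blast
    have "R n * r \<in> {0..<1}"
      using R[of n] r mult_strict_mono'[of "R n" 1 r 1] by auto
    then show "t \<in> E" unfolding E using r by blast
  qed
  with U show "E \<in> lmeasurable" "measure lebesgue E \<le> ?B" by simp_all
qed

section \<open>Fatou's theorem on radial limits\<close>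

lemma at_left_limit_exists:
  fixes f :: "real \<Rightarrow> 'a::banach"
  assumes "\<And>e. 0 < e \<Longrightarrow> \<exists>\<delta><1. \<forall>r s. \<delta> < r \<and> r < 1 \<and> \<delta> < s \<and> s < 1 \<longrightarrow> norm (f r - f s) < e"
  shows "\<exists>l. (f \<longlongrightarrow> l) (at_left 1)"
proof -
  have "cauchy_filter (filtermap f (at_left 1))"
    unfolding cauchy_filter_metric_filtermap
  proof (intro allI impI)
    fix e :: real assume "0 < e"
    from assms[OF this] obtain \<delta> where "\<delta> < 1"
      "\<And>r s. \<delta> < r \<Longrightarrow> r < 1 \<Longrightarrow> \<delta> < s \<Longrightarrow> s < 1 \<Longrightarrow> norm (f r - f s) < e"
      by blast
    then show "\<exists>P. eventually P (at_left 1) \<and> (\<forall>x y. P x \<and> P y \<longrightarrow> dist (f x) (f y) < e)"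
      by (intro exI[of _ "\<lambda>r. \<delta> < r \<and> r < 1"])
        (auto simp: dist_norm eventually_at_left_field)
  qed
  moreover have "complete (UNIV::'a set)"
    by (meson Cauchy_convergent UNIV_I complete_def convergent_def)
  ultimately show ?thesis
    using complete_uniform[where S="UNIV :: 'a set"] by (force simp add: filterlim_def)
qed

text \<open>Fatou's theorem: up to a polynomial, which is continuous, the radial oscillation is controlled
  by the radial maximal function of a tail of small norm.\<close>

lemma radial_limit_exists:
  fixes c :: "nat \<Rightarrow> 'e::chilbert_space"
  assumes c: "summable (\<lambda>k. (norm (c k))\<^sup>2)"
  shows "negligible {t \<in> {0..2 * pi}. \<not> (\<exists>l. ((\<lambda>r. power_sum c (complex_of_real r * cis t)) \<longlongrightarrow> l) (at_left 1))}"
proof -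
  let ?f = "\<lambda>t r. power_sum c (complex_of_real r * cis t)"
  define B where "B m = {t \<in> {0<..<2 * pi}. \<forall>\<delta><1. \<exists>r s. \<delta> < r \<and> r < 1 \<and> \<delta> < s \<and> s < 1 \<and>
    inverse (real (Suc m)) \<le> norm (?f t r - ?f t s)}" for m
  have "Bseq (\<lambda>k. (norm (c k))\<^sup>2)"
    using summable_LIMSEQ_zero[OF c] by (intro convergent_imp_Bseq convergentI)
  then obtain M where M: "\<And>k. (norm (c k))\<^sup>2 \<le> M" by (auto simp: Bseq_def)
  have C: "norm (c k) \<le> sqrt M" for k using M[of k] by (intro real_le_rsqrt)
  have C0: "0 \<le> sqrt M" using C[of 0] norm_ge_zero order_trans by blast
  have "negligible (B m)" for m
    unfolding negligible_outer_le
  proof (intro allI impI)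
    fix e :: real assume e: "0 < e"
    let ?\<epsilon> = "inverse (real (Suc m))"
    \<comment> \<open>The polynomial part oscillates by less than \<open>2 * v\<close>. If both tail
      values were at most \<open>v\<close>, the total would stay below \<open>4 * v\<close>,
      contradicting an oscillation of at least \<open>5 * v\<close>.\<close>
    define v where "v = ?\<epsilon> / 5"
    have v: "0 < v" by (simp add: v_def)
    \<comment> \<open>The tail is chosen so small that the weak-type factor
      \<open>20 * pi / v^2\<close> times its squared norm is at most \<open>e\<close>.\<close>
    have "0 < e * v\<^sup>2 / (20 * pi)" using e v by simp
    from suminf_exist_split[OF this c] obtain N
      where N: "norm (\<Sum>k. (norm (c (k + N)))\<^sup>2) < e * v\<^sup>2 / (20 * pi)" by blast
    define a where "a k = (if k < N then 0 else c k)" for k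
    define p where "p k = (if k < N then c k else 0)" for k
    have a2: "summable (\<lambda>k. (norm (a k))\<^sup>2)"
      by (rule summable_comparison_test'[OF c, of 0]) (simp add: a_def)
    have "(\<Sum>k. (norm (a k))\<^sup>2) = (\<Sum>k. (norm (a (k + N)))\<^sup>2) + (\<Sum>k<N. (norm (a k))\<^sup>2)"
      by (rule suminf_split_initial_segment[OF a2])
    then have "(\<Sum>k. (norm (a k))\<^sup>2) = (\<Sum>k. (norm (c (k + N)))\<^sup>2)"
      by (simp add: a_def)
    with N have aN: "(\<Sum>k. (norm (a k))\<^sup>2) \<le> e * v\<^sup>2 / (20 * pi)" by simp
    have p: "summable (\<lambda>k. norm (p k))"
      by (rule summable_finite[of "{..<N}"]) (auto simp: p_def)
    have Ca: "norm (a k) \<le> sqrt M" and Cp: "norm (p k) \<le> sqrt M" for k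
      using C[of k] C0 by (simp_all add: a_def p_def)
    have split: "power_sum c z = power_sum p z + power_sum a z" if "cmod z < 1" for z
    proof -
      have "(\<lambda>k. z ^ k *\<^sub>C p k + z ^ k *\<^sub>C a k) sums (power_sum p z + power_sum a z)"
        by (intro sums_add power_sum_sums_disc[OF Ca that] power_sum_sums_disc[OF Cp that])
      moreover have "z ^ k *\<^sub>C p k + z ^ k *\<^sub>C a k = z ^ k *\<^sub>C c k" for k
        by (simp add: p_def a_def scaleC.zero_right)
      ultimately show ?thesis by (simp add: power_sum_def sums_iff)
    qed
    define E where "E = {t \<in> {0<..<2 * pi}. \<exists>r\<in>{0..<1}. v < norm (power_sum a (complex_of_real r * cis t))}"
    note E = radial_weak_type[OF a2 v E_def]
    have "measure lebesgue E \<le> 20 * pi / v\<^sup>2 * (e * v\<^sup>2 / (20 * pi))"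
      by (rule order_trans[OF E(2) mult_left_mono[OF aN]]) simp
    also have "\<dots> = e" using v by simp
    finally have "measure lebesgue E \<le> e" .
    moreover have "B m \<subseteq> E"
    proof
      fix t assume t: "t \<in> B m"
      have "continuous_on {0..1} (\<lambda>r. power_sum p (complex_of_real r * cis t))"
        by (rule continuous_on_compose2[OF continuous_on_power_sum[OF p]])
          (auto intro!: continuous_intros simp: norm_mult)
      then have "\<exists>d>0. \<forall>r\<in>{0..1}. dist r 1 < d \<longrightarrow>
          dist (power_sum p (complex_of_real r * cis t)) (power_sum p (complex_of_real 1 * cis t)) < v"
        unfolding continuous_on_iff using v by fastforce
      then obtain d where d: "0 < d" "\<And>r. r \<in> {0..1} \<Longrightarrow> dist r 1 < d \<Longrightarrow>
          dist (power_sum p (complex_of_real r * cis t)) (power_sum p (complex_of_real 1 * cis t)) < v"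
        by blast
      \<comment> \<open>The maximum with 0 keeps the radii nonnegative, as the definition of
        \<open>E\<close> requires.\<close>
      define \<delta> where "\<delta> = max 0 (1 - d)"
      have "\<delta> < 1" using d by (simp add: \<delta>_def)
      moreover from t have "\<forall>\<delta><1. \<exists>r s. \<delta> < r \<and> r < 1 \<and> \<delta> < s \<and> s < 1 \<and> ?\<epsilon> \<le> norm (?f t r - ?f t s)"
        unfolding B_def mem_Collect_eq by (rule conjunct2)
      ultimately obtain r s where rs: "\<delta> < r" "r < 1" "\<delta> < s" "s < 1" "?\<epsilon> \<le> norm (?f t r - ?f t s)"
        by blast
      have rs': "0 \<le> r" "0 \<le> s" using rs(1,3) by (simp_all add: \<delta>_def)
      have "r \<in> {0..1}" "s \<in> {0..1}" "dist r 1 < d" "dist s 1 < d"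
        using rs(1-4) rs' by (auto simp: \<delta>_def dist_real_def)
      then have "dist (power_sum p (complex_of_real r * cis t)) (power_sum p (complex_of_real 1 * cis t)) < v"
          "dist (power_sum p (complex_of_real s * cis t)) (power_sum p (complex_of_real 1 * cis t)) < v"
        by (simp_all only: d(2))
      then have "dist (power_sum p (complex_of_real r * cis t)) (power_sum p (complex_of_real s * cis t)) < v + v"
        by (rule dist_triangle_less_add)
      moreover have "?f t r - ?f t s
          = (power_sum p (complex_of_real r * cis t) - power_sum p (complex_of_real s * cis t))
          + power_sum a (complex_of_real r * cis t) - power_sum a (complex_of_real s * cis t)"
        using rs(2,4) rs' by (simp add: split norm_mult)
      then have "norm (?f t r - ?f t s)
          \<le> norm (power_sum p (complex_of_real r * cis t) - power_sum p (complex_of_real s * cis t))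
          + norm (power_sum a (complex_of_real r * cis t)) + norm (power_sum a (complex_of_real s * cis t))"
        by (simp only:) (intro order_trans[OF norm_triangle_ineq4] add_right_mono norm_triangle_ineq)
      ultimately have "v < norm (power_sum a (complex_of_real r * cis t)) \<or>
          v < norm (power_sum a (complex_of_real s * cis t))"
        using rs(5) v unfolding dist_norm v_def by (intro disjCI) linarith
      then show "t \<in> E" using t rs rs' unfolding E_def B_def by auto
    qed
    ultimately show "\<exists>T. B m \<subseteq> T \<and> T \<in> lmeasurable \<and> measure lebesgue T \<le> e" using E(1) by blast
  qed
  then have "negligible (\<Union>(range B))"
    by (intro negligible_countable_Union) auto
  \<comment> \<open>The sets \<open>B m\<close> live in the open interval, so the two endpoints are
    added by hand.\<close>
  then have "negligible ({0, 2 * pi} \<union> \<Union>(range B))" by (intro negligible_Un) simp_all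
  then show ?thesis
  proof (rule negligible_subset, intro subsetI)
    fix t assume t: "t \<in> {t \<in> {0..2 * pi}. \<not> (\<exists>l. (?f t \<longlongrightarrow> l) (at_left 1))}"
    show "t \<in> {0, 2 * pi} \<union> \<Union>(range B)"
    proof (rule ccontr)
      assume not: "t \<notin> {0, 2 * pi} \<union> \<Union>(range B)"
      with t have ti: "t \<in> {0<..<2 * pi}" by auto
      have "\<exists>l. (?f t \<longlongrightarrow> l) (at_left 1)"
      proof (rule at_left_limit_exists)
        fix e :: real assume "0 < e"
        then obtain m where m: "inverse (real (Suc m)) < e" using reals_Archimedean by blast
        have "t \<notin> B m" using not by blast
        then obtain \<delta> where \<delta>: "\<delta> < 1" "\<And>r s. \<delta> < r \<Longrightarrow> r < 1 \<Longrightarrow> \<delta> < s \<Longrightarrow> s < 1 \<Longrightarrow>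
            norm (?f t r - ?f t s) < inverse (real (Suc m))"
          using ti unfolding B_def by (auto simp: not_le)
        then show "\<exists>\<delta><1. \<forall>r s. \<delta> < r \<and> r < 1 \<and> \<delta> < s \<and> s < 1 \<longrightarrow> norm (?f t r - ?f t s) < e"
          using m by (intro exI[of _ \<delta>]) (auto intro: less_trans)
      qed
      with t show False by blast
    qed
  qed
qed

subsection \<open>Multipliers of the vector-valued Hardy space\<close>

text \<open>A square-summable sequence of vectors stands for the power series with these coefficients,
  so that \<^term>\<open>ell2_push Suc\<close> is multiplication by the variable.\<close>

lemma ell2_norm_sums: "(\<lambda>k. (norm (ell2_nth f k))\<^sup>2) sums (norm f)\<^sup>2"
  for f :: "(nat, 'e::real_inner) ell2"
  using has_sum_imp_sums[OF has_sum_infsum[OF ell2_summable[of f]]] by (simp add: power2_norm_ell2)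

lemmas ell2_norm_summable = sums_summable[OF ell2_norm_sums]

lemma power_sum_ell2_sums:
  fixes f :: "(nat, 'e::chilbert_space) ell2"
  assumes "cmod z < 1"
  shows "(\<lambda>k. z ^ k *\<^sub>C ell2_nth f k) sums power_sum (ell2_nth f) z"
  by (rule power_sum_sums_disc[OF norm_ell2_nth_le assms])

text \<open>Cauchy-Schwarz against the geometric sequence. It makes evaluation at a point of the
  disc a bounded operator on the Hardy space.\<close>

lemma norm_power_sum_ell2_le:
  fixes f :: "(nat, 'e::chilbert_space) ell2"
  assumes z: "cmod z < 1"
  shows "(norm (power_sum (ell2_nth f) z))\<^sup>2 \<le> (norm f)\<^sup>2 / (1 - (cmod z)\<^sup>2)"
proof (rule LIMSEQ_le_const2)
  have z2: "(cmod z)\<^sup>2 < 1" using z by (simp add: abs_square_less_1)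
  show "(\<lambda>n. (norm (\<Sum>k<n. z ^ k *\<^sub>C ell2_nth f k))\<^sup>2) \<longlonglongrightarrow> (norm (power_sum (ell2_nth f) z))\<^sup>2"
    using power_sum_ell2_sums[OF z, of f] unfolding sums_def by (intro tendsto_intros)
  have "(norm (\<Sum>k<n. z ^ k *\<^sub>C ell2_nth f k))\<^sup>2 \<le> (norm f)\<^sup>2 / (1 - (cmod z)\<^sup>2)" for n
  proof -
    have "(norm (\<Sum>k<n. z ^ k *\<^sub>C ell2_nth f k))\<^sup>2 \<le> (\<Sum>k<n. cmod z ^ k * norm (ell2_nth f k))\<^sup>2"
      by (intro power_mono norm_sum[THEN order_trans] sum_mono) (simp_all add: norm_scaleC norm_power)
    also have "\<dots> \<le> (\<Sum>k<n. (cmod z ^ k)\<^sup>2) * (\<Sum>k<n. (norm (ell2_nth f k))\<^sup>2)"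
      by (rule Cauchy_Schwarz_ineq_sum)
    also have "\<dots> \<le> (1 / (1 - (cmod z)\<^sup>2)) * (norm f)\<^sup>2"
    proof (intro mult_mono sum_nonneg)
      have "(cmod z ^ k)\<^sup>2 = ((cmod z)\<^sup>2) ^ k" for k
        by (simp add: power_mult[symmetric] mult.commute)
      moreover have "(\<Sum>k<n. ((cmod z)\<^sup>2) ^ k) \<le> (\<Sum>k. ((cmod z)\<^sup>2) ^ k)"
        using z2 by (intro sum_le_suminf summable_geometric) auto
      ultimately show "(\<Sum>k<n. (cmod z ^ k)\<^sup>2) \<le> 1 / (1 - (cmod z)\<^sup>2)"
        using z2 by (simp add: suminf_geometric)
    qed (use z2 sum_le_power2_norm_ell2[of "{..<n}" f] in auto)
    finally show ?thesis by simp
  qed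
  then show "\<exists>N. \<forall>n\<ge>N. (norm (\<Sum>k<n. z ^ k *\<^sub>C ell2_nth f k))\<^sup>2 \<le> (norm f)\<^sup>2 / (1 - (cmod z)\<^sup>2)"
    by blast
qed

lemma bounded_linear_power_sum_ell2:
  assumes z: "cmod z < 1"
  shows "bounded_linear (\<lambda>f. power_sum (ell2_nth (f :: (nat, 'e::chilbert_space) ell2)) z)"
proof (rule bounded_linear_intro[where K="1 / sqrt (1 - (cmod z)\<^sup>2)"])
  fix f g :: "(nat, 'e) ell2" and r :: real
  have "(\<lambda>k. z ^ k *\<^sub>C ell2_nth f k + z ^ k *\<^sub>C ell2_nth g k) sums
      (power_sum (ell2_nth f) z + power_sum (ell2_nth g) z)"
    by (intro sums_add power_sum_ell2_sums z)
  then show "power_sum (ell2_nth (f + g)) z = power_sum (ell2_nth f) z + power_sum (ell2_nth g) z"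
    by (simp add: power_sum_def scaleC_add_right sums_iff)
  have "(\<lambda>k. r *\<^sub>R z ^ k *\<^sub>C ell2_nth f k) sums (r *\<^sub>R power_sum (ell2_nth f) z)"
    by (intro sums_scaleR_right power_sum_ell2_sums z)
  then show "power_sum (ell2_nth (r *\<^sub>R f)) z = r *\<^sub>R power_sum (ell2_nth f) z"
    by (simp add: power_sum_def scaleC.scaleR_right sums_iff)
  have "norm (power_sum (ell2_nth f) z) \<le> sqrt ((norm f)\<^sup>2 / (1 - (cmod z)\<^sup>2))"
    by (rule real_le_rsqrt[OF norm_power_sum_ell2_le[OF z]])
  then show "norm (power_sum (ell2_nth f) z) \<le> norm f * (1 / sqrt (1 - (cmod z)\<^sup>2))"
    by (simp add: real_sqrt_divide)
qed

lemma power_sum_ell2_single: "power_sum (ell2_nth (ell2_single m x)) z = z ^ m *\<^sub>C (x::'e::chilbert_space)"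
  using sums_unique[OF sums_If_finite_set[of "{m}" "\<lambda>k. z ^ k *\<^sub>C x"]]
  by (simp add: power_sum_def ell2_nth_single if_distrib scaleC.zero_right cong: if_cong)

lemma parseval_ell2:
  fixes f :: "(nat, 'e::chilbert_space) ell2"
  assumes "0 \<le> r" "r < 1"
  shows "((\<lambda>t. (norm (power_sum (ell2_nth f) (complex_of_real r * cis t)))\<^sup>2) has_integral
    2 * pi * (\<Sum>k. r ^ (2 * k) * (norm (ell2_nth f k))\<^sup>2)) {0..2 * pi}"
  using parseval_radius[where c="ell2_nth f" and s=0, OF norm_ell2_nth_le assms] by simp

text \<open>Parseval on the single circle of radius 1/2 already annihilates every coefficient of the
  difference.\<close>

lemma power_sum_ell2_unique:
  fixes f g :: "(nat, 'e::chilbert_space) ell2"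
  assumes eq: "\<And>z. cmod z < 1 \<Longrightarrow> power_sum (ell2_nth f) z = power_sum (ell2_nth g) z"
  shows "f = g"
proof -
  let ?h = "f - g"
  have "power_sum (ell2_nth ?h) z = 0" if z: "cmod z < 1" for z
    using linear_diff[OF bounded_linear.linear[OF bounded_linear_power_sum_ell2[OF z]], of f g]
    by (simp add: eq[OF z])
  then have "((\<lambda>t. 0::real) has_integral 2 * pi * (\<Sum>k. (1/2) ^ (2 * k) * (norm (ell2_nth ?h k))\<^sup>2)) {0..2 * pi}"
    using parseval_ell2[of "1/2" ?h] by (simp add: norm_mult)
  then have 0: "(\<Sum>k. (1/2) ^ (2 * k) * (norm (ell2_nth ?h k))\<^sup>2) = 0"
    by (simp add: has_integral_0_eq)
  have "summable (\<lambda>k. (1/2) ^ (2 * k) * (norm (ell2_nth ?h k))\<^sup>2)"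
    by (rule summable_comparison_test'[OF ell2_norm_summable[of ?h], of 0])
      (simp add: mult_left_le_one_le power_le_one)
  from suminf_eq_zero_iff[OF this] 0 have "ell2_nth ?h k = 0" for k by simp
  then show ?thesis by (intro ell2_eqI) simp
qed

lemma power_sum_push_Suc:
  fixes f :: "(nat, 'e::chilbert_space) ell2"
  assumes z: "cmod z < 1"
  shows "power_sum (ell2_nth (ell2_push Suc *\<^sub>V f)) z = z *\<^sub>C power_sum (ell2_nth f) z"
  by (rule eq_on_singlesI)
    (auto intro!: bounded_linear_compose[OF bounded_linear_power_sum_ell2[OF z] bounded_linear_cblinfun_apply]
      bounded_linear_compose[OF bounded_linear_scaleC bounded_linear_power_sum_ell2[OF z]]
      simp: ell2_push_single power_sum_ell2_single scaleC_scaleC)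

text \<open>Expressed through values in the disc and not through convolution of coefficients: by
  uniqueness of power series, operator identities can then be verified pointwise.\<close>

definition multiplier ::
    "(nat, 'e::chilbert_space) ell2 \<Rightarrow>\<^sub>C\<^sub>L (nat, 'e) ell2 \<Rightarrow> (complex \<Rightarrow> 'e \<Rightarrow>\<^sub>C\<^sub>L 'e) \<Rightarrow> bool"
  where "multiplier T \<Theta> \<longleftrightarrow> (\<forall>f z. cmod z < 1 \<longrightarrow>
    power_sum (ell2_nth (T *\<^sub>V f)) z = \<Theta> z *\<^sub>V power_sum (ell2_nth f) z)"

lemma multiplierD:
  "multiplier T \<Theta> \<Longrightarrow> cmod z < 1 \<Longrightarrow> power_sum (ell2_nth (T *\<^sub>V f)) z = \<Theta> z *\<^sub>V power_sum (ell2_nth f) z"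
  by (simp add: multiplier_def)

text \<open>Test the multiplier on the Szego kernel at \<open>z\<close>.\<close>

lemma multiplier_norm_le:
  fixes T :: "(nat, 'e::chilbert_space) ell2 \<Rightarrow>\<^sub>C\<^sub>L (nat, 'e) ell2"
  assumes T: "multiplier T \<Theta>" and z: "cmod z < 1"
  shows "norm (\<Theta> z) \<le> norm T"
proof (rule norm_cblinfun_bound)
  fix x :: 'e
  define q where "q = 1 - (cmod z)\<^sup>2"
  have q: "0 < q" using z by (simp add: q_def abs_square_less_1)
  have z2: "(cmod z)\<^sup>2 < 1" using q by (simp add: q_def)
  have sq: "(norm (cnj z ^ k *\<^sub>C x))\<^sup>2 = ((cmod z)\<^sup>2) ^ k * (norm x)\<^sup>2" for k
    by (simp add: norm_scaleC norm_power power_mult_distrib power_mult[symmetric] mult.commute)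
  have "summable (\<lambda>k. norm ((norm (cnj z ^ k *\<^sub>C x))\<^sup>2))"
    unfolding sq using z2 by (simp add: summable_mult2 summable_geometric)
  then have "(\<lambda>k. (norm (cnj z ^ k *\<^sub>C x))\<^sup>2) summable_on UNIV"
    by (rule norm_summable_imp_summable_on)
  moreover define f where "f = Abs_ell2 (\<lambda>k. cnj z ^ k *\<^sub>C x)"
  ultimately have f: "ell2_nth f = (\<lambda>k. cnj z ^ k *\<^sub>C x)" by (simp add: Abs_ell2_inverse)
  have nf: "(norm f)\<^sup>2 = (norm x)\<^sup>2 / q"
    using sums_unique[OF ell2_norm_sums[of f]] z2
    by (simp add: f sq suminf_mult2[symmetric] summable_geometric suminf_geometric q_def)
  have "(\<lambda>k. (z * cnj z) ^ k *\<^sub>C x) sums ((1 / (1 - z * cnj z)) *\<^sub>C x)"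
    using z2 by (intro bounded_linear.sums[OF scaleC.bounded_linear_left geometric_sums])
      (simp add: norm_mult power2_eq_square)
  moreover have "1 - z * cnj z = complex_of_real q"
    by (simp add: q_def complex_norm_square[symmetric])
  ultimately have ev: "power_sum (ell2_nth f) z = (1 / q) *\<^sub>R x"
    using sums_unique by (fastforce simp: power_sum_def f scaleC_scaleC power_mult_distrib
        scaleC_of_real[symmetric])
  \<comment> \<open>The kernel has squared norm \<open>(norm x)^2 / q\<close> and point evaluation
    costs another \<open>1 / q\<close>; together they match the square of the factor
    \<open>1 / q\<close> that evaluating the kernel produces on the left.\<close>
  have "(norm (\<Theta> z *\<^sub>V x) / q)\<^sup>2 = (norm (power_sum (ell2_nth (T *\<^sub>V f)) z))\<^sup>2"
    using q by (simp add: multiplierD[OF T z] ev cblinfun.scaleR_right)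
  also have "\<dots> \<le> (norm (T *\<^sub>V f))\<^sup>2 / q"
    using norm_power_sum_ell2_le[OF z] by (simp add: q_def)
  also have "\<dots> \<le> (norm T * norm f)\<^sup>2 / q"
    using q by (intro divide_right_mono power_mono norm_cblinfun) auto
  also have "\<dots> = (norm T * norm x / q)\<^sup>2"
    using q by (simp add: power_mult_distrib power_divide nf) (simp add: power2_eq_square)
  finally have "norm (\<Theta> z *\<^sub>V x) / q \<le> norm T * norm x / q"
    using q by (auto intro: power2_le_imp_le)
  then show "norm (\<Theta> z *\<^sub>V x) \<le> norm T * norm x"
    using q by (simp add: divide_le_cancel)
qed simp

lemma power_sum_cblinfun_apply:
  fixes a :: "nat \<Rightarrow> 'a::complex_normed_vector \<Rightarrow>\<^sub>C\<^sub>L 'b::{complex_normed_vector, banach}"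
  assumes "\<And>k. norm (a k) \<le> C" "cmod z < 1"
  shows "power_sum a z *\<^sub>V x = power_sum (\<lambda>k. a k *\<^sub>V x) z"
proof -
  have "(\<lambda>k. (z ^ k *\<^sub>C a k) *\<^sub>V x) sums (power_sum a z *\<^sub>V x)"
    by (rule bounded_linear.sums[OF cblinfun.bounded_linear_left power_sum_sums_disc[OF assms]])
  then show ?thesis
    by (simp add: power_sum_def[of "\<lambda>k. a k *\<^sub>V x"] scaleC_cblinfun_apply sums_iff)
qed

definition ell2_inject :: "'i \<Rightarrow> 'e::complex_inner \<Rightarrow>\<^sub>C\<^sub>L ('i, 'e) ell2"
  where "ell2_inject i = CBlinfun (Blinfun (ell2_single i))"

lemma ell2_inject_apply: "ell2_inject i *\<^sub>V x = ell2_single i x"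
  unfolding ell2_inject_def
  by (rule CBlinfun_apply[where K=1])
    (auto simp: ell2_single_scaleC intro!: ell2_eqI simp: ell2_nth_single)

definition multiplier_coeff ::
    "(nat, 'e::chilbert_space) ell2 \<Rightarrow>\<^sub>C\<^sub>L (nat, 'e) ell2 \<Rightarrow> nat \<Rightarrow> 'e \<Rightarrow>\<^sub>C\<^sub>L 'e"
  where "multiplier_coeff T r = ell2_coord r o\<^sub>C\<^sub>L T o\<^sub>C\<^sub>L ell2_inject 0"

lemma multiplier_coeff_apply: "multiplier_coeff T r *\<^sub>V x = ell2_nth (T *\<^sub>V ell2_single 0 x) r"
  by (simp add: multiplier_coeff_def ell2_coord_apply ell2_inject_apply)

lemma norm_multiplier_coeff: "norm (multiplier_coeff T r) \<le> norm T"
proof (rule norm_cblinfun_bound)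
  fix x
  show "norm (multiplier_coeff T r *\<^sub>V x) \<le> norm T * norm x"
    using order_trans[OF norm_ell2_nth_le norm_cblinfun, of T "ell2_single 0 x" r]
    by (simp add: multiplier_coeff_apply)
qed simp

text \<open>Commutation reduces each monomial to a constant, where the relation holds by the choice
  of the coefficients; continuity extends it from monomials to the whole space.\<close>

lemma multiplier_if_shift_commutes:
  fixes T :: "(nat, 'e::chilbert_space) ell2 \<Rightarrow>\<^sub>C\<^sub>L (nat, 'e) ell2"
  assumes comm: "\<And>f. T *\<^sub>V ell2_push Suc *\<^sub>V f = ell2_push Suc *\<^sub>V T *\<^sub>V f"
  shows "multiplier T (power_sum (multiplier_coeff T))"
  unfolding multiplier_def
proof (intro allI impI)
  fix f z assume z: "cmod z < 1"
  note ev = bounded_linear_power_sum_ell2[OF z]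
  show "power_sum (ell2_nth (T *\<^sub>V f)) z = power_sum (multiplier_coeff T) z *\<^sub>V power_sum (ell2_nth f) z"
  proof (rule eq_on_singlesI[where f=f])
    show "bounded_linear (\<lambda>f. power_sum (ell2_nth (T *\<^sub>V f)) z)"
      by (rule bounded_linear_compose[OF ev bounded_linear_cblinfun_apply])
    show "bounded_linear (\<lambda>f. power_sum (multiplier_coeff T) z *\<^sub>V power_sum (ell2_nth f) z)"
      by (rule bounded_linear_compose[OF bounded_linear_cblinfun_apply ev])
    fix m and x :: 'e
    show "power_sum (ell2_nth (T *\<^sub>V ell2_single m x)) z
        = power_sum (multiplier_coeff T) z *\<^sub>V power_sum (ell2_nth (ell2_single m x)) z"
    proof (induction m)
      case 0
      show ?case
        by (simp add: power_sum_ell2_single power_sum_cblinfun_apply[OF norm_multiplier_coeff z]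
            multiplier_coeff_apply)
    next
      case (Suc m)
      have "ell2_single (Suc m) x = ell2_push Suc *\<^sub>V ell2_single m x" by (simp add: ell2_push_single)
      then show ?case
        by (simp only: comm power_sum_push_Suc[OF z] Suc.IH cblinfun_scaleC_right)
    qed
  qed
qed

lemma multiplier_shift_commutes:
  assumes "multiplier T \<Theta>"
  shows "T *\<^sub>V ell2_push Suc *\<^sub>V f = ell2_push Suc *\<^sub>V T *\<^sub>V f"
  by (rule power_sum_ell2_unique)
    (simp add: power_sum_push_Suc multiplierD[OF assms] cblinfun_scaleC_right)

section \<open>Analyticity of vector-valued power series\<close>

lemma has_derivative_power_sum:
  fixes a :: "nat \<Rightarrow> 'a::{complex_normed_vector, banach}"
  assumes a: "\<And>k. norm (a k) \<le> C" and z: "cmod z < 1"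
  shows "\<exists>D. (power_sum a has_derivative (\<lambda>h. h *\<^sub>C D)) (at z)"
proof -
  \<comment> \<open>On the ball of radius \<open>r\<close> the derived series is dominated by the
    convergent series of \<open>n * r^(n-1) * C\<close>. Its uniform convergence there permits
    termwise differentiation.\<close>
  obtain r where r: "cmod z < r" "r < 1" using dense[OF z] by blast
  then have r0: "0 < r" using norm_ge_zero[of z] by linarith
  let ?S = "ball (0::complex) r"
  let ?d = "\<lambda>n x. (of_nat n * x ^ (n - 1)) *\<^sub>C a n"
  define D where "D x = (\<Sum>n. ?d n x)" for x
  have "summable (\<lambda>n. diffs (\<lambda>_. 1) n * r ^ n)"
    by (rule termdiff_converges[where K=1]) (use r r0 in \<open>auto intro: summable_geometric\<close>)
  then have "summable (\<lambda>n. real (Suc n) * r ^ (Suc n - 1))" by (simp add: diffs_def)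
  then have "summable (\<lambda>n. real n * r ^ (n - 1))" by (subst (asm) summable_Suc_iff)
  then have M: "summable (\<lambda>n. real n * r ^ (n - 1) * C)" by (rule summable_mult2)
  have lim: "uniform_limit ?S (\<lambda>n x. \<Sum>i<n. ?d i x) D sequentially"
    unfolding D_def[abs_def]
  proof (rule Weierstrass_m_test[OF _ M])
    fix n x assume x: "x \<in> ?S"
    have "norm (?d n x) = real n * cmod x ^ (n - 1) * norm (a n)"
      by (simp add: norm_scaleC norm_mult norm_power)
    also have "\<dots> \<le> real n * r ^ (n - 1) * C"
      using x r0 by (intro mult_mono power_mono a) auto
    finally show "norm (?d n x) \<le> real n * r ^ (n - 1) * C" .
  qed
  have unif: "\<forall>\<^sub>F n in sequentially. \<forall>x\<in>?S. \<forall>h. norm ((\<Sum>i<n. h *\<^sub>C ?d i x) - h *\<^sub>C D x) \<le> e * norm h"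
    if "0 < e" for e
    using uniform_limitD[OF lim that]
  proof (rule eventually_mono, intro ballI allI)
    fix n x h assume "\<forall>x\<in>?S. dist (\<Sum>i<n. ?d i x) (D x) < e" "x \<in> ?S"
    then have "norm ((\<Sum>i<n. ?d i x) - D x) \<le> e" by (simp add: dist_norm less_imp_le)
    then have "norm (h *\<^sub>C ((\<Sum>i<n. ?d i x) - D x)) \<le> e * norm h"
      unfolding norm_scaleC mult.commute[of e] by (rule mult_left_mono) simp
    then show "norm ((\<Sum>i<n. h *\<^sub>C ?d i x) - h *\<^sub>C D x) \<le> e * norm h"
      by (simp only: scaleC.diff_right scaleC.sum_right)
  qed
  have "\<exists>g. \<forall>x\<in>?S. (\<lambda>n. x ^ n *\<^sub>C a n) sums g x \<and> (g has_derivative (\<lambda>h. h *\<^sub>C D x)) (at x within ?S)"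
  proof (rule has_derivative_series[OF convex_ball _ unif])
    fix n x assume "x \<in> ?S"
    have "((\<lambda>x. x ^ n) has_derivative (\<lambda>h. h * (of_nat n * x ^ (n - 1)))) (at x within ?S)"
      by (auto intro!: derivative_eq_intros simp: mult_ac)
    from bounded_linear.has_derivative[OF scaleC.bounded_linear_left this, of "a n"]
    show "((\<lambda>x. x ^ n *\<^sub>C a n) has_derivative (\<lambda>h. h *\<^sub>C ?d n x)) (at x within ?S)"
      by (simp add: scaleC_scaleC)
  next
    show "z \<in> ?S" using r by simp
    show "(\<lambda>n. z ^ n *\<^sub>C a n) sums power_sum a z" by (rule power_sum_sums_disc[OF a z])
  qed
  then obtain g where g: "\<And>x. x \<in> ?S \<Longrightarrow> (\<lambda>n. x ^ n *\<^sub>C a n) sums g x"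
    "\<And>x. x \<in> ?S \<Longrightarrow> (g has_derivative (\<lambda>h. h *\<^sub>C D x)) (at x within ?S)" by blast
  have zS: "z \<in> ?S" using r by simp
  have "(g has_derivative (\<lambda>h. h *\<^sub>C D z)) (at z)"
    using g(2)[OF zS] by (simp add: at_within_open[OF zS])
  then have "(power_sum a has_derivative (\<lambda>h. h *\<^sub>C D z)) (at z)"
    by (rule has_derivative_transform_within_open[OF _ open_ball zS])
      (use g(1) in \<open>auto simp: power_sum_def sums_iff\<close>)
  then show ?thesis by blast
qed

lemma multiplier_H_infinity:
  assumes T: "multiplier T (power_sum a)" and a: "\<And>k. norm (a k) \<le> C"
  shows "power_sum a \<in> H_infinity"
proof -
  have "bounded (power_sum a ` ball 0 1)"
    using multiplier_norm_le[OF T] by (intro boundedI[of _ "norm T"]) auto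
  then show ?thesis using has_derivative_power_sum[OF a] by (auto simp: H_infinity_def)
qed

subsection \<open>Inner multipliers are the isometric ones\<close>

text \<open>Dominated convergence and measurability of limits are applied along sequences, so the
  radial approach is sampled at fixed radii.\<close>

definition radius_seq :: "nat \<Rightarrow> real"
  where "radius_seq n = 1 - inverse (real (Suc n))"

lemma radius_seq_bounds: "0 \<le> radius_seq n" "radius_seq n < 1"
  by (auto simp: radius_seq_def field_simps)

lemma radius_seq_tendsto: "radius_seq \<longlonglongrightarrow> 1"
proof -
  have "(\<lambda>n. 1 - inverse (real (Suc n))) \<longlonglongrightarrow> 1 - 0"
    by (intro tendsto_intros LIMSEQ_inverse_real_of_nat)
  then show ?thesis by (simp add: radius_seq_def[abs_def])
qed

lemma radius_seq_at_left: "filterlim radius_seq (at_left 1) sequentially"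
  unfolding filterlim_at
  using radius_seq_bounds(2) less_imp_neq[OF radius_seq_bounds(2)] radius_seq_tendsto by auto

lemma radial_means_tendsto:
  fixes f :: "(nat, 'e::chilbert_space) ell2"
  shows "(\<lambda>n. integral {0..2 * pi} (\<lambda>t. (norm (power_sum (ell2_nth f) (complex_of_real (radius_seq n) * cis t)))\<^sup>2))
    \<longlonglongrightarrow> 2 * pi * (norm f)\<^sup>2"
proof -
  let ?b = "\<lambda>k. complex_of_real ((norm (ell2_nth f k))\<^sup>2)"
  have b: "summable (\<lambda>k. norm (?b k))" using ell2_norm_summable[of f] by (simp add: norm_power)
  have ps: "power_sum ?b (complex_of_real (r\<^sup>2)) = complex_of_real (\<Sum>k. r ^ (2 * k) * (norm (ell2_nth f k))\<^sup>2)"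
    if "0 \<le> r" "r \<le> 1" for r
  proof -
    have "summable (\<lambda>k. r ^ (2 * k) * (norm (ell2_nth f k))\<^sup>2)"
      by (rule summable_comparison_test'[OF ell2_norm_summable[of f], of 0])
        (use that in \<open>simp add: mult_left_le_one_le power_le_one\<close>)
    from sums_unique[OF sums_of_real[OF summable_sums[OF this], where 'a=complex]]
    show ?thesis by (simp add: power_sum_def power_mult)
  qed
  have "(\<lambda>n. power_sum ?b (complex_of_real ((radius_seq n)\<^sup>2))) \<longlonglongrightarrow> power_sum ?b (complex_of_real (1\<^sup>2))"
  proof (rule continuous_on_tendsto_compose[OF continuous_on_power_sum[OF b]])
    show "(\<lambda>n. complex_of_real ((radius_seq n)\<^sup>2)) \<longlonglongrightarrow> complex_of_real (1\<^sup>2)"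
      by (intro tendsto_intros radius_seq_tendsto)
    show "\<forall>\<^sub>F n in sequentially. complex_of_real ((radius_seq n)\<^sup>2) \<in> cball 0 1"
      using radius_seq_bounds less_imp_le[OF radius_seq_bounds(2)]
      by (intro always_eventually allI) (simp add: norm_power power_le_one)
  qed simp
  then have "(\<lambda>n. complex_of_real (\<Sum>k. radius_seq n ^ (2 * k) * (norm (ell2_nth f k))\<^sup>2))
      \<longlonglongrightarrow> complex_of_real (\<Sum>k. 1 ^ (2 * k) * (norm (ell2_nth f k))\<^sup>2)"
    using radius_seq_bounds less_imp_le[OF radius_seq_bounds(2)]
    by (simp only: ps zero_le_one order_refl)
  then have "(\<lambda>n. \<Sum>k. radius_seq n ^ (2 * k) * (norm (ell2_nth f k))\<^sup>2) \<longlonglongrightarrow> (norm f)\<^sup>2"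
    unfolding tendsto_of_real_iff by (simp add: sums_unique[OF ell2_norm_sums[of f], symmetric])
  then have "(\<lambda>n. 2 * pi * (\<Sum>k. radius_seq n ^ (2 * k) * (norm (ell2_nth f k))\<^sup>2)) \<longlonglongrightarrow> 2 * pi * (norm f)\<^sup>2"
    by (intro tendsto_intros)
  then show ?thesis
    by (simp only: integral_unique[OF parseval_ell2[OF radius_seq_bounds]])
qed

lemma boundary_norm_integral:
  fixes f :: "(nat, 'e::chilbert_space) ell2" and \<beta> :: "real \<Rightarrow> real"
  assumes bound: "\<And>z. cmod z < 1 \<Longrightarrow> norm (power_sum (ell2_nth f) z) \<le> K"
    and lim: "AE t in lebesgue_on {0..2 * pi}.
      (\<lambda>n. norm (power_sum (ell2_nth f) (complex_of_real (radius_seq n) * cis t))) \<longlonglongrightarrow> \<beta> t"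
    and meas: "\<beta> \<in> borel_measurable (lebesgue_on {0..2 * pi})"
  shows "integrable (lebesgue_on {0..2 * pi}) (\<lambda>t. (\<beta> t)\<^sup>2)"
    and "integral\<^sup>L (lebesgue_on {0..2 * pi}) (\<lambda>t. (\<beta> t)\<^sup>2) = 2 * pi * (norm f)\<^sup>2"
proof -
  let ?M = "lebesgue_on {0..2 * pi}"
  let ?u = "\<lambda>n t. (norm (power_sum (ell2_nth f) (complex_of_real (radius_seq n) * cis t)))\<^sup>2"
  have r: "cmod (complex_of_real (radius_seq n) * cis t) < 1" for n t
    using radius_seq_bounds[of n] by (simp add: norm_mult)
  have cont: "continuous_on {0..2 * pi} (?u n)" for n
  proof -
    let ?q = "complex_of_real (radius_seq n)"
    have "summable (\<lambda>k. norm (?q ^ k *\<^sub>C ell2_nth f k))"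
      by (rule summable_norm_geometric[OF norm_ell2_nth_le]) (use radius_seq_bounds[of n] in simp)
    from continuous_on_power_sum_circle[OF this, of 1] show ?thesis
      by (auto intro!: continuous_intros simp: power_sum_scale)
  qed
  have int: "integrable ?M (?u n)" for n
    using continuous_imp_integrable_real[OF cont] .
  have eq: "integral\<^sup>L ?M (?u n) = integral {0..2 * pi} (?u n)" for n
    by (rule lebesgue_integral_eq_integral[OF int]) simp
  have lim': "AE t in ?M. (\<lambda>n. ?u n t) \<longlonglongrightarrow> (\<beta> t)\<^sup>2"
    using lim by eventually_elim (intro tendsto_intros)
  have bd: "AE t in ?M. norm (?u n t) \<le> K\<^sup>2" for n
    using bound[OF r] by (intro AE_I2) (simp add: power_mono)
  have K: "integrable ?M (\<lambda>t. K\<^sup>2)"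
    by (rule continuous_imp_integrable_real) simp
  have m: "(\<lambda>t. (\<beta> t)\<^sup>2) \<in> borel_measurable ?M" "\<And>n. ?u n \<in> borel_measurable ?M"
    using meas int by (auto intro: borel_measurable_power)
  note dom = m K lim' bd
  show "integrable ?M (\<lambda>t. (\<beta> t)\<^sup>2)"
    by (rule integrable_dominated_convergence[OF dom])
  have "(\<lambda>n. integral\<^sup>L ?M (?u n)) \<longlonglongrightarrow> integral\<^sup>L ?M (\<lambda>t. (\<beta> t)\<^sup>2)"
    by (rule integral_dominated_convergence[OF dom])
  then show "integral\<^sup>L ?M (\<lambda>t. (\<beta> t)\<^sup>2) = 2 * pi * (norm f)\<^sup>2"
    using radial_means_tendsto[of f] unfolding eq by (rule LIMSEQ_unique)
qed

lemma isometry_if_inner: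
  fixes T :: "(nat, 'e::chilbert_space) ell2 \<Rightarrow>\<^sub>C\<^sub>L (nat, 'e) ell2"
  assumes T: "multiplier T \<Theta>" and inner: "inner_function \<Theta>"
  shows "cisometry T"
proof -
  let ?M = "lebesgue_on {0..2 * pi}"
  have fin: "norm (T *\<^sub>V f) = norm f" if F: "finite F" and f: "f = (\<Sum>k\<in>F. ell2_single k (x k))" for F x f
  proof -
    let ?p = "ell2_nth f" and ?g = "T *\<^sub>V f"
    have p: "summable (\<lambda>k. norm (?p k))"
      by (rule summable_finite[OF F]) (auto simp: f ell2_nth_sum ell2_nth_single intro!: sum.neutral)
    define \<beta> where "\<beta> t = norm (power_sum ?p (cis t))" for t
    have cont: "continuous_on {0..2 * pi} \<beta>"
      unfolding \<beta>_def[abs_def]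
      using continuous_on_power_sum_circle[OF p, of 1 "{0..2 * pi}"] by (intro continuous_on_norm) simp
    have "AE t in ?M. \<exists>B. has_boundary_value \<Theta> (cis t) B \<and> cadjoint B o\<^sub>C\<^sub>L B = id_cblinfun"
      using inner by (simp add: inner_function_def)
    then have lim: "AE t in ?M. (\<lambda>n. norm (power_sum (ell2_nth ?g) (complex_of_real (radius_seq n) * cis t))) \<longlonglongrightarrow> \<beta> t"
    proof eventually_elim
      case (elim t)
      then obtain B where B: "has_boundary_value \<Theta> (cis t) B" "cisometry B"
        by (auto simp: cisometry_iff_cadjoint)
      let ?z = "\<lambda>n. complex_of_real (radius_seq n) * cis t"
      let ?y = "power_sum ?p (cis t)"
      have z: "cmod (?z n) < 1" for n using radius_seq_bounds[of n] by (simp add: norm_mult)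
      have "(\<lambda>n. \<Theta> (?z n) *\<^sub>V ?y) \<longlonglongrightarrow> B *\<^sub>V ?y"
        using B(1) unfolding has_boundary_value_def
        by (intro filterlim_compose[OF _ radius_seq_at_left]) blast
      \<comment> \<open>A strong limit acts on a fixed vector, whereas the polynomial moves with the
        radius; the uniform bound \<open>norm T\<close> on the symbol absorbs the
        difference.\<close>
      moreover have "(\<lambda>n. \<Theta> (?z n) *\<^sub>V (power_sum ?p (?z n) - ?y)) \<longlonglongrightarrow> 0"
      proof (rule Lim_null_comparison)
        show "\<forall>\<^sub>F n in sequentially. norm (\<Theta> (?z n) *\<^sub>V (power_sum ?p (?z n) - ?y))
            \<le> norm T * norm (power_sum ?p (?z n) - ?y)"
          by (intro always_eventually allI order_trans[OF norm_cblinfun] mult_right_mono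
              multiplier_norm_le[OF T z]) simp
        have "(\<lambda>n. power_sum ?p (?z n)) \<longlonglongrightarrow> ?y"
        proof (rule continuous_on_tendsto_compose[OF continuous_on_power_sum[OF p]])
          have "?z \<longlonglongrightarrow> complex_of_real 1 * cis t" by (intro tendsto_intros radius_seq_tendsto)
          then show "?z \<longlonglongrightarrow> cis t" by simp
        qed (use less_imp_le[OF z] in auto)
        then have "(\<lambda>n. norm T * norm (power_sum ?p (?z n) - ?y)) \<longlonglongrightarrow> norm T * norm (?y - ?y)"
          by (intro tendsto_intros)
        then show "(\<lambda>n. norm T * norm (power_sum ?p (?z n) - ?y)) \<longlonglongrightarrow> 0" by simp
      qed
      ultimately have "(\<lambda>n. \<Theta> (?z n) *\<^sub>V ?y + \<Theta> (?z n) *\<^sub>V (power_sum ?p (?z n) - ?y)) \<longlonglongrightarrow> B *\<^sub>V ?y + 0"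
        by (rule tendsto_add)
      then have "(\<lambda>n. power_sum (ell2_nth ?g) (?z n)) \<longlonglongrightarrow> B *\<^sub>V ?y"
        by (simp add: multiplierD[OF T z] cblinfun.diff_right)
      then have "(\<lambda>n. norm (power_sum (ell2_nth ?g) (?z n))) \<longlonglongrightarrow> norm (B *\<^sub>V ?y)"
        by (rule tendsto_norm)
      then show ?case using B(2) by (simp add: cisometry_def \<beta>_def)
    qed
    have bound: "norm (power_sum (ell2_nth ?g) z) \<le> norm T * (\<Sum>k. norm (?p k))" if z: "cmod z < 1" for z
      unfolding multiplierD[OF T z]
      by (intro order_trans[OF norm_cblinfun] mult_mono multiplier_norm_le[OF T z]
          norm_power_sum_le[OF p]) (use z in auto)
    have "2 * pi * (norm ?g)\<^sup>2 = integral\<^sup>L ?M (\<lambda>t. (\<beta> t)\<^sup>2)"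
      by (rule boundary_norm_integral(2)[OF bound lim, symmetric])
        (use continuous_imp_integrable_real[OF cont] in auto)
    also have "\<dots> = integral {0..2 * pi} (\<lambda>t. (\<beta> t)\<^sup>2)"
      by (rule lebesgue_integral_eq_integral)
        (auto intro!: continuous_imp_integrable_real continuous_intros cont)
    also have "\<dots> = 2 * pi * (norm f)\<^sup>2"
      using integral_unique[OF parseval[OF p, of 0]]
      by (simp add: \<beta>_def sums_unique[OF ell2_norm_sums[of f], symmetric])
    finally show ?thesis by simp
  qed
  show ?thesis
    unfolding cisometry_def
  proof
    fix f :: "(nat, 'e) ell2"
    let ?s = "\<lambda>F. \<Sum>i\<in>F. ell2_single i (ell2_nth f i)"
    have s: "(?s \<longlongrightarrow> f) (finite_subsets_at_top UNIV)"
      using ell2_has_sum[of f] by (simp add: has_sum_def)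
    then have "((\<lambda>F. norm (T *\<^sub>V ?s F)) \<longlongrightarrow> norm (T *\<^sub>V f)) (finite_subsets_at_top UNIV)"
      by (intro tendsto_norm bounded_linear.tendsto[OF bounded_linear_cblinfun_apply])
    moreover have "((\<lambda>F. norm (T *\<^sub>V ?s F)) \<longlongrightarrow> norm f) (finite_subsets_at_top UNIV)"
      by (rule Lim_transform_eventually[OF tendsto_norm[OF s]])
        (auto intro!: eventually_finite_subsets_at_top_weakI fin[symmetric])
    ultimately show "norm (T *\<^sub>V f) = norm f"
      by (rule tendsto_unique[OF finite_subsets_at_top_neq_bot])
  qed
qed

text \<open>The image of the constant \<open>x\<close> is bounded by \<open>norm x\<close> in the
  disc, while its boundary values have mean square exactly \<open>(norm x)^2\<close>. A nonnegative
  function with zero integral vanishes almost everywhere, so the bound is attained.\<close>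

lemma boundary_vector_isometric:
  fixes T :: "(nat, 'e::{chilbert_space, second_countable_topology}) ell2 \<Rightarrow>\<^sub>C\<^sub>L (nat, 'e) ell2"
  assumes T: "multiplier T \<Theta>" and iso: "cisometry T"
  shows "AE t in lebesgue_on {0..2 * pi}. \<exists>l. norm l = norm x \<and>
    ((\<lambda>r. \<Theta> (complex_of_real r * cis t) *\<^sub>V x) \<longlongrightarrow> l) (at_left 1)"
proof -
  let ?M = "lebesgue_on {0..2 * pi}"
  let ?f = "T *\<^sub>V ell2_single 0 x"
  let ?g = "\<lambda>t r. power_sum (ell2_nth ?f) (complex_of_real r * cis t)"
  have nf: "norm ?f = norm x" using iso by (simp add: cisometry_def)
  have nT: "norm T \<le> 1" by (rule norm_cblinfun_bound) (use iso in \<open>simp_all add: cisometry_def\<close>)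
  have ev: "power_sum (ell2_nth ?f) z = \<Theta> z *\<^sub>V x" if "cmod z < 1" for z
    by (simp add: multiplierD[OF T that] power_sum_ell2_single)
  have bound: "norm (power_sum (ell2_nth ?f) z) \<le> norm x" if z: "cmod z < 1" for z
  proof -
    have "norm (\<Theta> z *\<^sub>V x) \<le> 1 * norm x"
      by (intro order_trans[OF norm_cblinfun] mult_right_mono order_trans[OF multiplier_norm_le[OF T z] nT]) simp
    then show ?thesis by (simp add: ev[OF z])
  qed
  have "negligible {t \<in> {0..2 * pi}. \<not> (\<exists>l. (?g t \<longlongrightarrow> l) (at_left 1))}"
    by (rule radial_limit_exists[OF ell2_norm_summable])
  then have lim: "AE t in ?M. \<exists>l. (?g t \<longlongrightarrow> l) (at_left 1)"
    unfolding negligible_iff_null_sets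
    by (subst AE_restrict_space_iff) (auto intro: AE_I')
  \<comment> \<open>\<open>lim\<close> is defined for every \<open>t\<close>, which gives a
    measurable function whatever its default value on the null set of divergence.\<close>
  define \<beta> where "\<beta> t = lim (\<lambda>n. norm (?g t (radius_seq n)))" for t
  have z: "cmod (complex_of_real (radius_seq n) * cis t) < 1" for n t
    using radius_seq_bounds[of n] by (simp add: norm_mult)
  have seq: "AE t in ?M. (\<lambda>n. norm (?g t (radius_seq n))) \<longlonglongrightarrow> \<beta> t"
    using lim
  proof eventually_elim
    case (elim t)
    then obtain l where "(?g t \<longlongrightarrow> l) (at_left 1)" by blast
    then have "(\<lambda>n. norm (?g t (radius_seq n))) \<longlonglongrightarrow> norm l"
      by (intro tendsto_norm filterlim_compose[OF _ radius_seq_at_left])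
    then show ?case unfolding \<beta>_def by (simp add: limI)
  qed
  have "(\<lambda>t. norm (?g t (radius_seq n))) \<in> borel_measurable ?M" for n
  proof (rule borel_measurable_integrable, rule continuous_imp_integrable_real)
    let ?q = "complex_of_real (radius_seq n)"
    have "summable (\<lambda>k. norm (?q ^ k *\<^sub>C ell2_nth ?f k))"
      by (rule summable_norm_geometric[OF norm_ell2_nth_le]) (use radius_seq_bounds[of n] in simp)
    from continuous_on_power_sum_circle[OF this, of 1]
    show "continuous_on {0..2 * pi} (\<lambda>t. norm (?g t (radius_seq n)))"
      by (auto intro!: continuous_intros simp: power_sum_scale)
  qed
  then have meas: "\<beta> \<in> borel_measurable ?M"
    unfolding \<beta>_def[abs_def] by (rule borel_measurable_lim_metric)
  note \<beta> = boundary_norm_integral[OF bound seq meas]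
  have const: "integrable ?M (\<lambda>t. (norm x)\<^sup>2)"
    by (rule continuous_imp_integrable_real) simp
  have "integral\<^sup>L ?M (\<lambda>t. (norm x)\<^sup>2) = integral {0..2 * pi} (\<lambda>t. (norm x)\<^sup>2)"
    by (rule lebesgue_integral_eq_integral[OF const]) simp
  then have "integral\<^sup>L ?M (\<lambda>t. (norm x)\<^sup>2 - (\<beta> t)\<^sup>2) = 0"
    using \<beta> const by (simp add: nf)
  moreover have le: "AE t in ?M. \<beta> t \<le> norm x \<and> 0 \<le> \<beta> t"
    using seq
  proof eventually_elim
    case (elim t)
    have "\<beta> t \<le> norm x"
      by (rule LIMSEQ_le_const2[OF elim]) (use bound[OF z] in blast)
    moreover have "0 \<le> \<beta> t"
      by (rule LIMSEQ_le_const[OF elim]) (use norm_ge_zero in blast)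
    ultimately show ?case ..
  qed
  then have "AE t in ?M. 0 \<le> (norm x)\<^sup>2 - (\<beta> t)\<^sup>2"
    by eventually_elim (simp add: power_mono)
  ultimately have "AE t in ?M. (norm x)\<^sup>2 - (\<beta> t)\<^sup>2 = 0"
    using integral_nonneg_eq_0_iff_AE[of ?M "\<lambda>t. (norm x)\<^sup>2 - (\<beta> t)\<^sup>2"] \<beta>(1) const by simp
  with le have "AE t in ?M. \<beta> t = norm x"
    by eventually_elim (auto simp: power2_eq_iff_nonneg)
  with lim seq show ?thesis
  proof eventually_elim
    case (elim t)
    then obtain l where l: "(?g t \<longlongrightarrow> l) (at_left 1)" by blast
    then have "(\<lambda>n. norm (?g t (radius_seq n))) \<longlonglongrightarrow> norm l"
      by (intro tendsto_norm filterlim_compose[OF _ radius_seq_at_left])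
    with elim have "norm l = norm x" using LIMSEQ_unique by metis
    moreover have "\<forall>\<^sub>F r in at_left 1. ?g t r = \<Theta> (complex_of_real r * cis t) *\<^sub>V x"
      unfolding eventually_at_left_field
      by (intro exI[of _ 0]) (auto intro!: ev simp: norm_mult)
    with l have "((\<lambda>r. \<Theta> (complex_of_real r * cis t) *\<^sub>V x) \<longlongrightarrow> l) (at_left 1)"
      by (rule Lim_transform_eventually)
    ultimately show ?case by blast
  qed
qed

text \<open>Contractions that converge on a dense set converge everywhere; the limit is isometric
  because its norm-preserved vectors form a closed set containing the dense one.\<close>

lemma strong_limit_from_dense:
  fixes A :: "real \<Rightarrow> 'e::chilbert_space \<Rightarrow>\<^sub>C\<^sub>L 'e"
  assumes bound: "\<And>r. 0 < r \<Longrightarrow> r < 1 \<Longrightarrow> norm (A r) \<le> 1" and D: "closure D = UNIV"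
    and lim: "\<And>x. x \<in> D \<Longrightarrow> \<exists>l. norm l = norm x \<and> ((\<lambda>r. A r *\<^sub>V x) \<longlongrightarrow> l) (at_left 1)"
  shows "\<exists>B. cisometry B \<and> (\<forall>x. ((\<lambda>r. A r *\<^sub>V x) \<longlongrightarrow> B *\<^sub>V x) (at_left 1))"
proof -
  have le: "norm (A r *\<^sub>V x) \<le> norm x" if "0 < r" "r < 1" for r x
    using mult_right_mono[OF bound[OF that] norm_ge_zero[of x]] norm_cblinfun[of "A r" x] by simp
  have dense: "\<exists>d\<in>D. norm (x - d) < e" if "0 < e" for x e
    using D that closure_approachable[of x D] by (auto simp: dist_norm norm_minus_commute)
  have "\<exists>l. ((\<lambda>r. A r *\<^sub>V x) \<longlongrightarrow> l) (at_left 1)" for x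
  proof (rule at_left_limit_exists)
    fix e :: real assume e: "0 < e"
    then have e3: "0 < e / 3" by simp
    obtain d where d: "d \<in> D" "norm (x - d) < e / 3" using dense[OF e3] by blast
    obtain l where l: "((\<lambda>r. A r *\<^sub>V d) \<longlongrightarrow> l) (at_left 1)" using lim[OF d(1)] by blast
    \<comment> \<open>Replacing \<open>x\<close> by \<open>d\<close> costs less than
      \<open>e / 3\<close> at each of \<open>r\<close> and \<open>s\<close>. The remaining third is
      shared by the distances of their values at \<open>d\<close> from the limit.\<close>
    have "0 < e / 6" using e by simp
    from tendstoD[OF l this] obtain b where b: "b < 1" "\<And>r. b < r \<Longrightarrow> r < 1 \<Longrightarrow> dist (A r *\<^sub>V d) l < e / 6"
      unfolding eventually_at_left_field by blast
    have "norm (A r *\<^sub>V x - A s *\<^sub>V x) < e" if rs: "max 0 b < r" "r < 1" "max 0 b < s" "s < 1" for r s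
    proof -
      have "dist (A r *\<^sub>V d) (A s *\<^sub>V d) < e / 6 + e / 6"
        using rs by (intro dist_triangle_less_add[of _ l] b(2)) auto
      moreover have "norm (A r *\<^sub>V (x - d)) < e / 3" "norm (A s *\<^sub>V (x - d)) < e / 3"
        using le[of r "x - d"] le[of s "x - d"] d(2) rs by auto
      moreover have "A r *\<^sub>V x - A s *\<^sub>V x = A r *\<^sub>V (x - d) - A s *\<^sub>V (x - d) + (A r *\<^sub>V d - A s *\<^sub>V d)"
        by (simp add: cblinfun.diff_right)
      then have "norm (A r *\<^sub>V x - A s *\<^sub>V x)
          \<le> norm (A r *\<^sub>V (x - d)) + norm (A s *\<^sub>V (x - d)) + norm (A r *\<^sub>V d - A s *\<^sub>V d)"
        by (simp only:) (intro order_trans[OF norm_triangle_ineq] add_right_mono norm_triangle_ineq4)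
      ultimately show ?thesis by (simp add: dist_norm)
    qed
    then show "\<exists>\<delta><1. \<forall>r s. \<delta> < r \<and> r < 1 \<and> \<delta> < s \<and> s < 1 \<longrightarrow> norm (A r *\<^sub>V x - A s *\<^sub>V x) < e"
      using b(1) by (intro exI[of _ "max 0 b"]) auto
  qed
  then obtain f where f: "\<And>x. ((\<lambda>r. A r *\<^sub>V x) \<longlongrightarrow> f x) (at_left 1)" by metis
  have nontriv: "at_left (1::real) \<noteq> bot" by simp
  have add: "f (x + y) = f x + f y" for x y
    using tendsto_unique[OF nontriv f] tendsto_add[OF f f, of x y] by (simp add: cblinfun.add_right)
  have scale: "f (c *\<^sub>C x) = c *\<^sub>C f x" for c x
    using tendsto_unique[OF nontriv f] bounded_linear.tendsto[OF bounded_linear_scaleC f[of x], of c]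
    by (simp add: cblinfun_scaleC_right)
  have fle: "norm (f x) \<le> norm x" for x
  proof (rule tendsto_upperbound[OF tendsto_norm[OF f] _ nontriv])
    show "\<forall>\<^sub>F r in at_left 1. norm (A r *\<^sub>V x) \<le> norm x"
      unfolding eventually_at_left_field by (intro exI[of _ 0]) (auto intro: le)
  qed
  define B where "B = CBlinfun (Blinfun f)"
  have B: "B *\<^sub>V x = f x" for x
    unfolding B_def by (rule CBlinfun_apply[where K=1]) (simp_all add: add scale fle)
  have "closed {x. norm (B *\<^sub>V x) = norm x}"
    by (intro closed_Collect_eq continuous_intros bounded_linear.continuous_on[OF bounded_linear_cblinfun_apply])
  moreover have "D \<subseteq> {x. norm (B *\<^sub>V x) = norm x}"
  proof
    fix x assume "x \<in> D"
    from lim[OF this] obtain l where l: "norm l = norm x" "((\<lambda>r. A r *\<^sub>V x) \<longlongrightarrow> l) (at_left 1)" by blast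
    then have "f x = l" using tendsto_unique[OF nontriv f] by blast
    with l show "x \<in> {x. norm (B *\<^sub>V x) = norm x}" by (simp add: B)
  qed
  ultimately have "closure D \<subseteq> {x. norm (B *\<^sub>V x) = norm x}" by (intro closure_minimal)
  then have "cisometry B" unfolding D cisometry_def by blast
  then show ?thesis using f by (auto simp: B intro!: exI[of _ B])
qed

text \<open>Separability enters here: a countable dense set needs countably many null sets, and
  outside their union one boundary operator works for all vectors.\<close>

lemma inner_if_isometry:
  fixes T :: "(nat, 'e::{chilbert_space, second_countable_topology}) ell2 \<Rightarrow>\<^sub>C\<^sub>L (nat, 'e) ell2"
  assumes T: "multiplier T \<Theta>" and iso: "cisometry T" and H: "\<Theta> \<in> H_infinity"
  shows "inner_function \<Theta>"
proof -
  obtain D :: "'e set" where D: "countable D" "\<And>U. open U \<Longrightarrow> U \<noteq> {} \<Longrightarrow> \<exists>d\<in>D. d \<in> U"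
    by (rule countable_dense_setE) blast
  have cl: "closure D = UNIV"
  proof (rule ccontr)
    assume "closure D \<noteq> UNIV"
    then obtain d where "d \<in> D" "d \<in> - closure D" using D(2)[of "- closure D"] by auto
    then show False using closure_subset by blast
  qed
  have nT: "norm T \<le> 1" by (rule norm_cblinfun_bound) (use iso in \<open>simp_all add: cisometry_def\<close>)
  have "AE t in lebesgue_on {0..2 * pi}. \<forall>x\<in>D. \<exists>l. norm l = norm x \<and>
      ((\<lambda>r. \<Theta> (complex_of_real r * cis t) *\<^sub>V x) \<longlongrightarrow> l) (at_left 1)"
    by (subst AE_ball_countable[OF D(1)]) (intro ballI boundary_vector_isometric[OF T iso])
  then have "AE t in lebesgue_on {0..2 * pi}.
      \<exists>B. has_boundary_value \<Theta> (cis t) B \<and> cadjoint B o\<^sub>C\<^sub>L B = id_cblinfun"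
  proof eventually_elim
    case (elim t)
    have "norm (\<Theta> (complex_of_real r * cis t)) \<le> 1" if "0 < r" "r < 1" for r
      by (rule order_trans[OF multiplier_norm_le[OF T] nT]) (use that in \<open>simp add: norm_mult\<close>)
    from strong_limit_from_dense[of "\<lambda>r. \<Theta> (complex_of_real r * cis t)", OF this cl] elim show ?case
      unfolding has_boundary_value_def cisometry_iff_cadjoint by blast
  qed
  with H show ?thesis by (simp add: inner_function_def)
qed

subsection \<open>Invertible and unitary multipliers\<close>

lemma vector_power_series:
  fixes H :: "complex \<Rightarrow> 'e::chilbert_space"
  assumes hol: "\<And>y. (\<lambda>z. cinner y (H z)) holomorphic_on ball 0 1"
    and bound: "\<And>r. 0 < r \<Longrightarrow> r < 1 \<Longrightarrow> \<exists>B\<ge>0. \<forall>z. cmod z \<le> r \<longrightarrow> norm (H z) \<le> B"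
  obtains h where "\<And>z. cmod z < 1 \<Longrightarrow> summable (\<lambda>k. norm (z ^ k *\<^sub>C h k))"
    "\<And>z. cmod z < 1 \<Longrightarrow> power_sum h z = H z"
proof -
  define c where "c k y = (deriv ^^ k) (\<lambda>z. cinner y (H z)) 0 / fact k" for k y
  have add: "c k (x + y) = c k x + c k y" for k x y
    unfolding c_def cinner_add_left
    by (subst higher_deriv_add[OF hol hol open_ball]) (simp_all add: add_divide_distrib)
  have scale: "c k (a *\<^sub>C y) = cnj a * c k y" for k a y
    unfolding c_def cinner_scaleC_left
    by (subst higher_deriv_cmult[OF hol _ open_ball]) simp_all
  have est: "\<exists>B\<ge>0. \<forall>k y. cmod (c k y) \<le> norm y * B / r ^ k" if r: "0 < r" "r < 1" for r
  proof -
    obtain B where B: "0 \<le> B" "\<And>z. cmod z \<le> r \<Longrightarrow> norm (H z) \<le> B" using bound[OF r] by blast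
    have "cmod ((deriv ^^ k) (\<lambda>z. cinner y (H z)) 0) \<le> fact k * (norm y * B) / r ^ k" for k y
    proof (rule Cauchy_inequality)
      show "(\<lambda>z. cinner y (H z)) holomorphic_on ball 0 r"
        by (rule holomorphic_on_subset[OF hol]) (use r in auto)
      show "continuous_on (cball 0 r) (\<lambda>z. cinner y (H z))"
        by (rule holomorphic_on_imp_continuous_on[OF holomorphic_on_subset[OF hol]]) (use r in auto)
      show "cmod (cinner y (H z)) \<le> norm y * B" if "cmod (0 - z) = r" for z
        using that by (intro order_trans[OF cinner_Cauchy_Schwarz] mult_left_mono B) auto
    qed (rule r)
    then have "cmod (c k y) \<le> norm y * B / r ^ k" for k y
      by (simp add: c_def norm_divide divide_le_eq mult.commute)
    with B(1) show ?thesis by blast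
  qed
  have "\<exists>h. \<forall>y. c k y = cinner y h" for k
  proof -
    obtain B where "\<And>k y. cmod (c k y) \<le> norm y * B / (1/2) ^ k" using est[of "1/2"] by auto
    then show ?thesis
      by (intro riesz_representation[OF add scale, where K="B / (1/2) ^ k"]) (simp add: mult.commute)
  qed
  then obtain h where h: "\<And>k y. c k y = cinner y (h k)" by metis
  have summ: "summable (\<lambda>k. norm (z ^ k *\<^sub>C h k))" if z: "cmod z < 1" for z
  proof -
    obtain r where r: "cmod z < r" "r < 1" using dense[OF z] by blast
    then have r0: "0 < r" using norm_ge_zero[of z] by linarith
    obtain B where B: "0 \<le> B" "\<And>k y. cmod (c k y) \<le> norm y * B / r ^ k" using est[OF r0 r(2)] by auto
    have hk: "norm (h k) \<le> B / r ^ k" for k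
    proof (cases "h k = 0")
      case False
      \<comment> \<open>Testing the Cauchy estimate on \<open>y = h k\<close> and cancelling one
        factor bounds the norm of the coefficient.\<close>
      have "norm (h k) * norm (h k) \<le> norm (h k) * (B / r ^ k)"
        using B(2)[of k "h k"] by (simp add: h cinner_self power2_eq_square norm_mult)
      then show ?thesis by (rule mult_left_le_imp_le) (use False in simp)
    qed (use B r0 in simp)
    show ?thesis
    proof (rule summable_comparison_test')
      show "summable (\<lambda>k. B * (cmod z / r) ^ k)"
        using r r0 by (intro summable_mult summable_geometric) simp
      show "norm (norm (z ^ k *\<^sub>C h k)) \<le> B * (cmod z / r) ^ k" if "k \<ge> 0" for k
        using mult_left_mono[OF hk[of k], of "cmod z ^ k"]
        by (simp add: norm_scaleC norm_power power_divide mult.commute)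
    qed
  qed
  have "power_sum h z = H z" if z: "cmod z < 1" for z
  proof (rule cinner_eqI)
    fix y
    have "(\<lambda>k. z ^ k *\<^sub>C h k) sums power_sum h z"
      unfolding power_sum_def by (rule summable_sums[OF summable_norm_cancel[OF summ[OF z]]])
    from bounded_linear.sums[OF bounded_linear_cinner_right this]
    have "(\<lambda>k. z ^ k * cinner y (h k)) sums cinner y (power_sum h z)"
      by (simp add: cinner_scaleC_right)
    moreover have "(\<lambda>k. z ^ k * cinner y (h k)) sums cinner y (H z)"
      using holomorphic_power_series[OF hol, of z y] z
      by (simp add: h[symmetric] c_def mult.commute)
    ultimately show "cinner y (power_sum h z) = cinner y (H z)" by (rule sums_unique2)
  qed
  with summ show thesis by (rule that)
qed

lemma H_infinity_bounded:
  assumes "F \<in> H_infinity"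
  shows "\<exists>K. \<forall>z. cmod z < 1 \<longrightarrow> norm (F z) \<le> K"
proof -
  from assms have "bounded (F ` ball 0 1)" by (simp add: H_infinity_def)
  then obtain K where "\<forall>x\<in>F ` ball 0 1. norm x \<le> K" by (auto simp: bounded_iff)
  then show ?thesis by (intro exI[of _ K]) simp
qed

lemma H_infinity_cong:
  assumes F: "F \<in> H_infinity" and eq: "\<And>z. z \<in> ball 0 1 \<Longrightarrow> F z = G z"
  shows "G \<in> H_infinity"
  unfolding H_infinity_def mem_Collect_eq
proof (intro conjI ballI)
  have "G ` ball 0 1 = F ` ball 0 1" using eq by (intro image_cong) simp_all
  then show "bounded (G ` ball 0 1)" using F by (simp add: H_infinity_def)
  fix z :: complex assume z: "z \<in> ball 0 1"
  then obtain D where "(F has_derivative (\<lambda>h. h *\<^sub>C D)) (at z)"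
    using F unfolding H_infinity_def by blast
  then have "(G has_derivative (\<lambda>h. h *\<^sub>C D)) (at z)"
    by (rule has_derivative_transform_within_open[OF _ open_ball z eq])
  then show "\<exists>D. (G has_derivative (\<lambda>h. h *\<^sub>C D)) (at z)" by blast
qed

lemma H_infinity_const: "(\<lambda>_. A) \<in> H_infinity"
proof -
  have "((\<lambda>_. A) has_derivative (\<lambda>h. h *\<^sub>C 0)) (at z)" for z :: complex
    by simp
  moreover have "bounded ((\<lambda>_. A) ` ball (0::complex) 1)" by (rule boundedI[of _ "norm A"]) auto
  ultimately show ?thesis unfolding H_infinity_def by blast
qed

lemma invertible_symbol_if_invertible_multiplier:
  fixes T :: "(nat, 'e::chilbert_space) ell2 \<Rightarrow>\<^sub>C\<^sub>L (nat, 'e) ell2"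
  assumes T: "multiplier T \<Theta>" and H: "\<Theta> \<in> H_infinity" and inv: "cinvertible T"
  shows "invertible_in_H_infinity \<Theta>"
proof -
  obtain R where R: "\<And>f. R *\<^sub>V T *\<^sub>V f = f" "\<And>f. T *\<^sub>V R *\<^sub>V f = f"
    using inv by (auto simp: cinvertible_iff)
  have "R *\<^sub>V ell2_push Suc *\<^sub>V f = ell2_push Suc *\<^sub>V R *\<^sub>V f" for f
  proof -
    have "ell2_push Suc *\<^sub>V R *\<^sub>V f = R *\<^sub>V T *\<^sub>V ell2_push Suc *\<^sub>V R *\<^sub>V f"
      by (simp only: R)
    also have "T *\<^sub>V ell2_push Suc *\<^sub>V R *\<^sub>V f = ell2_push Suc *\<^sub>V T *\<^sub>V R *\<^sub>V f"
      by (rule multiplier_shift_commutes[OF T])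
    finally show ?thesis by (simp only: R)
  qed
  then have M: "multiplier R (power_sum (multiplier_coeff R))" by (rule multiplier_if_shift_commutes)
  let ?\<Psi> = "power_sum (multiplier_coeff R)"
  have inv: "is_cinverse (\<Theta> z) (?\<Psi> z)" if z: "cmod z < 1" for z
  proof -
    have "\<Theta> z *\<^sub>V ?\<Psi> z *\<^sub>V x = x" "?\<Psi> z *\<^sub>V \<Theta> z *\<^sub>V x = x" for x
      using multiplierD[OF T z, of "R *\<^sub>V ell2_single 0 x"] multiplierD[OF M z, of "T *\<^sub>V ell2_single 0 x"]
      by (simp_all add: R multiplierD[OF T z] multiplierD[OF M z] power_sum_ell2_single)
    then show ?thesis by (simp add: is_cinverse_def cblinfun_compose_eq_id_iff)
  qed
  have "(\<lambda>z. cinverse (\<Theta> z)) \<in> H_infinity"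
    by (rule H_infinity_cong[OF multiplier_H_infinity[OF M norm_multiplier_coeff]])
      (simp add: cinverse_eqI[OF inv])
  moreover have "\<forall>z\<in>ball 0 1. cinvertible (\<Theta> z)"
    unfolding cinvertible_def using inv by (metis dist_0_norm mem_ball)
  ultimately show ?thesis using H by (simp only: invertible_in_H_infinity_def simp_thms)
qed

text \<open>The pointwise estimate through the inverse symbol is integrated over circles whose radii
  tend to 1. It will supply both injectivity of \<open>T\<close> and boundedness of its
  inverse.\<close>

lemma multiplier_bounded_below:
  fixes T :: "(nat, 'e::chilbert_space) ell2 \<Rightarrow>\<^sub>C\<^sub>L (nat, 'e) ell2"
  assumes T: "multiplier T \<Theta>"
    and \<Psi>: "\<And>z x. cmod z < 1 \<Longrightarrow> \<Psi> z *\<^sub>V \<Theta> z *\<^sub>V x = x" "\<And>z. cmod z < 1 \<Longrightarrow> norm (\<Psi> z) \<le> K"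
  shows "norm f \<le> K * norm (T *\<^sub>V f)"
proof -
  have K: "0 \<le> K" by (rule order_trans[OF norm_ge_zero \<Psi>(2)[of 0]]) simp
  let ?I = "\<lambda>f n. integral {0..2 * pi} (\<lambda>t. (norm (power_sum (ell2_nth f) (complex_of_real (radius_seq n) * cis t)))\<^sup>2)"
  have pt: "(norm (power_sum (ell2_nth f) z))\<^sup>2 \<le> K\<^sup>2 * (norm (power_sum (ell2_nth (T *\<^sub>V f)) z))\<^sup>2"
    if z: "cmod z < 1" for z
  proof -
    have "norm (power_sum (ell2_nth f) z) = norm (\<Psi> z *\<^sub>V power_sum (ell2_nth (T *\<^sub>V f)) z)"
      by (simp add: multiplierD[OF T z] \<Psi>(1)[OF z])
    also have "\<dots> \<le> K * norm (power_sum (ell2_nth (T *\<^sub>V f)) z)"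
      by (intro order_trans[OF norm_cblinfun] mult_right_mono \<Psi>(2) z) simp
    finally show ?thesis unfolding power_mult_distrib[symmetric] by (rule power_mono) simp
  qed
  have "2 * pi * (norm f)\<^sup>2 \<le> K\<^sup>2 * (2 * pi * (norm (T *\<^sub>V f))\<^sup>2)"
  proof (rule LIMSEQ_le[OF radial_means_tendsto[of f]])
    show "(\<lambda>n. K\<^sup>2 * ?I (T *\<^sub>V f) n) \<longlonglongrightarrow> K\<^sup>2 * (2 * pi * (norm (T *\<^sub>V f))\<^sup>2)"
      by (intro tendsto_mult_left radial_means_tendsto)
    have "?I f n \<le> K\<^sup>2 * ?I (T *\<^sub>V f) n" for n
    proof -
      have "?I f n \<le> integral {0..2 * pi} (\<lambda>t. K\<^sup>2 *
          (norm (power_sum (ell2_nth (T *\<^sub>V f)) (complex_of_real (radius_seq n) * cis t)))\<^sup>2)"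
        by (intro integral_le integrable_on_mult_right has_integral_integrable[OF parseval_ell2]
            radius_seq_bounds pt) (use radius_seq_bounds[of n] in \<open>simp add: norm_mult\<close>)
      then show ?thesis by simp
    qed
    then show "\<exists>N. \<forall>n\<ge>N. ?I f n \<le> K\<^sup>2 * ?I (T *\<^sub>V f) n" by blast
  qed
  then have "(norm f)\<^sup>2 \<le> (K * norm (T *\<^sub>V f))\<^sup>2" by (simp add: power_mult_distrib)
  then show ?thesis by (rule power2_le_imp_le) (simp add: K)
qed

text \<open>Supplies preimages under an invertible multiplier. The product is weakly holomorphic and
  bounded on smaller discs, hence a power series, and comparing means over circles makes its
  coefficients square-summable.\<close>

lemma H_infinity_times_ell2:
  fixes g :: "(nat, 'e::chilbert_space) ell2"
  assumes \<Psi>: "\<Psi> \<in> H_infinity"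
  obtains f :: "(nat, 'e) ell2" where
    "\<And>z. cmod z < 1 \<Longrightarrow> power_sum (ell2_nth f) z = \<Psi> z *\<^sub>V power_sum (ell2_nth g) z"
proof -
  obtain K where K: "\<And>z. cmod z < 1 \<Longrightarrow> norm (\<Psi> z) \<le> K"
    using H_infinity_bounded[OF \<Psi>] by blast
  have K0: "0 \<le> K" by (rule order_trans[OF norm_ge_zero K[of 0]]) simp
  let ?H = "\<lambda>z. \<Psi> z *\<^sub>V power_sum (ell2_nth g) z"
  have Hle: "norm (?H z) \<le> K * norm (power_sum (ell2_nth g) z)" if "cmod z < 1" for z
    by (intro order_trans[OF norm_cblinfun] mult_right_mono K that) simp
  have hol: "(\<lambda>z. cinner y (?H z)) holomorphic_on ball 0 1" for y
    unfolding holomorphic_on_def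
  proof
    fix z :: complex assume z: "z \<in> ball 0 1"
    obtain D where D: "(\<Psi> has_derivative (\<lambda>h. h *\<^sub>C D)) (at z)"
      using \<Psi> z unfolding H_infinity_def by blast
    have z1: "cmod z < 1" using z by simp
    obtain E where E: "(power_sum (ell2_nth g) has_derivative (\<lambda>h. h *\<^sub>C E)) (at z)"
      using has_derivative_power_sum[where a="ell2_nth g", OF norm_ell2_nth_le z1] by blast
    let ?P = "power_sum (ell2_nth g) z"
    let ?c = "cinner y (\<Psi> z *\<^sub>V E) + cinner y (D *\<^sub>V ?P)"
    have eq: "(\<lambda>h. cinner y (\<Psi> z *\<^sub>V h *\<^sub>C E + (h *\<^sub>C D) *\<^sub>V ?P)) = (*) ?c"
      by (rule ext) (simp add: cblinfun_scaleC_right scaleC_cblinfun_apply cinner_add_right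
          cinner_scaleC_right algebra_simps)
    note deriv = cblinfun.FDERIV[OF D E]
    have "((\<lambda>z. cinner y (?H z)) has_derivative (\<lambda>h. cinner y (\<Psi> z *\<^sub>V h *\<^sub>C E + (h *\<^sub>C D) *\<^sub>V ?P))) (at z)"
      by (rule bounded_linear.has_derivative[OF bounded_linear_cinner_right deriv])
    then have "((\<lambda>z. cinner y (?H z)) has_field_derivative ?c) (at z)"
      unfolding has_field_derivative_def eq .
    then have "(\<lambda>z. cinner y (?H z)) field_differentiable at z"
      unfolding field_differentiable_def by (rule exI)
    then show "(\<lambda>z. cinner y (?H z)) field_differentiable at z within ball 0 1"
      by (rule field_differentiable_at_within)
  qed
  have bd: "\<exists>B\<ge>0. \<forall>z. cmod z \<le> r \<longrightarrow> norm (?H z) \<le> B" if r: "0 < r" "r < 1" for r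
  proof -
    let ?B = "K * ((1 / sqrt (1 - r\<^sup>2)) * norm g)"
    have r2: "r\<^sup>2 < 1" using r by (simp add: abs_square_less_1)
    have "norm (?H z) \<le> ?B" if z: "cmod z \<le> r" for z
    proof -
      have z1: "cmod z < 1" using z r by simp
      have "(cmod z)\<^sup>2 \<le> r\<^sup>2" using z by (intro power_mono) auto
      then have "(norm g)\<^sup>2 / (1 - (cmod z)\<^sup>2) \<le> (norm g)\<^sup>2 / (1 - r\<^sup>2)"
        using r2 by (intro divide_left_mono mult_pos_pos) auto
      then have "norm (power_sum (ell2_nth g) z) \<le> sqrt ((norm g)\<^sup>2 / (1 - r\<^sup>2))"
        by (intro real_le_rsqrt order_trans[OF norm_power_sum_ell2_le[OF z1]])
      then have "norm (power_sum (ell2_nth g) z) \<le> (1 / sqrt (1 - r\<^sup>2)) * norm g"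
        by (simp add: real_sqrt_divide)
      then show ?thesis by (intro order_trans[OF Hle[OF z1]] mult_left_mono K0)
    qed
    moreover have "0 \<le> ?B" using K0 r2 by (intro mult_nonneg_nonneg) auto
    ultimately show ?thesis by blast
  qed
  obtain h :: "nat \<Rightarrow> 'e" where h: "\<And>z. cmod z < 1 \<Longrightarrow> summable (\<lambda>k. norm (z ^ k *\<^sub>C h k))"
    "\<And>z. cmod z < 1 \<Longrightarrow> power_sum h z = ?H z"
    using vector_power_series[OF hol bd] by blast
  let ?I = "\<lambda>n. integral {0..2 * pi} (\<lambda>t. (norm (power_sum (ell2_nth g) (complex_of_real (radius_seq n) * cis t)))\<^sup>2)"
  \<comment> \<open>The number \<open>N\<close> of coefficients stays fixed while the radius tends
    to 1. Bounding every finite sum then yields square summability without exchanging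
    limits.\<close>
  have part: "2 * pi * (\<Sum>k<N. radius_seq n ^ (2 * k) * (norm (h k))\<^sup>2) \<le> K\<^sup>2 * ?I n" for n N
  proof -
    let ?q = "complex_of_real (radius_seq n)"
    have q: "cmod ?q < 1" "cmod (?q * cis t) < 1" for t
      using radius_seq_bounds[of n] by (simp_all add: norm_mult)
    have d: "(norm (?q ^ k *\<^sub>C h k))\<^sup>2 = radius_seq n ^ (2 * k) * (norm (h k))\<^sup>2" for k
      using radius_seq_bounds[of n]
      by (simp add: norm_scaleC norm_power power_mult_distrib power_even_eq)
    have s: "summable (\<lambda>k. (norm (?q ^ k *\<^sub>C h k))\<^sup>2)"
      using cinner.summable_abs[OF h(1)[OF q(1)] h(1)[OF q(1)]]
      by (simp add: cinner_self norm_power)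
    note P = parseval[OF h(1)[OF q(1)], of 0]
    have "2 * pi * (\<Sum>k<N. (norm (?q ^ k *\<^sub>C h k))\<^sup>2) \<le> 2 * pi * (\<Sum>k. (norm (?q ^ k *\<^sub>C h k))\<^sup>2)"
      by (intro mult_left_mono sum_le_suminf s) auto
    also have "\<dots> \<le> integral {0..2 * pi} (\<lambda>t. K\<^sup>2 * (norm (power_sum (ell2_nth g) (?q * cis t)))\<^sup>2)"
    proof (rule has_integral_le)
      show "((\<lambda>t. (norm (power_sum (\<lambda>k. ?q ^ k *\<^sub>C h k) (cis t)))\<^sup>2) has_integral
          2 * pi * (\<Sum>k. (norm (?q ^ k *\<^sub>C h k))\<^sup>2)) {0..2 * pi}" using P by simp
      show "((\<lambda>t. K\<^sup>2 * (norm (power_sum (ell2_nth g) (?q * cis t)))\<^sup>2) has_integral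
          integral {0..2 * pi} (\<lambda>t. K\<^sup>2 * (norm (power_sum (ell2_nth g) (?q * cis t)))\<^sup>2)) {0..2 * pi}"
        by (intro integrable_integral integrable_on_mult_right has_integral_integrable[OF parseval_ell2]
            radius_seq_bounds)
      show "(norm (power_sum (\<lambda>k. ?q ^ k *\<^sub>C h k) (cis t)))\<^sup>2
          \<le> K\<^sup>2 * (norm (power_sum (ell2_nth g) (?q * cis t)))\<^sup>2" for t
        unfolding power_sum_scale h(2)[OF q(2)] power_mult_distrib[symmetric]
        by (rule power_mono[OF Hle[OF q(2)]]) simp
    qed
    finally show ?thesis unfolding d by simp
  qed
  have "2 * pi * (\<Sum>k<N. (norm (h k))\<^sup>2) \<le> K\<^sup>2 * (2 * pi * (norm g)\<^sup>2)" for N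
  proof (rule LIMSEQ_le)
    have "(\<lambda>n. 2 * pi * (\<Sum>k<N. radius_seq n ^ (2 * k) * (norm (h k))\<^sup>2))
        \<longlonglongrightarrow> 2 * pi * (\<Sum>k<N. 1 ^ (2 * k) * (norm (h k))\<^sup>2)"
      by (intro tendsto_intros radius_seq_tendsto)
    then show "(\<lambda>n. 2 * pi * (\<Sum>k<N. radius_seq n ^ (2 * k) * (norm (h k))\<^sup>2))
        \<longlonglongrightarrow> 2 * pi * (\<Sum>k<N. (norm (h k))\<^sup>2)" by simp
    show "(\<lambda>n. K\<^sup>2 * ?I n) \<longlonglongrightarrow> K\<^sup>2 * (2 * pi * (norm g)\<^sup>2)"
      by (intro tendsto_mult_left radial_means_tendsto)
  qed (use part in blast)
  then have "(\<Sum>k<N. (norm (h k))\<^sup>2) \<le> K\<^sup>2 * (norm g)\<^sup>2" for N by (simp add: mult.left_commute)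
  then have "summable (\<lambda>k. norm ((norm (h k))\<^sup>2))"
    by (intro bounded_imp_summable[where B="K\<^sup>2 * (norm g)\<^sup>2"])
      (simp_all add: lessThan_Suc_atMost[symmetric] del: sum.lessThan_Suc)
  then have "(\<lambda>k. (norm (h k))\<^sup>2) summable_on UNIV"
    by (rule norm_summable_imp_summable_on)
  then have "ell2_nth (Abs_ell2 h) = h" by (simp add: Abs_ell2_inverse)
  then show thesis using that[of "Abs_ell2 h"] h(2) by simp
qed

lemma invertible_multiplier_if_invertible_symbol:
  fixes T :: "(nat, 'e::chilbert_space) ell2 \<Rightarrow>\<^sub>C\<^sub>L (nat, 'e) ell2"
  assumes T: "multiplier T \<Theta>" and inv: "invertible_in_H_infinity \<Theta>"
  shows "cinvertible T"
proof -
  define \<Psi> where "\<Psi> z = cinverse (\<Theta> z)" for z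
  have \<Psi>: "\<Psi> \<in> H_infinity" using inv by (simp add: invertible_in_H_infinity_def \<Psi>_def[abs_def])
  have "is_cinverse (\<Theta> z) (\<Psi> z)" if "cmod z < 1" for z
  proof -
    have "z \<in> ball 0 1" using that by simp
    then obtain B where B: "is_cinverse (\<Theta> z) B"
      using inv unfolding invertible_in_H_infinity_def cinvertible_def by blast
    then show ?thesis by (simp only: \<Psi>_def cinverse_eqI[OF B])
  qed
  then have left: "\<Psi> z *\<^sub>V \<Theta> z *\<^sub>V x = x" and right: "\<Theta> z *\<^sub>V \<Psi> z *\<^sub>V x = x" if "cmod z < 1" for z x
    using that by (simp_all add: is_cinverse_def cblinfun_compose_eq_id_iff)
  obtain K where K: "\<And>z. cmod z < 1 \<Longrightarrow> norm (\<Psi> z) \<le> K"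
    using H_infinity_bounded[OF \<Psi>] by blast
  have below: "norm f \<le> K * norm (T *\<^sub>V f)" for f
    by (rule multiplier_bounded_below[OF T left K])
  have inj: "f = g" if "T *\<^sub>V f = T *\<^sub>V g" for f g
    using below[of "f - g"] that by (simp add: cblinfun.diff_right)
  have "\<exists>f. T *\<^sub>V f = g" for g
  proof -
    obtain f where f: "\<And>z. cmod z < 1 \<Longrightarrow> power_sum (ell2_nth f) z = \<Psi> z *\<^sub>V power_sum (ell2_nth g) z"
      using H_infinity_times_ell2[OF \<Psi>] by blast
    have "T *\<^sub>V f = g"
      by (rule power_sum_ell2_unique) (simp add: multiplierD[OF T] f right)
    then show ?thesis by blast
  qed
  \<comment> \<open>A choice of preimages; injectivity of \<open>T\<close> makes it linear, and the
    lower bound makes it bounded.\<close>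
  then obtain S where S: "\<And>g. T *\<^sub>V S g = g" by metis
  have "CBlinfun (Blinfun S) *\<^sub>V g = S g" for g
  proof (rule CBlinfun_apply)
    show "S (x + y) = S x + S y" for x y by (rule inj) (simp add: S cblinfun.add_right)
    show "S (c *\<^sub>C x) = c *\<^sub>C S x" for c x by (rule inj) (simp add: S cblinfun_scaleC_right)
    show "norm (S x) \<le> K * norm x" for x using below[of "S x"] by (simp add: S)
  qed
  moreover have "S (T *\<^sub>V f) = f" for f by (rule inj) (rule S)
  ultimately show ?thesis unfolding cinvertible_iff by (intro exI[of _ "CBlinfun (Blinfun S)"]) (simp add: S)
qed

text \<open>A unitary multiplier also commutes with the adjoint of the shift, whose kernel consists of
  the constants.\<close>

lemma constant_unitary_if_unitary_multiplier:
  fixes T :: "(nat, 'e::chilbert_space) ell2 \<Rightarrow>\<^sub>C\<^sub>L (nat, 'e) ell2"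
  assumes T: "multiplier T \<Theta>" and H: "\<Theta> \<in> H_infinity" and iso: "cisometry T" and inv: "cinvertible T"
  shows "constant_unitary \<Theta>"
proof -
  obtain R where R: "\<And>f. T *\<^sub>V R *\<^sub>V f = f" using inv by (auto simp: cinvertible_iff)
  have Suc0: "ell2_nth (T *\<^sub>V ell2_single 0 x) (Suc k) = 0" for x k
  proof (rule cinner_eqI)
    fix y :: 'e
    let ?f = "ell2_single k y"
    \<comment> \<open>Writing the monomial as \<open>T\<close> applied to a shifted vector lets the
      isometry cancel \<open>T\<close> in the inner product; what remains pairs a shifted vector
      with a constant.\<close>
    have "ell2_single (Suc k) y = ell2_push Suc *\<^sub>V T *\<^sub>V R *\<^sub>V ?f"
      by (simp add: R ell2_push_single)
    also have "\<dots> = T *\<^sub>V ell2_push Suc *\<^sub>V R *\<^sub>V ?f"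
      by (rule multiplier_shift_commutes[OF T, symmetric])
    finally have "cinner (ell2_single (Suc k) y) (T *\<^sub>V ell2_single 0 x)
        = cinner (ell2_push Suc *\<^sub>V R *\<^sub>V ?f) (ell2_single 0 x)"
      using iso by (simp add: cisometry_iff_cinner)
    also have "\<dots> = cnj (cinner (ell2_single 0 x) (ell2_push Suc *\<^sub>V R *\<^sub>V ?f))"
      by (rule cinner_commute)
    also have "\<dots> = 0"
      by (simp add: cinner_single ell2_push_nth_outside cinner.zero_right)
    finally show "cinner y (ell2_nth (T *\<^sub>V ell2_single 0 x) (Suc k)) = cinner y 0"
      by (simp add: cinner_single cinner.zero_right)
  qed
  define U where "U = multiplier_coeff T 0"
  have single: "T *\<^sub>V ell2_single 0 x = ell2_single 0 (U *\<^sub>V x)" for x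
  proof (rule ell2_eqI)
    fix k show "ell2_nth (T *\<^sub>V ell2_single 0 x) k = ell2_nth (ell2_single 0 (U *\<^sub>V x)) k"
      by (cases k) (simp_all add: Suc0 ell2_nth_single U_def multiplier_coeff_apply)
  qed
  have U: "\<Theta> z = U" if "cmod z < 1" for z
  proof (rule cblinfun_eqI)
    fix x show "\<Theta> z *\<^sub>V x = U *\<^sub>V x"
      using multiplierD[OF T that, of "ell2_single 0 x"] by (simp add: single power_sum_ell2_single)
  qed
  have "cisometry U"
    unfolding cisometry_def
  proof
    fix x
    have "norm (T *\<^sub>V ell2_single 0 x) = norm (ell2_single 0 x :: (nat, 'e) ell2)"
      using iso by (simp only: cisometry_def)
    then show "norm (U *\<^sub>V x) = norm x" by (simp only: single norm_single)
  qed
  moreover have "cinvertible U"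
    using invertible_symbol_if_invertible_multiplier[OF T H inv] U[of 0]
    by (auto simp: invertible_in_H_infinity_def)
  ultimately show ?thesis using U by (auto simp: constant_unitary_def cunitary_iff)
qed

lemma constant_unitary_imp:
  fixes \<Theta> :: "complex \<Rightarrow> 'e::chilbert_space \<Rightarrow>\<^sub>C\<^sub>L 'e"
  assumes "constant_unitary \<Theta>"
  shows "inner_function \<Theta>" "invertible_in_H_infinity \<Theta>"
proof -
  obtain U where U: "cunitary U" "\<And>z. z \<in> ball 0 1 \<Longrightarrow> \<Theta> z = U"
    using assms by (auto simp: constant_unitary_def)
  have H: "\<Theta> \<in> H_infinity" by (rule H_infinity_cong[OF H_infinity_const[of U]]) (simp add: U)
  have "has_boundary_value \<Theta> (cis t) U" for t
    unfolding has_boundary_value_def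
  proof
    fix x
    have "\<forall>\<^sub>F r in at_left 1. U *\<^sub>V x = \<Theta> (complex_of_real r * cis t) *\<^sub>V x"
      unfolding eventually_at_left_field
      by (intro exI[of _ 0]) (auto simp: U(2) norm_mult)
    then show "((\<lambda>r. \<Theta> (complex_of_real r * cis t) *\<^sub>V x) \<longlongrightarrow> U *\<^sub>V x) (at_left 1)"
      by (rule Lim_transform_eventually[OF tendsto_const])
  qed
  then show "inner_function \<Theta>"
    using H U(1) by (auto simp: inner_function_def cunitary_def intro!: AE_I2)
  have inv: "is_cinverse U (cadjoint U)" using U(1) by (simp add: cunitary_def is_cinverse_def)
  have "(\<lambda>z. cinverse (\<Theta> z)) \<in> H_infinity"
    by (rule H_infinity_cong[OF H_infinity_const[of "cadjoint U"]]) (simp add: U(2) cinverse_eqI[OF inv])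
  then show "invertible_in_H_infinity \<Theta>"
    using H inv U(2) by (auto simp: invertible_in_H_infinity_def cinvertible_def)
qed

subsection \<open>Compression to a reducing block\<close>

text \<open>\<open>J\<close> embeds the block isometrically and \<open>J\<close> after
  \<open>Q\<close> projects orthogonally onto it. By \<open>identity_off\<close>, \<open>A\<close>
  is triangular for this splitting: the compression \<open>T\<close> on the block, the identity on
  the complement, and one corner from the block to the complement.\<close>

locale block_compression =
  fixes J :: "'h::chilbert_space \<Rightarrow>\<^sub>C\<^sub>L 'k::chilbert_space" and Q :: "'k \<Rightarrow>\<^sub>C\<^sub>L 'h" and A :: "'k \<Rightarrow>\<^sub>C\<^sub>L 'k"
  assumes QJ: "Q *\<^sub>V J *\<^sub>V c = c"
    and adj: "cinner (J *\<^sub>V c) g = cinner c (Q *\<^sub>V g)"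
    and identity_off: "Q *\<^sub>V f = 0 \<Longrightarrow> A *\<^sub>V f = f"
begin

abbreviation "T \<equiv> Q o\<^sub>C\<^sub>L A o\<^sub>C\<^sub>L J"

lemma decompose: "A *\<^sub>V f = A *\<^sub>V J *\<^sub>V Q *\<^sub>V f + (f - J *\<^sub>V Q *\<^sub>V f)"
proof -
  have "A *\<^sub>V (f - J *\<^sub>V Q *\<^sub>V f) = f - J *\<^sub>V Q *\<^sub>V f"
    by (rule identity_off) (simp add: cblinfun.diff_right QJ)
  then show ?thesis by (simp add: cblinfun.diff_right algebra_simps)
qed

lemma TQ: "T *\<^sub>V Q *\<^sub>V f = Q *\<^sub>V A *\<^sub>V f"
  using arg_cong[OF decompose[of f], of "(*\<^sub>V) Q"]
  by (simp add: cblinfun.add_right cblinfun.diff_right QJ)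

lemma norm_J: "norm (J *\<^sub>V c) = norm c"
proof -
  have "cisometry J" by (simp add: cisometry_iff_cinner adj QJ)
  then show ?thesis by (simp add: cisometry_def)
qed

lemma invertible_iff: "cinvertible A \<longleftrightarrow> cinvertible T"
proof
  assume "cinvertible A"
  then obtain S where S: "\<And>f. S *\<^sub>V A *\<^sub>V f = f" "\<And>f. A *\<^sub>V S *\<^sub>V f = f" by (auto simp: cinvertible_iff)
  \<comment> \<open>The inverse also fixes the complement, so its block component depends on the
    block component of the argument alone.\<close>
  have SJ: "Q *\<^sub>V S *\<^sub>V J *\<^sub>V Q *\<^sub>V f = Q *\<^sub>V S *\<^sub>V f" for f
  proof -
    let ?g = "f - J *\<^sub>V Q *\<^sub>V f"
    have "Q *\<^sub>V ?g = 0" by (simp add: cblinfun.diff_right QJ)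
    then have "S *\<^sub>V ?g = ?g" using S(1)[of ?g] by (simp add: identity_off)
    then have "Q *\<^sub>V S *\<^sub>V ?g = 0" using \<open>Q *\<^sub>V ?g = 0\<close> by simp
    then show ?thesis by (simp add: cblinfun.diff_right)
  qed
  have "T *\<^sub>V Q *\<^sub>V S *\<^sub>V J *\<^sub>V c = c" for c
    unfolding TQ by (simp add: S QJ)
  moreover have "Q *\<^sub>V S *\<^sub>V J *\<^sub>V T *\<^sub>V c = c" for c
  proof -
    have "Q *\<^sub>V S *\<^sub>V J *\<^sub>V T *\<^sub>V Q *\<^sub>V J *\<^sub>V c = c" unfolding TQ SJ by (simp add: S QJ)
    then show ?thesis by (simp only: QJ)
  qed
  ultimately show "cinvertible T"
    unfolding cinvertible_iff by (intro exI[of _ "Q o\<^sub>C\<^sub>L S o\<^sub>C\<^sub>L J"]) simp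
next
  assume "cinvertible T"
  then obtain R where R: "\<And>c. R *\<^sub>V Q *\<^sub>V A *\<^sub>V J *\<^sub>V c = c" "\<And>c. Q *\<^sub>V A *\<^sub>V J *\<^sub>V R *\<^sub>V c = c"
    by (auto simp: cinvertible_iff)
  \<comment> \<open>The inverse of a triangular block operator: \<open>R\<close> acts on the block,
    and subtracting \<open>A J R Q g\<close> from \<open>g\<close> leaves a vector of the complement
    because \<open>R\<close> is a right inverse of \<open>T\<close>.\<close>
  let ?S = "J o\<^sub>C\<^sub>L R o\<^sub>C\<^sub>L Q + (id_cblinfun - A o\<^sub>C\<^sub>L J o\<^sub>C\<^sub>L R o\<^sub>C\<^sub>L Q)"
  have S: "?S *\<^sub>V g = J *\<^sub>V R *\<^sub>V Q *\<^sub>V g + (g - A *\<^sub>V J *\<^sub>V R *\<^sub>V Q *\<^sub>V g)" for g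
    by (simp add: cblinfun.add_left cblinfun.diff_left)
  have "A *\<^sub>V ?S *\<^sub>V g = g" for g
  proof -
    have "A *\<^sub>V (g - A *\<^sub>V J *\<^sub>V R *\<^sub>V Q *\<^sub>V g) = g - A *\<^sub>V J *\<^sub>V R *\<^sub>V Q *\<^sub>V g"
      by (rule identity_off) (simp add: cblinfun.diff_right R)
    then show ?thesis unfolding S cblinfun.add_right by simp
  qed
  moreover have "?S *\<^sub>V A *\<^sub>V f = f" for f
  proof -
    have RQ: "R *\<^sub>V Q *\<^sub>V A *\<^sub>V f = Q *\<^sub>V f" using R(1)[of "Q *\<^sub>V f"] TQ[of f] by simp
    show ?thesis unfolding S RQ using decompose[of f] by (simp add: algebra_simps)
  qed
  ultimately show "cinvertible A" unfolding cinvertible_iff by blast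
qed

lemma isometry_iff: "cisometry A \<longleftrightarrow> cisometry T \<and> (\<forall>c. A *\<^sub>V J *\<^sub>V c = J *\<^sub>V T *\<^sub>V c)"
proof
  assume A: "cisometry A"
  have inv: "A *\<^sub>V J *\<^sub>V c = J *\<^sub>V T *\<^sub>V c" for c
  proof -
    \<comment> \<open>The part of \<open>A J c\<close> outside the block. As \<open>A\<close> fixes
      \<open>g\<close> and preserves inner products, \<open>g\<close> is orthogonal to
      \<open>A J c\<close> as well as to the block, hence to itself.\<close>
    define g where "g = A *\<^sub>V J *\<^sub>V c - J *\<^sub>V Q *\<^sub>V A *\<^sub>V J *\<^sub>V c"
    have Qg: "Q *\<^sub>V g = 0" by (simp add: g_def cblinfun.diff_right QJ)
    have "cinner (A *\<^sub>V J *\<^sub>V c) g = cinner (A *\<^sub>V J *\<^sub>V c) (A *\<^sub>V g)" by (simp add: identity_off[OF Qg])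
    also have "\<dots> = cinner (J *\<^sub>V c) g" using A by (simp add: cisometry_iff_cinner)
    also have "\<dots> = 0" by (simp add: adj Qg cinner.zero_right)
    finally have "cinner g g = 0"
      by (subst g_def) (simp add: cinner.diff_left adj Qg cinner.zero_right)
    then have "g = 0" by (simp add: cinner_self)
    then show ?thesis by (simp add: g_def)
  qed
  have "norm (T *\<^sub>V c) = norm c" for c
    using A inv[of c] norm_J[of "T *\<^sub>V c"] norm_J[of c] by (simp add: cisometry_def)
  with inv show "cisometry T \<and> (\<forall>c. A *\<^sub>V J *\<^sub>V c = J *\<^sub>V T *\<^sub>V c)" by (simp add: cisometry_def)
next
  assume T: "cisometry T \<and> (\<forall>c. A *\<^sub>V J *\<^sub>V c = J *\<^sub>V T *\<^sub>V c)"
  show "cisometry A"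
    unfolding cisometry_def
  proof
    fix f
    let ?g = "f - J *\<^sub>V Q *\<^sub>V f"
    have orth: "cinner (J *\<^sub>V c) ?g = 0" for c
      by (simp add: adj cblinfun.diff_right QJ cinner.zero_right)
    have "(norm (A *\<^sub>V f))\<^sup>2 = (norm (J *\<^sub>V T *\<^sub>V Q *\<^sub>V f + ?g))\<^sup>2"
      using T by (simp only: decompose[of f])
    also have "\<dots> = (norm (Q *\<^sub>V f))\<^sup>2 + (norm ?g)\<^sup>2"
      using T by (simp only: norm_add_orthogonal[OF orth] norm_J cisometry_def)
    also have "\<dots> = (norm (J *\<^sub>V Q *\<^sub>V f + ?g))\<^sup>2"
      by (simp only: norm_add_orthogonal[OF orth] norm_J)
    finally show "norm (A *\<^sub>V f) = norm f" by simp
  qed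
qed

end

lemma isometric_isomorphism_compose:
  assumes V: "\<And>f. U *\<^sub>V V *\<^sub>V f = f" "\<And>f. V *\<^sub>V U *\<^sub>V f = f" "cisometry V"
  shows "cisometry (V o\<^sub>C\<^sub>L W) \<longleftrightarrow> cisometry W" "cinvertible (V o\<^sub>C\<^sub>L W) \<longleftrightarrow> cinvertible W"
proof -
  show "cisometry (V o\<^sub>C\<^sub>L W) \<longleftrightarrow> cisometry W" using V(3) by (simp add: cisometry_def)
  show "cinvertible (V o\<^sub>C\<^sub>L W) \<longleftrightarrow> cinvertible W"
  proof
    assume "cinvertible (V o\<^sub>C\<^sub>L W)"
    then obtain B where B: "\<And>x. B *\<^sub>V V *\<^sub>V W *\<^sub>V x = x" "\<And>x. V *\<^sub>V W *\<^sub>V B *\<^sub>V x = x"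
      by (auto simp: cinvertible_iff)
    have "W *\<^sub>V B *\<^sub>V V *\<^sub>V x = x" for x
    proof -
      have "U *\<^sub>V V *\<^sub>V W *\<^sub>V B *\<^sub>V V *\<^sub>V x = U *\<^sub>V V *\<^sub>V x" by (simp only: B)
      then show ?thesis by (simp only: V)
    qed
    then show "cinvertible W" unfolding cinvertible_iff using B by (intro exI[of _ "B o\<^sub>C\<^sub>L V"]) simp
  next
    assume "cinvertible W"
    then obtain B where "\<And>x. B *\<^sub>V W *\<^sub>V x = x" "\<And>x. W *\<^sub>V B *\<^sub>V x = x" by (auto simp: cinvertible_iff)
    then show "cinvertible (V o\<^sub>C\<^sub>L W)"
      unfolding cinvertible_iff using V by (intro exI[of _ "B o\<^sub>C\<^sub>L U"]) simp
  qed
qed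


subsection \<open>The odometer on words\<close>

primrec odometer :: "'n::{finite, linorder} list \<Rightarrow> 'n list"
  where "odometer [] = []"
  | "odometer (a # w) = (if a = letter_max then letter_one # odometer w else letter_succ a # w)"

text \<open>A successor is never the first letter; this separates an incremented letter from a
  carried one in the injectivity of the odometer.\<close>

lemma letter_succ:
  fixes a :: "'n::{finite, linorder}"
  assumes "a \<noteq> letter_max"
  shows "a < letter_succ a" "a < b \<Longrightarrow> letter_succ a \<le> b" "letter_succ a \<noteq> letter_one"
proof -
  have "a \<le> letter_max" unfolding letter_max_def by (rule Max_ge) simp_all
  with assms have "a < letter_max" by simp
  then have "{b. a < b} \<noteq> {}" by blast
  then have "letter_succ a \<in> {b. a < b}" unfolding letter_succ_def by (intro Min_in) simp_all
  then show less: "a < letter_succ a" by simp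
  show "letter_succ a \<le> b" if "a < b" unfolding letter_succ_def using that by (intro Min_le) simp_all
  have "letter_one \<le> a" unfolding letter_one_def by (rule Min_le) simp_all
  with less show "letter_succ a \<noteq> letter_one" by auto
qed

lemma letter_succ_inject:
  assumes "a \<noteq> letter_max" "b \<noteq> letter_max" "letter_succ a = letter_succ b"
  shows "a = b"
  using letter_succ(1,2)[OF assms(1)] letter_succ(1,2)[OF assms(2)] assms(3)
  by (metis linorder_neqE not_le)

lemma inj_odometer: "inj (odometer :: 'n::{finite, linorder} list \<Rightarrow> _)"
proof (rule injI)
  fix u v :: "'n list"
  show "odometer u = odometer v \<Longrightarrow> u = v"
  proof (induction u arbitrary: v)
    case Nil
    then show ?case by (cases v) (auto split: if_splits)
  next
    case (Cons a u)
    then obtain b v' where v: "v = b # v'" by (cases v) (auto split: if_splits)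
    show ?case
      using Cons letter_succ(3)[of a] letter_succ(3)[of b] letter_succ_inject[of a b]
      by (auto simp: v split: if_splits)
  qed
qed

lemma length_odometer: "length (odometer w) = length w"
  by (induction w) auto

text \<open>The odometer preserves length, and an injective self-map of the finite set of words of a
  given length is onto.\<close>

lemma bij_odometer: "bij (odometer :: 'n::{finite, linorder} list \<Rightarrow> _)"
proof -
  have "v \<in> range odometer" for v :: "'n list"
  proof -
    let ?A = "{w :: 'n list. length w = length v}"
    have "finite ?A" using finite_lists_length_eq[of "UNIV :: 'n set" "length v"] by simp
    moreover have "odometer ` ?A \<subseteq> ?A" by (auto simp: length_odometer)
    ultimately have "odometer ` ?A = ?A"
      by (rule endo_inj_surj) (rule inj_on_subset[OF inj_odometer subset_UNIV])
    then show ?thesis by blast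
  qed
  then show ?thesis using inj_odometer by (auto simp: bij_def)
qed

lemma odometer_replicate: "odometer (replicate m letter_max) = replicate m letter_one"
  by (induction m) simp_all

lemma odometer_eq:
  assumes "k < length w" "w ! k \<noteq> letter_max" "\<forall>i<k. w ! i = letter_max"
  shows "odometer w = replicate k letter_one @ [letter_succ (w ! k)] @ drop (Suc k) w"
  using assms
proof (induction w arbitrary: k)
  case (Cons a w)
  show ?case
  proof (cases k)
    case (Suc j)
    have "a = letter_max" using Cons.prems Suc by force
    moreover have "\<forall>i<j. w ! i = letter_max" using Cons.prems(3) Suc by (metis Suc_mono nth_Cons_Suc)
    ultimately show ?thesis using Cons Suc by simp
  qed (use Cons.prems in simp)
qed simp

lemma first_letter_ne:
  assumes "w \<notin> range (\<lambda>m. replicate m a)"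
  obtains k where "k < length w" "w ! k \<noteq> a" "\<forall>i<k. w ! i = a"
proof -
  have "\<exists>k. k < length w \<and> w ! k \<noteq> a"
  proof (rule ccontr)
    assume "\<nexists>k. k < length w \<and> w ! k \<noteq> a"
    then have "w = replicate (length w) a" by (intro nth_equalityI) auto
    with assms show False by blast
  qed
  then obtain k where "k < length w \<and> w ! k \<noteq> a" "\<forall>i<k. \<not> (i < length w \<and> w ! i \<noteq> a)"
    using exists_least_iff[of "\<lambda>k. k < length w \<and> w ! k \<noteq> a"] by blast
  then show thesis by (intro that[of k]) auto
qed

lemma inj_replicate: "inj (\<lambda>m. replicate m a)"
  by (rule injI) (metis length_replicate)

lemma ell2_push_pull_support:
  fixes f :: "('j, 'e::chilbert_space) ell2"
  assumes "inj \<sigma>" "\<And>j. j \<notin> range \<sigma> \<Longrightarrow> ell2_nth f j = 0"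
  shows "ell2_push \<sigma> *\<^sub>V ell2_pull \<sigma> *\<^sub>V f = f"
proof (rule ell2_eqI)
  fix j show "ell2_nth (ell2_push \<sigma> *\<^sub>V ell2_pull \<sigma> *\<^sub>V f) j = ell2_nth f j"
    by (cases "j \<in> range \<sigma>") (auto simp: assms ell2_push_nth_outside ell2_pull_nth)
qed

text \<open>The coordinate conditions cut out a closed subspace containing the generators;
  conversely, the finite partial sums of a family satisfying them lie in the span and converge to
  it.\<close>

lemma M_perp_iff:
  fixes f :: "('n::{finite, linorder}, 'e::chilbert_space) fock"
  shows "f \<in> M_perp \<longleftrightarrow> (\<forall>v. v \<notin> range (\<lambda>m. replicate m letter_one) \<longrightarrow> ell2_nth f v = 0)"
proof
  let ?G = "{basis_tensor (replicate m letter_one) \<xi> | m \<xi>. True} :: ('n, 'e) fock set"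
  let ?Z = "{f :: ('n, 'e) fock. \<forall>v. v \<notin> range (\<lambda>m. replicate m letter_one) \<longrightarrow> ell2_nth f v = 0}"
  have "?Z = (\<Inter>v\<in>- range (\<lambda>m. replicate m letter_one). {f. ell2_coord v *\<^sub>V f = 0})"
    by (auto simp: ell2_coord_apply)
  moreover have "closed {f :: ('n, 'e) fock. ell2_coord v *\<^sub>V f = 0}" for v
    by (intro closed_Collect_eq continuous_intros bounded_linear.continuous_on[OF bounded_linear_cblinfun_apply])
  ultimately have "closed ?Z" by (simp only:) (rule closed_INT, blast)
  moreover have "cspan ?G \<subseteq> ?Z"
  proof (rule complex_vector.span_minimal)
    show "?G \<subseteq> ?Z" by (auto simp: ell2_nth_single)
    show "complex_vector.subspace ?Z"
      by (rule complex_vector.subspaceI) auto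
  qed
  ultimately have "M_perp \<subseteq> ?Z" unfolding M_perp_def by (intro closure_minimal)
  then show "\<forall>v. v \<notin> range (\<lambda>m. replicate m letter_one) \<longrightarrow> ell2_nth f v = 0" if "f \<in> M_perp"
    using that by blast
  assume f: "\<forall>v. v \<notin> range (\<lambda>m. replicate m letter_one) \<longrightarrow> ell2_nth f v = 0"
  have "ell2_single v (ell2_nth f v) \<in> cspan ?G" for v
  proof (cases "v \<in> range (\<lambda>m. replicate m letter_one)")
    case True
    then show ?thesis by (intro complex_vector.span_base) auto
  next
    case False
    then have "ell2_single v (ell2_nth f v) = 0" using f by (intro ell2_eqI) (simp add: ell2_nth_single)
    then show ?thesis by (simp add: complex_vector.span_zero)
  qed
  then have "(\<Sum>v\<in>F. ell2_single v (ell2_nth f v)) \<in> closure (cspan ?G)" for F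
    using closure_subset by (intro subsetD[OF closure_subset] complex_vector.span_sum)
  then show "f \<in> M_perp"
    unfolding M_perp_def using ell2_has_sum[of f] unfolding has_sum_def
    by (intro Lim_in_closed_set[OF closed_closure _ finite_subsets_at_top_neq_bot]) (auto intro: always_eventually)
qed


subsection \<open>The odometer map as a block operator\<close>

locale odometer_map =
  fixes L :: "'e::chilbert_space \<Rightarrow>\<^sub>C\<^sub>L ('n::{finite, linorder}, 'e) fock" and W :: "('n, 'e) fock \<Rightarrow>\<^sub>C\<^sub>L ('n, 'e) fock"
  assumes W: "is_odometer_map L W"
begin

definition max_word :: "nat \<Rightarrow> 'n list" where "max_word m = replicate m letter_max"

definition one_word :: "nat \<Rightarrow> 'n list" where "one_word m = replicate m letter_one"

abbreviation J :: "(nat, 'e) ell2 \<Rightarrow>\<^sub>C\<^sub>L ('n, 'e) fock" where "J \<equiv> ell2_push max_word"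

abbreviation Q :: "('n, 'e) fock \<Rightarrow>\<^sub>C\<^sub>L (nat, 'e) ell2" where "Q \<equiv> ell2_pull max_word"

abbreviation A :: "('n, 'e) fock \<Rightarrow>\<^sub>C\<^sub>L ('n, 'e) fock" where "A \<equiv> ell2_pull odometer o\<^sub>C\<^sub>L W"

lemma inj_max_word: "inj max_word" and inj_one_word: "inj one_word"
  using inj_replicate by (simp_all add: max_word_def[abs_def] one_word_def[abs_def])

lemma W_max_word: "W *\<^sub>V basis_tensor (max_word m) x = left_tensor (one_word m) (L *\<^sub>V x)"
proof (cases m)
  case 0
  have "left_tensor [] f = f" for f :: "('n, 'e) fock"
    by (rule ell2_eqI) (simp add: left_tensor.rep_eq)
  then show ?thesis using W 0 by (simp add: is_odometer_map_def max_word_def one_word_def)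
next
  case (Suc k)
  then have "1 \<le> m" by simp
  then show ?thesis using W unfolding is_odometer_map_def max_word_def one_word_def by blast
qed

lemma W_other_word:
  assumes "w \<notin> range max_word"
  shows "W *\<^sub>V basis_tensor w x = basis_tensor (odometer w) x"
proof -
  obtain k where k: "k < length w" "w ! k \<noteq> letter_max" "\<forall>i<k. w ! i = letter_max"
    using first_letter_ne[of w letter_max] assms unfolding max_word_def[abs_def] by blast
  then show ?thesis using W unfolding is_odometer_map_def odometer_eq[OF k] by blast
qed

lemma odometer_max_word: "odometer (max_word m) = one_word m"
  by (simp add: max_word_def one_word_def odometer_replicate)

lemma odometer_other_word: "odometer w \<notin> range one_word \<longleftrightarrow> w \<notin> range max_word"
  using injD[OF inj_odometer] by (auto simp: odometer_max_word[symmetric])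

sublocale block_compression J Q A
proof
  fix c :: "(nat, 'e) ell2" and f g :: "('n, 'e) fock"
  show "Q *\<^sub>V J *\<^sub>V c = c" by (rule ell2_pull_push[OF inj_max_word])
  show "cinner (J *\<^sub>V c) g = cinner c (Q *\<^sub>V g)"
    by (metis cinner_commute cinner_push)
  \<comment> \<open>Unlike the implication from \<open>Q f = 0\<close>, this decomposition is an
    identity between bounded linear maps of \<open>f\<close>, so it can be verified on elementary
    tensors.\<close>
  have "A *\<^sub>V f = A *\<^sub>V J *\<^sub>V Q *\<^sub>V f + (f - J *\<^sub>V Q *\<^sub>V f)"
  proof (rule eq_on_singlesI[where f=f])
    fix w and x :: 'e
    show "A *\<^sub>V ell2_single w x
        = A *\<^sub>V J *\<^sub>V Q *\<^sub>V ell2_single w x + (ell2_single w x - J *\<^sub>V Q *\<^sub>V ell2_single w x)"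
    proof (cases "w \<in> range max_word")
      case True
      then have "J *\<^sub>V Q *\<^sub>V ell2_single w x = ell2_single w x"
        by (auto simp: ell2_pull_single ell2_push_single inj_max_word)
      then show ?thesis by simp
    next
      case False
      then have "Q *\<^sub>V ell2_single w x = 0"
        by (intro ell2_eqI) (auto simp: ell2_pull_nth[OF inj_max_word] ell2_nth_single)
      moreover have "A *\<^sub>V ell2_single w x = ell2_single w x"
        by (simp add: W_other_word[OF False] ell2_pull_single inj_odometer)
      ultimately show ?thesis by (simp add: cblinfun.zero_right)
    qed
  qed (intro bounded_linear_cblinfun_apply bounded_linear_add bounded_linear_sub bounded_linear_ident
      bounded_linear_compose[OF bounded_linear_cblinfun_apply])+
  then show "A *\<^sub>V f = f" if "Q *\<^sub>V f = 0" using that by (simp add: cblinfun.zero_right)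
qed

text \<open>A lower triangular Toeplitz matrix: \<open>W\<close> prefixes \<open>m\<close> letters 1
  to \<open>L x\<close>, so the entry depends on \<open>k - m\<close>.\<close>

lemma T_single: "ell2_nth (T *\<^sub>V ell2_single m x) k = (if m \<le> k then ell2_nth (L *\<^sub>V x) (one_word (k - m)) else 0)"
  by (auto simp: ell2_pull_nth inj_max_word inj_odometer ell2_push_single W_max_word odometer_max_word
      left_tensor.rep_eq one_word_def min_def)

lemma T_shift: "T *\<^sub>V ell2_push Suc *\<^sub>V f = ell2_push Suc *\<^sub>V T *\<^sub>V f"
proof (rule eq_on_singlesI[where f=f])
  show "bounded_linear (\<lambda>f. T *\<^sub>V ell2_push Suc *\<^sub>V f)" "bounded_linear (\<lambda>f. ell2_push Suc *\<^sub>V T *\<^sub>V f)"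
    by (intro bounded_linear_compose[OF bounded_linear_cblinfun_apply bounded_linear_cblinfun_apply])+
  fix m and x :: 'e
  show "T *\<^sub>V ell2_push Suc *\<^sub>V ell2_single m x = ell2_push Suc *\<^sub>V T *\<^sub>V ell2_single m x"
  proof (rule ell2_eqI)
    fix k
    show "ell2_nth (T *\<^sub>V ell2_push Suc *\<^sub>V ell2_single m x) k = ell2_nth (ell2_push Suc *\<^sub>V T *\<^sub>V ell2_single m x) k"
    proof (cases k)
      case 0
      then show ?thesis
        by (simp only: ell2_push_single[OF inj_Suc] T_single) (simp add: ell2_push_nth_outside)
    next
      case (Suc j)
      then show ?thesis
        by (simp only: ell2_push_single[OF inj_Suc] T_single ell2_push_nth[OF inj_Suc]) simp
    qed
  qed
qed

lemma multiplier_T: "multiplier T (analytic_symbol L)"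
proof -
  have "multiplier_coeff T r = symbol_coeff L r" for r
    by (rule cblinfun_eqI)
      (simp only: multiplier_coeff_apply T_single, simp add: symbol_coeff_def ell2_coord_apply one_word_def)
  then have "power_sum (multiplier_coeff T) = analytic_symbol L"
    by (simp add: fun_eq_iff power_sum_def analytic_symbol_def)
  with multiplier_if_shift_commutes[OF T_shift] show ?thesis by simp
qed

lemma symbol_H_infinity: "analytic_symbol L \<in> H_infinity"
proof -
  have eq: "analytic_symbol L = power_sum (symbol_coeff L)"
    by (simp add: fun_eq_iff power_sum_def analytic_symbol_def)
  have "norm (symbol_coeff L r) \<le> norm L" for r
    by (rule norm_cblinfun_bound)
      (auto simp: symbol_coeff_def ell2_coord_apply intro: order_trans[OF norm_ell2_nth_le norm_cblinfun])
  with multiplier_T show ?thesis unfolding eq by (rule multiplier_H_infinity)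
qed

lemma invariant_iff: "(\<forall>c. A *\<^sub>V J *\<^sub>V c = J *\<^sub>V T *\<^sub>V c) \<longleftrightarrow> range (cblinfun_apply L) \<subseteq> M_perp"
proof
  assume inv: "\<forall>c. A *\<^sub>V J *\<^sub>V c = J *\<^sub>V T *\<^sub>V c"
  show "range (cblinfun_apply L) \<subseteq> M_perp"
  proof clarify
    fix x
    have "ell2_nth (L *\<^sub>V x) v = 0" if v: "v \<notin> range one_word" for v
    proof -
      obtain w where w: "v = odometer w" using bij_odometer by (metis bij_def surjD)
      have "ell2_nth (L *\<^sub>V x) v = ell2_nth (A *\<^sub>V J *\<^sub>V ell2_single 0 x) w"
        using W_max_word[of 0 x]
        by (simp add: w ell2_push_single inj_max_word ell2_pull_nth inj_odometer left_tensor.rep_eq one_word_def)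
      also have "\<dots> = ell2_nth (J *\<^sub>V T *\<^sub>V ell2_single 0 x) w" using inv by (simp only:)
      also have "\<dots> = 0"
        by (rule ell2_push_nth_outside[OF inj_max_word]) (use v odometer_other_word[of w] in \<open>simp add: w\<close>)
      finally show ?thesis .
    qed
    then show "L *\<^sub>V x \<in> M_perp" by (simp add: M_perp_iff one_word_def[abs_def])
  qed
next
  assume L: "range (cblinfun_apply L) \<subseteq> M_perp"
  have L0: "ell2_nth (L *\<^sub>V x) v = 0" if "v \<notin> range one_word" for x v
    using L that M_perp_iff[of "L *\<^sub>V x"] by (auto simp: one_word_def[abs_def])
  show "\<forall>c. A *\<^sub>V J *\<^sub>V c = J *\<^sub>V T *\<^sub>V c"
  proof
    fix c
    show "A *\<^sub>V J *\<^sub>V c = J *\<^sub>V T *\<^sub>V c"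
    proof (rule eq_on_singlesI[where f=c])
      show "bounded_linear (\<lambda>c. A *\<^sub>V J *\<^sub>V c)" "bounded_linear (\<lambda>c. J *\<^sub>V T *\<^sub>V c)"
        by (intro bounded_linear_compose[OF bounded_linear_cblinfun_apply bounded_linear_cblinfun_apply])+
      fix m and x :: 'e
      have "ell2_nth (A *\<^sub>V J *\<^sub>V ell2_single m x) w = 0" if w: "w \<notin> range max_word" for w
      proof -
        have "ell2_nth (A *\<^sub>V J *\<^sub>V ell2_single m x) w = ell2_nth (left_tensor (one_word m) (L *\<^sub>V x)) (odometer w)"
          by (simp add: ell2_push_single inj_max_word ell2_pull_nth inj_odometer W_max_word)
        also have "\<dots> = 0"
        proof (cases "take m (odometer w) = one_word m")
          case True
          \<comment> \<open>Otherwise the whole word would consist of letters 1, making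
            \<open>w\<close> a power of the last letter.\<close>
          have "drop m (odometer w) \<notin> range one_word"
          proof
            assume "drop m (odometer w) \<in> range one_word"
            then obtain k where "drop m (odometer w) = one_word k" by blast
            then have "odometer w = one_word (m + k)"
              using True append_take_drop_id[of m "odometer w"] by (simp add: one_word_def replicate_add)
            with w odometer_other_word[of w] show False by blast
          qed
          then show ?thesis using True by (simp add: left_tensor.rep_eq L0) (simp add: one_word_def L0)
        next
          case False
          then show ?thesis by (simp add: left_tensor.rep_eq one_word_def)
        qed
        finally show ?thesis .
      qed
      from ell2_push_pull_support[OF inj_max_word this]
      show "A *\<^sub>V J *\<^sub>V ell2_single m x = J *\<^sub>V T *\<^sub>V ell2_single m x" by simp
    qed
  qed
qed

lemma isometry_W_iff: "cisometry W \<longleftrightarrow> cisometry T \<and> range (cblinfun_apply L) \<subseteq> M_perp"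
  and invertible_W_iff: "cinvertible W \<longleftrightarrow> cinvertible T"
proof -
  note bij = bij_odometer and inj = inj_odometer
  have V: "ell2_push odometer *\<^sub>V ell2_pull odometer *\<^sub>V f = f"
    "ell2_pull odometer *\<^sub>V ell2_push odometer *\<^sub>V f = f" for f :: "('n, 'e) fock"
    by (simp_all add: bij inj)
  have "norm (ell2_pull odometer *\<^sub>V f) = norm f" for f :: "('n, 'e) fock"
    using cisometry_push[OF inj, where 'e='e] V(1)[of f] unfolding cisometry_def by metis
  then have "cisometry (ell2_pull odometer :: ('n, 'e) fock \<Rightarrow>\<^sub>C\<^sub>L _)" by (simp add: cisometry_def)
  note iso = isometric_isomorphism_compose[OF V this, of W]
  show "cisometry W \<longleftrightarrow> cisometry T \<and> range (cblinfun_apply L) \<subseteq> M_perp"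
    using iso(1) isometry_iff invariant_iff by blast
  show "cinvertible W \<longleftrightarrow> cinvertible T"
    using iso(2) invertible_iff by blast
qed

end

section \<open>The three equivalences for the odometer map\<close>

theorem theorem4p4:
  fixes L :: "'e::{chilbert_space, second_countable_topology} \<Rightarrow>\<^sub>C\<^sub>L
      ('n::{finite, linorder}, 'e) fock"
    and W :: "('n, 'e) fock \<Rightarrow>\<^sub>C\<^sub>L ('n, 'e) fock"
    and \<Theta> :: "complex \<Rightarrow> 'e \<Rightarrow>\<^sub>C\<^sub>L 'e"
  assumes "is_odometer_map L W"
    and "\<Theta> = analytic_symbol L"
  shows "(cisometry W \<longleftrightarrow> range (cblinfun_apply L) \<subseteq> M_perp \<and> inner_function \<Theta>) \<and>
    (cunitary W \<longleftrightarrow> range (cblinfun_apply L) \<subseteq> M_perp \<and> constant_unitary \<Theta>) \<and>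
    (cinvertible W \<longleftrightarrow> invertible_in_H_infinity \<Theta>)"
proof -
  interpret odometer_map L W by unfold_locales (rule assms(1))
  have T: "multiplier T \<Theta>" and H: "\<Theta> \<in> H_infinity"
    using multiplier_T symbol_H_infinity by (simp_all only: assms(2))
  have iso: "cisometry T \<longleftrightarrow> inner_function \<Theta>"
    using isometry_if_inner[OF T] inner_if_isometry[OF T _ H] by blast
  have inv: "cinvertible T \<longleftrightarrow> invertible_in_H_infinity \<Theta>"
    using invertible_symbol_if_invertible_multiplier[OF T H]
      invertible_multiplier_if_invertible_symbol[OF T] by blast
  have "cisometry T \<and> cinvertible T \<longleftrightarrow> constant_unitary \<Theta>"
    using constant_unitary_if_unitary_multiplier[OF T H] constant_unitary_imp[of \<Theta>] iso inv by blast
  then show ?thesis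
    using isometry_W_iff invertible_W_iff cunitary_iff[of W] iso inv by blast
qed

end
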